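(* Assume $m\ge 2$. There exists a polynomial-time deterministic online algorithm with kill-and-restart for minimizing total flow time on $m$ identical machines that is $O(\sqrt{n/m})$-competitive against the optimal offline preemptive schedule.
   Context: Online scheduling of $n$ jobs on $m$ identical machines; each job $j$ has release time $r_j\ge0$ and processing time $p_j>0$, becomes known only at $r_j$, and $n,m$ are known in advance. Each machine processes at most one job at a time. Kill-and-restart model: the algorithm may terminate a running job; its processed work is lost and it must later be run again from scratch for $p_j$ uninterrupted time units, possibly on a different machine. Flow time of $j$ is $C_j-r_j$; the objective is total flow time $F$. $\mathrm{OPT}(J)$ is the minimum total flow time over offline preemptive schedules without migration (jobs may be interrupted and later resumed on the same machine without loss). $\Gamma$-competitive means $F(\mathrm{ALG}(J))\le\Gamma\cdot\mathrm{OPT}(J)$ for every instance $J$.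
   Formalization: The bound O(√(n/m)) is stated as O(max(1, √(n/m))): for n ≥ m it is the claimed bound, while for n < m, where √(n/m) < 1 and no algorithm can beat ratio 1 (e.g. one job and many machines), the ratio is O(1). *)

theory Defs
  imports Complex_Main "HOL-Library.Log_Nat"
begin

section \<open>Instances and schedules\<close>

text \<open>A job is a pair (release time, processing time).  An instance lists its jobs in order of
  release; job \<open>j\<close> is the entry at position \<open>j\<close>, counted from 0.\<close>

type_synonym 'a job = "'a \<times> 'a"

abbreviation release :: "'a job \<Rightarrow> 'a" where "release \<equiv> fst"
abbreviation proc :: "'a job \<Rightarrow> 'a" where "proc \<equiv> snd"

definition is_instance :: "real job list \<Rightarrow> bool" where
  "is_instance J \<longleftrightarrow> sorted (map release J) \<and> (\<forall>x\<in>set J. 0 \<le> release x \<and> 0 < proc x)"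

text \<open>In a run the machine executes the job without interruption during the half-open interval
  from \<open>start\<close> to \<open>stop\<close>.\<close>

record run =
  job :: nat
  machine :: nat
  start :: real
  stop :: real

type_synonym schedule = "run set"

definition disjoint_time :: "run \<Rightarrow> run \<Rightarrow> bool" where
  "disjoint_time a b \<longleftrightarrow> stop a \<le> start b \<or> stop b \<le> start a"

text \<open>The requirements common to both models: no machine executes two jobs at a time, and no job
  is executed twice at a time.\<close>

definition valid_runs :: "nat \<Rightarrow> real job list \<Rightarrow> schedule \<Rightarrow> bool" where
  "valid_runs m J S \<longleftrightarrow> finite S \<and>
     (\<forall>a\<in>S. job a < length J \<and> machine a < m \<and> release (J ! job a) \<le> start a \<and> start a < stop a) \<and>
     (\<forall>a\<in>S. \<forall>b\<in>S. a \<noteq> b \<and> (machine a = machine b \<or> job a = job b) \<longrightarrow> disjoint_time a b)"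

text \<open>Kill-and-restart: the last run of a job is uninterrupted and has its full length; all
  earlier ones were killed before finishing, and contribute nothing.\<close>

definition kill_restart_schedule :: "nat \<Rightarrow> real job list \<Rightarrow> schedule \<Rightarrow> bool" where
  "kill_restart_schedule m J S \<longleftrightarrow> valid_runs m J S \<and>
     (\<forall>j<length J. \<exists>a\<in>S. job a = j \<and> stop a - start a = proc (J ! j) \<and>
        (\<forall>b\<in>S. job b = j \<and> b \<noteq> a \<longrightarrow> stop b - start b < proc (J ! j) \<and> stop b \<le> start a))"

definition preemptive_schedule :: "nat \<Rightarrow> real job list \<Rightarrow> schedule \<Rightarrow> bool" where
  "preemptive_schedule m J S \<longleftrightarrow> valid_runs m J S \<and>
     (\<forall>a\<in>S. \<forall>b\<in>S. job a = job b \<longrightarrow> machine a = machine b) \<and>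
     (\<forall>j<length J. (\<Sum>a | a \<in> S \<and> job a = j. stop a - start a) = proc (J ! j))"

definition completion :: "schedule \<Rightarrow> nat \<Rightarrow> real" where
  "completion S j = Max (stop ` {a \<in> S. job a = j})"

definition total_flow_time :: "real job list \<Rightarrow> schedule \<Rightarrow> real" where
  "total_flow_time J S = (\<Sum>j<length J. completion S j - release (J ! j))"

definition OPT :: "nat \<Rightarrow> real job list \<Rightarrow> real" where
  "OPT m J = Inf {total_flow_time J S | S. preemptive_schedule m J S}"


section \<open>Deterministic online algorithms\<close>

text \<open>For fixed \<open>n\<close> and \<open>m\<close>, an algorithm maps the list of jobs released so far to the runs it
  carries out as long as no further job is released.  Processing times are known from the release
  on, so releases are the only source of new information.  When the remaining jobs
  arrive the schedule may change, but only in what lies in the future: all starts and all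
  terminations (completions or kills) up to time \<open>t\<close> are determined by the jobs released up to
  \<open>t\<close>.  As \<open>n\<close> is known in advance, a schedule for fewer than \<open>n\<close> jobs need not complete them.\<close>

definition revealed :: "real \<Rightarrow> real job list \<Rightarrow> real job list" where
  "revealed t J = filter (\<lambda>x. release x \<le> t) J"

definition same_until :: "real \<Rightarrow> schedule \<Rightarrow> schedule \<Rightarrow> bool" where
  "same_until t S S' \<longleftrightarrow>
     (\<lambda>a. (job a, machine a, start a)) ` {a \<in> S. start a \<le> t} =
     (\<lambda>a. (job a, machine a, start a)) ` {a \<in> S'. start a \<le> t} \<and>
     {a \<in> S. stop a \<le> t} = {a \<in> S'. stop a \<le> t}"

definition kill_restart_online :: "nat \<Rightarrow> nat \<Rightarrow> (real job list \<Rightarrow> schedule) \<Rightarrow> bool" where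
  "kill_restart_online n m alg \<longleftrightarrow>
     (\<forall>J. is_instance J \<and> length J = n \<longrightarrow>
        kill_restart_schedule m J (alg J) \<and>
        (\<forall>t. same_until t (alg (revealed t J)) (alg J)))"

definition competitive :: "nat \<Rightarrow> nat \<Rightarrow> real \<Rightarrow> (real job list \<Rightarrow> schedule) \<Rightarrow> bool" where
  "competitive n m \<Gamma> alg \<longleftrightarrow>
     (\<forall>J. is_instance J \<and> length J = n \<longrightarrow> total_flow_time J (alg J) \<le> \<Gamma> * OPT m J)"


section \<open>Polynomial time\<close>

text \<open>A first-order, call-by-value language over integers and pairs.  Integer operations are
  charged the bit lengths of their operands; all other steps cost 1, since pairs are passed
  by reference and never compared or copied.  This is the logarithmic cost criterion for random
  access machines, so polynomial time agrees with polynomial time on Turing machines.  Functions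
  take one argument; variables are de Bruijn indices; 0 is false.\<close>

datatype val = VNum int | VPair val val

datatype iop = IAdd | ISub | IMul | IDiv | ILess

fun iop_sem :: "iop \<Rightarrow> int \<Rightarrow> int \<Rightarrow> int" where
  "iop_sem IAdd a b = a + b"
| "iop_sem ISub a b = a - b"
| "iop_sem IMul a b = a * b"
| "iop_sem IDiv a b = a div b"
| "iop_sem ILess a b = of_bool (a < b)"

datatype exp =
    EVar nat
  | ENum int
  | EOp iop exp exp
  | EPair exp exp
  | EFst exp
  | ESnd exp
  | EIsPair exp
  | EIf exp exp exp
  | ELet exp exp
  | ECall nat exp

text \<open>Entry \<open>f\<close> of the list is the body of function \<open>f\<close>; execution starts with function 0.\<close>

type_synonym program = "exp list"

definition int_size :: "int \<Rightarrow> nat" where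
  "int_size a = 1 + floorlog 2 (nat \<bar>a\<bar>)"

inductive big_step :: "program \<Rightarrow> val list \<Rightarrow> exp \<Rightarrow> val \<Rightarrow> nat \<Rightarrow> bool" for P where
  Var: "i < length env \<Longrightarrow> big_step P env (EVar i) (env ! i) 1"
| Num: "big_step P env (ENum a) (VNum a) (int_size a)"
| Op: "big_step P env e1 (VNum a) t1 \<Longrightarrow> big_step P env e2 (VNum b) t2 \<Longrightarrow>
     big_step P env (EOp f e1 e2) (VNum (iop_sem f a b)) (t1 + t2 + int_size a + int_size b)"
| Pair: "big_step P env e1 v1 t1 \<Longrightarrow> big_step P env e2 v2 t2 \<Longrightarrow>
     big_step P env (EPair e1 e2) (VPair v1 v2) (t1 + t2 + 1)"
| Fst: "big_step P env e (VPair v1 v2) t \<Longrightarrow> big_step P env (EFst e) v1 (t + 1)"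
| Snd: "big_step P env e (VPair v1 v2) t \<Longrightarrow> big_step P env (ESnd e) v2 (t + 1)"
| IsPair_True: "big_step P env e (VPair v1 v2) t \<Longrightarrow> big_step P env (EIsPair e) (VNum 1) (t + 1)"
| IsPair_False: "big_step P env e (VNum a) t \<Longrightarrow> big_step P env (EIsPair e) (VNum 0) (t + 1)"
| If_True: "big_step P env e (VNum a) t \<Longrightarrow> a \<noteq> 0 \<Longrightarrow> big_step P env e1 v t1 \<Longrightarrow>
     big_step P env (EIf e e1 e2) v (t + t1 + 1)"
| If_False: "big_step P env e (VNum 0) t \<Longrightarrow> big_step P env e2 v t2 \<Longrightarrow>
     big_step P env (EIf e e1 e2) v (t + t2 + 1)"
| Let: "big_step P env e1 v1 t1 \<Longrightarrow> big_step P (v1 # env) e2 v t2 \<Longrightarrow>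
     big_step P env (ELet e1 e2) v (t1 + t2 + 1)"
| Call: "f < length P \<Longrightarrow> big_step P env e v1 t1 \<Longrightarrow> big_step P [v1] (P ! f) v t2 \<Longrightarrow>
     big_step P env (ECall f e) v (t1 + t2 + 1)"

inductive_cases big_step_elims:
  "big_step P env (EVar i) v t"
  "big_step P env (ENum a) v t"
  "big_step P env (EOp f e1 e2) v t"
  "big_step P env (EPair e1 e2) v t"
  "big_step P env (EFst e) v t"
  "big_step P env (ESnd e) v t"
  "big_step P env (EIsPair e) v t"
  "big_step P env (EIf e e1 e2) v t"
  "big_step P env (ELet e1 e2) v t"
  "big_step P env (ECall f e) v t"

lemma big_step_deterministic:
  "big_step P env e v t \<Longrightarrow> big_step P env e v' t' \<Longrightarrow> v' = v \<and> t' = t"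
  by (induction arbitrary: v' t' rule: big_step.induct)
    (erule big_step_elims;
      metis val.inject val.distinct Suc_eq_plus1 add_Suc_right add_0_right One_nat_def)+

definition runs_in :: "program \<Rightarrow> val \<Rightarrow> val \<Rightarrow> nat \<Rightarrow> bool" where
  "runs_in P input output t \<longleftrightarrow> big_step P [input] (ECall 0 (EVar 0)) output t"

fun val_size :: "val \<Rightarrow> nat" where
  "val_size (VNum a) = int_size a"
| "val_size (VPair v w) = val_size v + val_size w + 1"

fun list_val :: "val list \<Rightarrow> val" where
  "list_val [] = VNum 0"
| "list_val (v # vs) = VPair v (list_val vs)"

definition rat_val :: "rat \<Rightarrow> val" where
  "rat_val q = VPair (VNum (fst (quotient_of q))) (VNum (snd (quotient_of q)))"

definition input_val :: "nat \<Rightarrow> nat \<Rightarrow> rat job list \<Rightarrow> val" where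
  "input_val n m J = VPair (VNum (int n)) (VPair (VNum (int m))
     (list_val (map (\<lambda>x. VPair (rat_val (release x)) (rat_val (proc x))) J)))"

text \<open>Outputs: fractions need not be in lowest terms, and the runs may be listed in any order.\<close>

definition represents_real :: "val \<Rightarrow> real \<Rightarrow> bool" where
  "represents_real v x \<longleftrightarrow>
     (\<exists>a b. v = VPair (VNum a) (VNum b) \<and> b \<noteq> 0 \<and> x = of_int a / of_int b)"

definition represents_run :: "val \<Rightarrow> run \<Rightarrow> bool" where
  "represents_run v a \<longleftrightarrow>
     (\<exists>s e. v = VPair (VNum (int (job a))) (VPair (VNum (int (machine a))) (VPair s e)) \<and>
        represents_real s (start a) \<and> represents_real e (stop a))"

definition represents_schedule :: "val \<Rightarrow> schedule \<Rightarrow> bool" where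
  "represents_schedule v S \<longleftrightarrow>
     (\<exists>vs as. v = list_val vs \<and> list_all2 represents_run vs as \<and> set as = S)"

definition real_job :: "rat job \<Rightarrow> real job" where
  "real_job = map_prod of_rat of_rat"

text \<open>Bit complexity is defined for rational data.  The term \<open>n\<close> in the bound
  counts the announced jobs that are not yet released; for a complete instance it is
  dominated by the input size.  The number \<open>m\<close> is encoded in binary.\<close>

definition polynomial_time :: "(nat \<Rightarrow> nat \<Rightarrow> real job list \<Rightarrow> schedule) \<Rightarrow> bool" where
  "polynomial_time A \<longleftrightarrow>
     (\<exists>P c k. \<forall>n m J. is_instance (map real_job J) \<and> length J \<le> n \<longrightarrow>
        (\<exists>v t. runs_in P (input_val n m J) v t \<and>
           represents_schedule v (A n m (map real_job J)) \<and>
           t \<le> c * (n + val_size (input_val n m J)) ^ k))"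

end

theory Submission
  imports Defs "HOL-Analysis.Analysis" "HOL-Library.Multiset"
begin

text \<open>Let \<open>\<beta> \<ge> 2\<close> be least with \<open>n \<le> m \<beta>\<^sup>2\<close>, so \<open>\<beta> \<le> 2 max 1 (sqrt (n / m))\<close>, and sort the jobs into classes by
  the integral part of the logarithm of the processing time to base \<open>\<beta>\<close>.  An idle machine starts a fresh job of the
  lowest class, the youngest one of that class.  A run is killed as soon as \<open>m \<beta>\<close> jobs have been released since its
  start.  Killed jobs are restarted, shortest first, when no fresh job waits, on at most \<open>m div 2\<close> machines at a time.

  Each machine kills at most \<open>\<beta>\<close> times, hence there are at most \<open>m \<beta>\<close> kills.  Write \<open>P\<close> for the total
  processing time, a lower bound of the optimum.

  Fresh jobs wait only while all machines are busy, at least half of them with first runs, and the first runs have total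
  length at most \<open>P\<close>; so it is affordable that \<open>O(m \<beta>)\<close> fresh jobs wait.  Let \<open>u\<close> be the highest class being run (if a killed
  job is running, then every waiting job arrived after its start, and these are fewer than \<open>m \<beta>\<close>).  Of lower class than \<open>u\<close>
  fewer than \<open>m \<beta>\<close> jobs wait, for the same reason.  In each of the classes \<open>u\<close>, \<open>u + 1\<close>, \<open>u + 2\<close> a volume comparison bounds the number by
  \<open>3 m \<beta>\<close> plus \<open>\<beta>\<close> times the number of jobs alive in the optimum; serving the youngest job first keeps the jobs
  delayed by a long run from holding up the later ones.  A job of a higher class is waiting behind runs shorter by a
  factor \<open>\<beta>\<^sup>2\<close>, which altogether take no longer than the job itself.

  Killed jobs, at most \<open>m \<beta>\<close> of them, wait either while half of the machines execute first runs, or while \<open>m div 2\<close> machines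
  execute restarts.  During a restart of a job of length \<open>p\<close>, the jobs that were waiting at its start are at least as long, so their
  delay is at most \<open>P\<close>, and at most \<open>m\<close> jobs join them.  As there are at most \<open>m \<beta>\<close> restarts, this costs \<open>O(\<beta> P)\<close>.\<close>

section \<open>The algorithm as an event-driven simulation\<close>

text \<open>Kills are paid for by releases, not by lengths: kills that are disjoint in time use up
  disjoint sets of \<open>m \<beta>\<close> releases, and \<open>n \<le> m \<beta>\<^sup>2\<close>
  leaves room for \<open>\<beta>\<close> of them. On the other side, turning volume into numbers of
  jobs loses the ratio \<open>\<beta>\<close> of the lengths within a class. The choice of
  \<open>\<beta>\<close> balances the two losses. All charging is done moment by moment. The number
  of unfinished jobs is bounded by weights of the runs active at that moment plus
  \<open>3 \<beta>\<close> times the number of jobs alive in the optimum. The weight of a run does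
  not change while it lasts, so integration over time gives sums of weight times length. The
  simulation is polymorphic in the type of times. It is analysed over the reals, whereas the program
  computes with integers; as it only adds and compares times, scaling by a common denominator
  carries one over to the other. That it is online is seen on the simulation as well: jobs not yet
  released sit at the end of the list of pending jobs and have no effect before their
  release.\<close>

text \<open>In a running entry, \<open>ek\<close> counts the jobs released up to its start, so that the releases since
  then are the difference to the current number \<open>relno\<close>; \<open>erej\<close> marks restarts of killed jobs.  The queue
  \<open>fq\<close> holds the fresh jobs, \<open>rq\<close> the killed ones.\<close>

datatype 'a jrec = JR (jid: nat) (jrel: 'a) (jproc: 'a) (jcls: int)

datatype 'a ent = En (ejob: "'a jrec") (emach: nat) (estart: 'a) (ek: nat) (erej: bool)

datatype 'a orun = Or (ojob: nat) (omach: nat) (ostart: 'a) (ostop: 'a)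

datatype 'a state = St (pend: "'a jrec list") (relno: nat) (fq: "'a jrec list") (rq: "'a jrec list")
  (running: "'a ent list") (free: "nat list") (outs: "'a orun list")

definition eend :: "'a::plus ent \<Rightarrow> 'a" where
  "eend x = estart x + jproc (ejob x)"

text \<open>Jobs arrive in the order of their indices, so within a class the queue is last in, first out.\<close>

fun insQ :: "'a jrec \<Rightarrow> 'a jrec list \<Rightarrow> 'a jrec list" where
  "insQ j [] = [j]"
| "insQ j (q # Q) = (if jcls q < jcls j then q # insQ j Q else j # q # Q)"

fun insZ :: "'a::linorder jrec \<Rightarrow> 'a jrec list \<Rightarrow> 'a jrec list" where
  "insZ j [] = [j]"
| "insZ j (z # Z) = (if jproc z < jproc j then z # insZ j Z else j # z # Z)"

fun min_end :: "'a::{plus,linorder} \<Rightarrow> 'a ent list \<Rightarrow> 'a" where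
  "min_end t [] = t"
| "min_end t (x # X) = min_end (if eend x < t then eend x else t) X"

text \<open>Without pending jobs the minimum needs another starting value, and the head of
  \<open>X\<close> supplies one. With both lists empty the value is unspecified; \<open>step\<close>
  excludes that case.\<close>

fun next_time :: "'a::{plus,linorder} jrec list \<Rightarrow> 'a ent list \<Rightarrow> 'a" where
  "next_time (j # pd) X = min_end (jrel j) X"
| "next_time [] X = min_end (eend (hd X)) X"

fun arrive :: "'a::linorder \<Rightarrow> 'a jrec list \<Rightarrow> nat \<Rightarrow> 'a jrec list \<Rightarrow> 'a jrec list \<times> nat \<times> 'a jrec list" where
  "arrive t [] k Q = ([], k, Q)"
| "arrive t (j # pd) k Q = (if t < jrel j then (j # pd, k, Q) else arrive t pd (Suc k) (insQ j Q))"

text \<open>Completion takes precedence over the kill condition, so a job that ends exactly when the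
  threshold is reached is not lost. Every closed run gets the end \<open>t\<close>; for a completed
  one this is \<open>eend\<close>, because no event time skips an end.\<close>

fun purge :: "nat \<Rightarrow> 'a::{plus,linorder} \<Rightarrow> nat \<Rightarrow> 'a ent list \<Rightarrow> 'a ent list \<Rightarrow> nat list \<Rightarrow> 'a jrec list \<Rightarrow> 'a orun list \<Rightarrow>
    'a ent list \<times> nat list \<times> 'a jrec list \<times> 'a orun list" where
  "purge B t k [] Y fr Z out = (Y, fr, Z, out)"
| "purge B t k (x # X) Y fr Z out =
    (if t < eend x then
       if k < ek x + B then purge B t k X (x # Y) fr Z out
       else purge B t k X Y (emach x # fr) (insZ (ejob x) Z) (Or (jid (ejob x)) (emach x) (estart x) t # out)
     else purge B t k X Y (emach x # fr) Z (Or (jid (ejob x)) (emach x) (estart x) t # out))"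

fun rejs :: "'a ent list \<Rightarrow> nat" where
  "rejs [] = 0"
| "rejs (x # X) = (if erej x then Suc (rejs X) else rejs X)"

fun fill :: "nat \<Rightarrow> 'a \<Rightarrow> nat \<Rightarrow> nat list \<Rightarrow> 'a jrec list \<Rightarrow> 'a jrec list \<Rightarrow> 'a ent list \<Rightarrow>
    'a jrec list \<times> 'a jrec list \<times> 'a ent list \<times> nat list" where
  "fill h t k [] Q Z X = (Q, Z, X, [])"
| "fill h t k (f # fr) (q # Q) Z X = fill h t k fr Q Z (En q f t k False # X)"
| "fill h t k (f # fr) [] [] X = ([], [], X, f # fr)"
| "fill h t k (f # fr) [] (z # Z) X =
    (if rejs X < h then fill h t k fr [] Z (En z f t k True # X) else ([], z # Z, X, f # fr))"

text \<open>Arrivals come before ends and kills, and starts come last: a job released at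
  \<open>t\<close> counts for the kills at \<open>t\<close> and may take a machine that they free. A
  state with nothing pending or running is a fixed point, so \<open>loop\<close> may take more
  rounds than there are events.\<close>

fun step :: "nat \<Rightarrow> nat \<Rightarrow> 'a::{plus,linorder} state \<Rightarrow> 'a state" where
  "step B h (St pd k Q Z X fr out) =
    (if pd = [] \<and> X = [] then St pd k Q Z X fr out
     else let t = next_time pd X;
              (pd', k', Q1) = arrive t pd k Q;
              (X1, fr1, Z1, out') = purge B t k' X [] fr Z out;
              (Q', Z', X', fr') = fill h t k' fr1 Q1 Z1 X1
          in St pd' k' Q' Z' X' fr' out')"

fun loop :: "nat \<Rightarrow> nat \<Rightarrow> nat \<Rightarrow> 'a::{plus,linorder} state \<Rightarrow> 'a state" where
  "loop B h 0 \<sigma> = \<sigma>"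
| "loop B h (Suc N) \<sigma> = loop B h N (step B h \<sigma>)"

definition better :: "'a jrec \<Rightarrow> 'a jrec \<Rightarrow> bool" where
  "better q q' \<longleftrightarrow> jcls q < jcls q' \<or> jcls q = jcls q' \<and> jid q' < jid q"

lemma mset_insQ [simp]: "mset (insQ j Q) = add_mset j (mset Q)"
  by (induction Q) auto

lemma mset_insZ [simp]: "mset (insZ j Z) = add_mset j (mset Z)"
  by (induction Z) auto

lemma set_insQ [simp]: "set (insQ j Q) = insert j (set Q)"
  by (metis mset_insQ set_mset_add_mset_insert set_mset_mset)

lemma set_insZ [simp]: "set (insZ j Z) = insert j (set Z)"
  by (metis mset_insZ set_mset_add_mset_insert set_mset_mset)

lemma length_insQ [simp]: "length (insQ j Q) = Suc (length Q)"
  by (metis mset_insQ size_add_mset size_mset)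

lemma length_insZ [simp]: "length (insZ j Z) = Suc (length Z)"
  by (metis mset_insZ size_add_mset size_mset)

lemma sorted_insQ: "sorted_wrt better Q \<Longrightarrow> (\<And>q. q \<in> set Q \<Longrightarrow> jid q < jid j) \<Longrightarrow> sorted_wrt better (insQ j Q)"
  by (induction Q) (auto simp: better_def)

lemma sorted_insZ: "sorted (map jproc Z) \<Longrightarrow> sorted (map jproc (insZ j Z))"
  by (induction Z) auto

lemma min_end_le_arg: "min_end t X \<le> t"
proof (induction X arbitrary: t)
  case (Cons y X)
  show ?case using Cons.IH[of "if eend y < t then eend y else t"] by (auto split: if_splits)
qed simp

lemma min_end_le: "x \<in> set X \<Longrightarrow> min_end t X \<le> eend x"
proof (induction X arbitrary: t)
  case (Cons y X)
  then show ?case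
    using min_end_le_arg[of t X] min_end_le_arg[of "eend y" X]
    by (cases "x = y") (auto simp: not_less intro: order_trans)
qed simp

lemma min_end_in: "min_end t X = t \<or> (\<exists>x\<in>set X. min_end t X = eend x)"
proof (induction X arbitrary: t)
  case (Cons y X)
  show ?case using Cons.IH[of "if eend y < t then eend y else t"] by (auto split: if_splits)
qed simp

lemma next_time_le:
  "x \<in> set X \<Longrightarrow> next_time pd X \<le> eend x" "pd = j # pd' \<Longrightarrow> next_time pd X \<le> jrel j"
  by (cases pd; simp add: min_end_le min_end_le_arg)+

lemma next_time_in:
  assumes "pd \<noteq> [] \<or> X \<noteq> []"
  shows "(\<exists>x\<in>set X. next_time pd X = eend x) \<or> (pd \<noteq> [] \<and> next_time pd X = jrel (hd pd))"
proof (cases pd)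
  case Nil
  then show ?thesis using min_end_in[of "eend (hd X)" X] assms by auto
next
  case (Cons j pd')
  then show ?thesis using min_end_in[of "jrel j" X] by auto
qed

lemma rejs_append [simp]: "rejs (X @ Y) = rejs X + rejs Y"
  by (induction X) auto

lemma rejs_conv: "rejs X = length (filter erej X)"
  by (induction X) auto

text \<open>Job, machine and start identify a run while its end is still open; cf. \<open>same_until\<close>.\<close>

definition okey :: "real orun \<Rightarrow> nat \<times> nat \<times> real" where
  "okey a = (ojob a, omach a, ostart a)"

definition xkey :: "real ent \<Rightarrow> nat \<times> nat \<times> real" where
  "xkey x = (jid (ejob x), emach x, estart x)"

definition orun_run :: "real orun \<Rightarrow> run" where
  "orun_run a = \<lparr>job = ojob a, machine = omach a, start = ostart a, stop = ostop a\<rparr>"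

definition ent_run :: "real ent \<Rightarrow> run" where
  "ent_run x = \<lparr>job = jid (ejob x), machine = emach x, start = estart x, stop = eend x\<rparr>"

definition run_key :: "run \<Rightarrow> nat \<times> nat \<times> real" where
  "run_key a = (job a, machine a, start a)"

lemma orun_run_simps [simp]:
  "job (orun_run a) = ojob a" "machine (orun_run a) = omach a" "start (orun_run a) = ostart a" "stop (orun_run a) = ostop a"
  "run_key (orun_run a) = okey a" "run_key (ent_run x) = xkey x" "start (ent_run x) = estart x" "stop (ent_run x) = eend x"
  "machine (ent_run x) = emach x"
  by (simp_all add: orun_run_def ent_run_def run_key_def okey_def xkey_def)

lemma same_until_key: "same_until t S S' \<longleftrightarrow>
  run_key ` {a \<in> S. start a \<le> t} = run_key ` {a \<in> S'. start a \<le> t} \<and> {a \<in> S. stop a \<le> t} = {a \<in> S'. stop a \<le> t}"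
  by (simp add: same_until_def run_key_def)

text \<open>An open run is listed with the end that it has unless it is killed. A comparison up to
  time \<open>t\<close> tolerates this as long as that end lies after \<open>t\<close>, for then
  only the key of the run matters.\<close>

definition all_runs :: "real state \<Rightarrow> run set" where
  "all_runs \<sigma> = orun_run ` set (outs \<sigma>) \<union> ent_run ` set (running \<sigma>)"

definition idle :: "real state \<Rightarrow> bool" where
  "idle \<sigma> \<longleftrightarrow> pend \<sigma> = [] \<and> running \<sigma> = []"

definition nt :: "real state \<Rightarrow> real" where
  "nt \<sigma> = next_time (pend \<sigma>) (running \<sigma>)"

text \<open>A pending job weighs 2, one for its arrival and one for its completion. Starts and kills
  only move jobs between the other lists, so every event lowers the measure, and twice the number of
  jobs bounds the number of rounds.\<close>

definition meas :: "real state \<Rightarrow> nat" where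
  "meas \<sigma> = 2 * length (pend \<sigma>) + length (fq \<sigma>) + length (rq \<sigma>) + length (running \<sigma>)"

section \<open>Invariants of the simulation\<close>

locale jobs =
  fixes J :: "real jrec list" and B h M :: nat
  assumes sorted_J: "sorted (map jrel J)" and jid_J: "j < length J \<Longrightarrow> jid (J ! j) = j"
    and rel_nonneg: "j < length J \<Longrightarrow> 0 \<le> jrel (J ! j)" and proc_pos: "j < length J \<Longrightarrow> 0 < jproc (J ! j)"
    and B_pos: "0 < B"
begin

abbreviation "rl j \<equiv> jrel (J ! j)"
abbreviation "pj j \<equiv> jproc (J ! j)"

definition relsd :: "real \<Rightarrow> nat" where
  "relsd t = card {j. j < length J \<and> rl j \<le> t}"

lemma rl_mono: "i \<le> j \<Longrightarrow> j < length J \<Longrightarrow> rl i \<le> rl j"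
  using sorted_J sorted_nth_mono[of "map jrel J" i j] by simp

lemma relsd_eq: "(\<And>j. j < length J \<Longrightarrow> j < k \<longleftrightarrow> rl j \<le> t) \<Longrightarrow> k \<le> length J \<Longrightarrow> relsd t = k"
proof -
  assume "\<And>j. j < length J \<Longrightarrow> j < k \<longleftrightarrow> rl j \<le> t" "k \<le> length J"
  then have "{j. j < length J \<and> rl j \<le> t} = {..<k}"
    by (intro set_eqI) (metis lessThan_iff mem_Collect_eq order_less_le_trans)
  then show ?thesis by (simp add: relsd_def)
qed

lemma relsd_diff: "s \<le> t \<Longrightarrow> card {j. j < length J \<and> s < rl j \<and> rl j \<le> t} = relsd t - relsd s"
proof -
  assume "s \<le> t"
  then have "{j. j < length J \<and> s < rl j \<and> rl j \<le> t} =
    {j. j < length J \<and> rl j \<le> t} - {j. j < length J \<and> rl j \<le> s}" by auto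
  then show ?thesis using \<open>s \<le> t\<close> unfolding relsd_def
    by (simp add: card_Diff_subset Collect_mono_iff order_trans[of _ s t])
qed

end

text \<open>The invariant is weak enough to hold also between the phases of a step: a run may be
  due, \<open>T \<le> eend x\<close>, and a machine may be free while jobs wait. Releases strictly
  inside a run stay below \<open>B\<close>, whereas those at its end count towards a kill; the
  difference is due to simultaneous releases, which can overshoot the threshold.\<close>

locale sim_inv = jobs J B h M for J :: "real jrec list" and B h M +
  fixes T :: real and k :: nat and Q Z :: "real jrec list" and X :: "real ent list" and fr :: "nat list"
    and out :: "real orun list"
  assumes k_le: "k \<le> length J"
    and dist: "distinct (map jid Q @ map jid Z @ map (jid \<circ> ejob) X)"
    and mach_dist: "distinct (map emach X @ fr)"
    and mach_set: "set (map emach X @ fr) = {..<M}"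
    and jobQ: "q \<in> set Q \<Longrightarrow> jid q < k \<and> q = J ! jid q"
    and jobZ: "z \<in> set Z \<Longrightarrow> jid z < k \<and> z = J ! jid z"
    and jobX: "x \<in> set X \<Longrightarrow> jid (ejob x) < k \<and> ejob x = J ! jid (ejob x)"
    and ent: "x \<in> set X \<Longrightarrow> jrel (ejob x) \<le> estart x \<and> estart x \<le> T \<and> T \<le> eend x \<and> ek x = relsd (estart x)"
    and outD: "a \<in> set out \<Longrightarrow> ojob a < k \<and> omach a < M \<and> rl (ojob a) \<le> ostart a \<and> ostart a < ostop a \<and>
      ostop a \<le> T \<and> ostop a - ostart a \<le> pj (ojob a)"
    and few: "a \<in> set out \<Longrightarrow> card {j. j < length J \<and> ostart a < rl j \<and> rl j < ostop a} < B"
    and many: "a \<in> set out \<Longrightarrow> ostop a - ostart a < pj (ojob a) \<Longrightarrow>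
      B \<le> card {j. j < length J \<and> ostart a < rl j \<and> rl j \<le> ostop a}"
    and out_out: "a \<in> set out \<Longrightarrow> b \<in> set out \<Longrightarrow> a \<noteq> b \<Longrightarrow> omach a = omach b \<or> ojob a = ojob b \<Longrightarrow>
      ostop a \<le> ostart b \<or> ostop b \<le> ostart a"
    and out_X: "a \<in> set out \<Longrightarrow> x \<in> set X \<Longrightarrow> omach a = emach x \<or> ojob a = jid (ejob x) \<Longrightarrow> ostop a \<le> estart x"
    and done_gone: "a \<in> set out \<Longrightarrow> ostop a - ostart a = pj (ojob a) \<Longrightarrow>
      ojob a \<notin> jid ` set Q \<union> jid ` set Z \<union> (jid \<circ> ejob) ` set X"
    and done_last: "a \<in> set out \<Longrightarrow> b \<in> set out \<Longrightarrow> ostop a - ostart a = pj (ojob a) \<Longrightarrow> ojob b = ojob a \<Longrightarrow>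
      b \<noteq> a \<Longrightarrow> ostop b - ostart b < pj (ojob b) \<and> ostop b \<le> ostart a"
    and somewhere: "j < k \<Longrightarrow> j \<in> jid ` set Q \<union> jid ` set Z \<union> (jid \<circ> ejob) ` set X \<or>
      (\<exists>a\<in>set out. ojob a = j \<and> ostop a - ostart a = pj j)"
    and freshQ: "q \<in> set Q \<Longrightarrow> a \<in> set out \<Longrightarrow> ojob a \<noteq> jid q"
    and rejZ: "z \<in> set Z \<Longrightarrow> \<exists>a\<in>set out. ojob a = jid z"
    and rejX: "x \<in> set X \<Longrightarrow> erej x \<longleftrightarrow> (\<exists>a\<in>set out. ojob a = jid (ejob x))"
    and cap: "rejs X \<le> h"
    and sortedQ: "sorted_wrt better Q"
    and sortedZ: "sorted (map jproc Z)"

section \<open>The invariant through the phases of a step\<close>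

context jobs
begin

lemma inv_arrive1:
  assumes "sim_inv J B h M t k Q Z X fr out" "k < length J" "j = J ! k"
  shows "sim_inv J B h M t (Suc k) (insQ j Q) Z X fr out"
proof -
  interpret sim_inv J B h M t k Q Z X fr out by fact
  have id: "jid j = k" using assms jid_J by simp
  have new: "k \<notin> jid ` set Q \<union> jid ` set Z \<union> (jid \<circ> ejob) ` set X" using jobQ jobZ jobX by fastforce
  have outk: "ojob a \<noteq> k" if "a \<in> set out" for a using outD[OF that] by auto
  show ?thesis
  proof (unfold_locales, goal_cases)
    case 2
    have "mset (map jid (insQ j Q) @ map jid Z @ map (jid \<circ> ejob) X) =
      mset (jid j # map jid Q @ map jid Z @ map (jid \<circ> ejob) X)" by simp
    from mset_eq_imp_distinct_iff[OF this] show ?case using dist new id by auto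
  next
    case (5 q)
    then consider "q = j" | "q \<in> set Q" by auto
    then show ?case
    proof cases
      case 1 then show ?thesis using id assms(3) by simp
    next
      case 2 then show ?thesis using jobQ[of q] less_SucI by blast
    qed
  next
    case (14 a) then show ?case using done_gone outk id by auto
  next
    case (16 i)
    then consider "i < k" | "i = k" by linarith
    then show ?case using somewhere[of i] id by cases auto
  next
    case (17 q a) then show ?case using freshQ outk id by auto
  next
    case 21 then show ?case using sorted_insQ[OF sortedQ] jobQ id by auto
  next
    case (9 a) then show ?case using outD[of a] by auto
  next
    case 1 then show ?case using assms by simp
  next
    case 3 then show ?case by (rule mach_dist)
  next
    case 4 then show ?case by (rule mach_set)
  next
    case (6 z) then show ?case using jobZ[of z] less_SucI by blast
  next
    case (7 x) then show ?case using jobX[of x] less_SucI by blast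
  next
    case (8 x) then show ?case by (rule ent)
  next
    case (10 a) then show ?case by (rule few)
  next
    case (11 a) then show ?case by (rule many)
  next
    case (12 a b) then show ?case by (rule out_out)
  next
    case (13 a x) then show ?case by (rule out_X)
  next
    case (15 a b) then show ?case by (rule done_last)
  next
    case (18 z) then show ?case by (rule rejZ)
  next
    case (19 x) then show ?case by (rule rejX)
  next
    case 20 then show ?case by (rule cap)
  next
    case 22 then show ?case by (rule sortedZ)
  qed
qed

text \<open>Kill and completion are treated together, told apart by \<open>t < eend x\<close>: the
  closed run is recorded in the same way, and only the whereabouts of the job differ.\<close>

lemma inv_remove:
  assumes inv: "sim_inv J B h M t k Q Z (Y @ x # X) fr out" and lt: "estart x < t"
    and few_x: "card {j. j < length J \<and> estart x < rl j \<and> rl j < t} < B"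
    and Z': "if t < eend x then Z' = insZ (ejob x) Z \<and> B \<le> card {j. j < length J \<and> estart x < rl j \<and> rl j \<le> t} else Z' = Z"
  shows "sim_inv J B h M t k Q Z' (Y @ X) (emach x # fr) (Or (jid (ejob x)) (emach x) (estart x) t # out)"
proof -
  interpret sim_inv J B h M t k Q Z "Y @ x # X" fr out by fact
  let ?o = "Or (jid (ejob x)) (emach x) (estart x) t"
  have x: "jid (ejob x) < k \<and> ejob x = J ! jid (ejob x)" by (rule jobX) simp
  have tx: "t \<le> eend x" "estart x \<le> t" "jrel (ejob x) \<le> estart x" using ent[of x] by auto
  have proc: "jproc (ejob x) = pj (jid (ejob x))" "jrel (ejob x) = rl (jid (ejob x))" using x by metis+
  have xk: "jid (ejob x) < k" using x by simp
  have xM: "emach x < M" using mach_set by auto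
  have full: "t - estart x = pj (jid (ejob x)) \<longleftrightarrow> \<not> t < eend x" "t - estart x \<le> pj (jid (ejob x))"
    using tx proc by (auto simp: eend_def)
  have ox: "a \<in> set out \<Longrightarrow> omach a = emach x \<or> ojob a = jid (ejob x) \<Longrightarrow> ostop a \<le> estart x" for a
    using out_X[of a x] by simp
  have dx: "jid (ejob x) \<notin> jid ` set Q \<union> jid ` set Z \<union> (jid \<circ> ejob) ` set (Y @ X)" using dist by auto
  have mx: "emach x \<notin> emach ` set (Y @ X)" using mach_dist by auto
  \<comment> \<open>An earlier run of full length would have removed the job from all lists, but the
    job is running.\<close>
  have oldkill: "ostop a - ostart a < pj (ojob a)" if "a \<in> set out" "ojob a = jid (ejob x)" for a
    using done_gone[of a] outD[OF that(1)] that by force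
  have setZ: "set Z' = set Z \<or> set Z' = insert (ejob x) (set Z)" using Z' by (auto split: if_splits)
  show ?thesis
  proof (unfold_locales, goal_cases)
    case 2
    show ?case
    proof (cases "t < eend x")
      case True
      have "mset (map jid Q @ map jid Z' @ map (jid \<circ> ejob) (Y @ X)) = mset (map jid Q @ map jid Z @ map (jid \<circ> ejob) (Y @ x # X))"
        using Z' True by simp
      from mset_eq_imp_distinct_iff[OF this] show ?thesis using dist by simp
    qed (use dist Z' in auto)
  next
    case 3 then show ?case using mach_dist by auto
  next
    case 4 then show ?case using mach_set by auto
  next
    case (6 z)
    then consider "z = ejob x" | "z \<in> set Z" using setZ by auto
    then show ?case using jobZ[of z] x(1) by cases blast+
  next
    case (9 a) then show ?case using outD[of a] full(2) lt xM xk tx(3)[unfolded proc(2)]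
      by (cases "a = ?o") auto
  next
    case (10 a) then show ?case using few few_x by auto
  next
    case (11 a) then show ?case using many[of a] Z' full by (auto split: if_splits)
  next
    case (12 a b) then show ?case using out_out[of a b] ox by auto
  next
    case (13 a y) then show ?case using out_X[of a y] dx mx by auto
  next
    case (14 a)
    show ?case
    proof (cases "a = ?o")
      case True
      then have "Z' = Z" using 14 full Z' by auto
      then show ?thesis using dx True by auto
    next
      case False
      then have "a \<in> set out" using 14 by simp
      then show ?thesis using done_gone[of a] 14 setZ by auto
    qed
  next
    case (15 a b)
    show ?case
    proof (cases "a = ?o")
      case True
      then show ?thesis using 15 oldkill[of b] ox[of b] by auto
    next
      case False
      then have a: "a \<in> set out" using 15 by simp
      show ?thesis
      proof (cases "b = ?o")
        case True
        then show ?thesis using oldkill[OF a] 15 by simp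
      next
        case False
        then show ?thesis using done_last[OF a, of b] 15 by auto
      qed
    qed
  next
    case (16 j)
    show ?case
    proof (cases "j = jid (ejob x)")
      case True
      show ?thesis using full Z' True by (cases "t < eend x") auto
    next
      case False
      then show ?thesis using somewhere[OF 16] setZ by auto
    qed
  next
    case (17 q a) then show ?case using freshQ[of q a] dx by auto
  next
    case (18 z) then show ?case using rejZ[of z] setZ by auto
  next
    case (19 y) then show ?case using rejX[of y] dx by auto
  next
    case 20 then show ?case using cap by (auto split: if_splits)
  next
    case 22 then show ?case using sortedZ sorted_insZ Z' by (auto split: if_splits)
  next
    case 1 then show ?case by (rule k_le)
  next
    case (5 q) then show ?case by (rule jobQ)
  next
    case (7 y) then show ?case using jobX[of y] by simp
  next
    case (8 y) then show ?case using ent[of y] by simp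
  next
    case 21 then show ?case by (rule sortedQ)
  qed
qed

lemma inv_start_fresh:
  assumes inv: "sim_inv J B h M t k (q # Q) Z X (f # fr) out" and k: "k = relsd t" and rel: "\<And>j. j < k \<Longrightarrow> rl j \<le> t"
  shows "sim_inv J B h M t k Q Z (En q f t k False # X) fr out"
proof -
  interpret sim_inv J B h M t k "q # Q" Z X "f # fr" out by fact
  have q: "jid q < k" "q = J ! jid q" using jobQ[of q] by auto
  have rq: "jrel q \<le> t" using q rel by metis
  have pq: "0 < jproc q" using q k_le proc_pos[of "jid q"] by simp
  show ?thesis
  proof (unfold_locales, goal_cases)
    case (8 x) then show ?case using ent[of x] rq pq k by (auto simp: eend_def)
  next
    case (13 a x) then show ?case using out_X[of a x] outD[of a] freshQ[of q a] by auto
  next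
    case (14 a) then show ?case using done_gone[of a] by auto
  next
    case (16 j) then show ?case using somewhere[of j] by auto
  next
    case (19 x) then show ?case using rejX[of x] freshQ[of q] by auto
  next
    case 20 then show ?case using cap by simp
  next
    case 1 then show ?case by (rule k_le)
  next
    case 2 then show ?case using dist by auto
  next
    case 3 then show ?case using mach_dist by auto
  next
    case 4 then show ?case using mach_set by auto
  next
    case (5 i) then show ?case using jobQ[of i] by simp
  next
    case (6 z) then show ?case by (rule jobZ)
  next
    case (7 x) then show ?case using jobX[of x] q by (cases "x = En q f t k False") auto
  next
    case (9 a) then show ?case by (rule outD)
  next
    case (10 a) then show ?case by (rule few)
  next
    case (11 a) then show ?case by (rule many)
  next
    case (12 a b) then show ?case by (rule out_out)
  next
    case (15 a b) then show ?case by (rule done_last)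
  next
    case (17 i a) then show ?case using freshQ[of i a] by simp
  next
    case (18 z) then show ?case by (rule rejZ)
  next
    case 21 then show ?case using sortedQ by simp
  next
    case 22 then show ?case by (rule sortedZ)
  qed
qed

lemma inv_start_rej:
  assumes inv: "sim_inv J B h M t k [] (z # Z) X (f # fr) out" and k: "k = relsd t" and rel: "\<And>j. j < k \<Longrightarrow> rl j \<le> t"
    and "rejs X < h"
  shows "sim_inv J B h M t k [] Z (En z f t k True # X) fr out"
proof -
  interpret sim_inv J B h M t k "[]" "z # Z" X "f # fr" out by fact
  have q: "jid z < k" "z = J ! jid z" using jobZ[of z] by auto
  have rq: "jrel z \<le> t" using q rel by metis
  have pq: "0 < jproc z" using q k_le proc_pos[of "jid z"] by simp
  show ?thesis
  proof (unfold_locales, goal_cases)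
    case (8 x) then show ?case using ent[of x] rq pq k by (auto simp: eend_def)
  next
    case (13 a x) then show ?case using out_X[of a x] outD[of a] by auto
  next
    case (14 a) then show ?case using done_gone[of a] by auto
  next
    case (16 j) then show ?case using somewhere[of j] by auto
  next
    case (19 x) then show ?case using rejX[of x] rejZ[of z] by auto
  next
    case 20 then show ?case using assms by simp
  next
    case 1 then show ?case by (rule k_le)
  next
    case 2 then show ?case using dist by auto
  next
    case 3 then show ?case using mach_dist by auto
  next
    case 4 then show ?case using mach_set by auto
  next
    case 5 then show ?case by simp
  next
    case (6 i) then show ?case using jobZ[of i] by simp
  next
    case (7 x) then show ?case using jobX[of x] q by (cases "x = En z f t k True") auto
  next
    case (9 a) then show ?case by (rule outD)
  next
    case (10 a) then show ?case by (rule few)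
  next
    case (11 a) then show ?case by (rule many)
  next
    case (12 a b) then show ?case by (rule out_out)
  next
    case (15 a b) then show ?case by (rule done_last)
  next
    case 17 then show ?case by simp
  next
    case (18 i) then show ?case using rejZ[of i] by simp
  next
    case 21 then show ?case using sortedQ by simp
  next
    case 22 then show ?case using sortedZ by simp
  qed
qed


lemma inv_arrive:
  assumes "sim_inv J B h M t k Q Z X fr out" "pd = drop k J" "arrive t pd k Q = (pd', k', Q')"
    "\<And>j. j < k \<Longrightarrow> rl j \<le> t"
  shows "sim_inv J B h M t k' Q' Z X fr out \<and> pd' = drop k' J \<and> k \<le> k' \<and>
    (\<forall>j<length J. j < k' \<longleftrightarrow> rl j \<le> t) \<and> length pd' + length Q' = length pd + length Q"
  using assms
proof (induction t pd k Q arbitrary: pd' k' Q' rule: arrive.induct)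
  case (1 t k Q)
  then have "length J \<le> k" by simp
  then show ?case using 1 by (auto simp: order_less_le_trans)
next
  case (2 t j pd k Q)
  have k: "k < length J" "j = J ! k" "pd = drop (Suc k) J"
    using 2(3) by (metis drop_all list.distinct(1) not_le, metis nth_via_drop, metis drop_Suc list.sel(3) tl_drop)
  show ?case
  proof (cases "t < jrel j")
    case True
    then have eq: "pd' = j # pd" "k' = k" "Q' = Q" using 2(4) by simp_all
    have "i < k \<longleftrightarrow> rl i \<le> t" if "i < length J" for i
      using 2(5)[of i] rl_mono[of k i] that True k by (cases "i < k") auto
    then show ?thesis using 2 eq by simp
  next
    case False
    have "sim_inv J B h M t (Suc k) (insQ j Q) Z X fr out"
      using inv_arrive1[OF 2(2) k(1) k(2)] .
    moreover have "rl i \<le> t" if "i < Suc k" for i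
      using that 2(5)[of i] False k by (cases "i = k") auto
    ultimately show ?thesis using 2(1)[OF False _ k(3)] 2(4) False by fastforce
  qed
qed

lemma arrive_less: "arrive t (j # pd) k Q = (pd', k', Q') \<Longrightarrow> jrel j \<le> t \<Longrightarrow> length pd' < length (j # pd)"
proof -
  have *: "arrive t pd k Q = (pd', k', Q') \<Longrightarrow> length pd' \<le> length pd" for pd k Q
    by (induction t pd k Q arbitrary: pd' k' Q' rule: arrive.induct) (force split: if_splits)+
  show "arrive t (j # pd) k Q = (pd', k', Q') \<Longrightarrow> jrel j \<le> t \<Longrightarrow> length pd' < length (j # pd)"
    using *[of pd "Suc k" "insQ j Q"] by (simp add: not_less[symmetric])
qed

text \<open>The last clause serves \<open>meas\<close>: a killed run merely moves its job to the
  queue, while the runs that end on time are subtracted.\<close>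

definition purged :: "real \<Rightarrow> nat \<Rightarrow> real jrec list \<Rightarrow> real ent list \<Rightarrow> real ent list \<Rightarrow> real jrec list \<Rightarrow> real orun list \<Rightarrow>
    real ent list \<Rightarrow> nat list \<Rightarrow> real jrec list \<Rightarrow> real orun list \<Rightarrow> bool" where
  "purged t k Q X Y Z out X' fr' Z' out' \<longleftrightarrow> sim_inv J B h M t k Q Z' X' fr' out' \<and>
    (\<forall>x\<in>set X'. x \<in> set Y \<or> (x \<in> set X \<and> t < eend x \<and> k < ek x + B)) \<and>
    set out \<subseteq> set out' \<and> (\<forall>a\<in>set out'. a \<in> set out \<or> (ostop a = t \<and> okey a \<in> xkey ` set X)) \<and>
    set Y \<subseteq> set X' \<and> (\<forall>x\<in>set X. x \<in> set X' \<or> (\<exists>a\<in>set out'. okey a = xkey x)) \<and>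
    length Z' + length X' + length (filter (\<lambda>x. eend x \<le> t) X) \<le> length Z + length Y + length X"

lemma inv_purge:
  assumes "sim_inv J B h M t k Q Z (Y @ X) fr out" "purge B t k X Y fr Z out = (X', fr', Z', out')"
    "k = relsd t" "\<And>x. x \<in> set X \<Longrightarrow> estart x < t \<and> card {j. j < length J \<and> estart x < rl j \<and> rl j < t} < B"
  shows "purged t k Q X Y Z out X' fr' Z' out'"
  using assms
proof (induction X arbitrary: Y fr Z out)
  case Nil
  then show ?case by (auto simp: purged_def)
next
  case (Cons x X)
  note prems = Cons.prems
  interpret I: sim_inv J B h M t k Q Z "Y @ x # X" fr out by (rule prems(1))
  let ?o = "Or (jid (ejob x)) (emach x) (estart x) t"
  have x: "estart x < t" "card {j. j < length J \<and> estart x < rl j \<and> rl j < t} < B" using prems(4)[of x] by auto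
  have X: "\<And>y. y \<in> set X \<Longrightarrow> estart y < t \<and> card {j. j < length J \<and> estart y < rl j \<and> rl j < t} < B"
    using prems(4) by simp
  have ekx: "ek x = relsd (estart x)" using I.ent[of x] by simp
  have key: "okey ?o = xkey x" by (simp add: okey_def xkey_def)
  consider "t < eend x" "k < ek x + B" | "t < eend x" "\<not> k < ek x + B" | "\<not> t < eend x" by blast
  then show ?case
  proof cases
    case 1
    \<comment> \<open>The run survives; only its position in the list of running entries
      changes.\<close>
    have "sim_inv J B h M t k Q Z ((x # Y) @ X) fr out"
    proof (unfold_locales, goal_cases)
      case 2
      have "mset (map jid Q @ map jid Z @ map (jid \<circ> ejob) ((x # Y) @ X)) = mset (map jid Q @ map jid Z @ map (jid \<circ> ejob) (Y @ x # X))" by simp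
      from mset_eq_imp_distinct_iff[OF this] show ?case using I.dist by simp
    next
      case 3 then show ?case using I.mach_dist by auto
    next
      case 4 then show ?case using I.mach_set by auto
    next
      case (7 y) then show ?case using I.jobX[of y] by simp
    next
      case (8 y) then show ?case using I.ent[of y] by simp
    next
      case (13 a y) then show ?case using I.out_X[of a y] by simp
    next
      case (14 a) then show ?case using I.done_gone[of a] by simp
    next
      case (16 i) then show ?case using I.somewhere[of i] by simp
    next
      case (19 y) then show ?case using I.rejX[of y] by simp
    next
      case 20 then show ?case using I.cap by (simp split: if_splits)
    qed (fact I.k_le I.jobQ I.jobZ I.outD I.few I.many I.out_out I.done_last I.freshQ I.rejZ I.sortedQ I.sortedZ)+
    from Cons.IH[OF this _ prems(3) X] prems(2) 1
    have IH: "purged t k Q X (x # Y) Z out X' fr' Z' out'"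
      by simp
    show ?thesis using IH 1 unfolding purged_def by auto
  next
    case 2
    have "relsd (estart x) \<le> relsd t" unfolding relsd_def using x(1) by (intro card_mono) auto
    then have "sim_inv J B h M t k Q (insZ (ejob x) Z) (Y @ X) (emach x # fr) (?o # out)"
      using 2 x ekx prems(3) by (intro inv_remove[OF I.sim_inv_axioms]) (auto simp: relsd_diff)
    from Cons.IH[OF this _ prems(3) X] prems(2) 2
    have IH: "purged t k Q X Y (insZ (ejob x) Z) (?o # out) X' fr' Z' out'"
      by simp
    show ?thesis using IH 2 key unfolding purged_def by auto
  next
    case 3
    then have "sim_inv J B h M t k Q Z (Y @ X) (emach x # fr) (?o # out)"
      using x by (intro inv_remove[OF I.sim_inv_axioms]) auto
    from Cons.IH[OF this _ prems(3) X] prems(2) 3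
    have IH: "purged t k Q X Y Z (?o # out) X' fr' Z' out'"
      by simp
    show ?thesis using IH 3 key unfolding purged_def by auto
  qed
qed

text \<open>The priority of a run started in this phase is stated against the jobs that are left
  over at its end. These are the jobs waiting at time \<open>t\<close>, as seen in the finished
  schedule.\<close>

definition filled :: "real \<Rightarrow> nat \<Rightarrow> real jrec list \<Rightarrow> real jrec list \<Rightarrow> real ent list \<Rightarrow> real orun list \<Rightarrow>
    real jrec list \<Rightarrow> real jrec list \<Rightarrow> real ent list \<Rightarrow> nat list \<Rightarrow> bool" where
  "filled t k Q Z X out Q' Z' X' fr' \<longleftrightarrow> sim_inv J B h M t k Q' Z' X' fr' out \<and>
    (Q' \<noteq> [] \<longrightarrow> fr' = []) \<and> (Z' \<noteq> [] \<longrightarrow> fr' = [] \<or> h \<le> rejs X') \<and>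
    set Q' \<subseteq> set Q \<and> set Z' \<subseteq> set Z \<and> set X \<subseteq> set X' \<and>
    length Q' + length Z' + length X' = length Q + length Z + length X \<and>
    (\<forall>x\<in>set X'. x \<in> set X \<or> (estart x = t \<and> ek x = k \<and> t < eend x \<and>
      (if erej x then Q' = [] \<and> (\<forall>z\<in>set Z'. jproc (ejob x) \<le> jproc z) else (\<forall>q\<in>set Q'. better (ejob x) q))))"

lemma inv_fill:
  assumes "sim_inv J B h M t k Q Z X fr out" "fill h t k fr Q Z X = (Q', Z', X', fr')"
    "k = relsd t" "\<And>j. j < k \<Longrightarrow> rl j \<le> t"
  shows "filled t k Q Z X out Q' Z' X' fr'"
  using assms
proof (induction fr arbitrary: Q Z X)
  case Nil
  then show ?case by (auto simp: filled_def)
next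
  case (Cons f fr)
  note prems = Cons.prems
  show ?case
  proof (cases Q)
    case (Cons q Q0)
    interpret I: sim_inv J B h M t k "q # Q0" Z X "f # fr" out using prems(1) Cons by simp
    have "jid q < k" "q = J ! jid q" using I.jobQ[of q] by auto
    then have "0 < jproc q" using proc_pos[of "jid q"] I.k_le by simp
    then have e: "t < eend (En q f t k False)" by (simp add: eend_def)
    have b: "\<And>q'. q' \<in> set Q0 \<Longrightarrow> better q q'" using I.sortedQ by simp
    have "sim_inv J B h M t k Q0 Z (En q f t k False # X) fr out"
      by (rule inv_start_fresh[OF I.sim_inv_axioms prems(3) prems(4)])
    from Cons.IH[OF this _ prems(3) prems(4)] prems(2) Cons
    have IH: "filled t k Q0 Z (En q f t k False # X) out Q' Z' X' fr'"
      by simp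
    then show ?thesis using e b Cons unfolding filled_def by (intro conjI ballI) (auto dest!: bspec)
  next
    case Nil
    show ?thesis
    proof (cases Z)
      case (Cons z Z0)
      interpret I: sim_inv J B h M t k "[]" "z # Z0" X "f # fr" out using prems(1) Cons Nil by simp
      show ?thesis
      proof (cases "rejs X < h")
        case True
        have "jid z < k" "z = J ! jid z" using I.jobZ[of z] by auto
        then have "0 < jproc z" using proc_pos[of "jid z"] I.k_le by simp
        then have e: "t < eend (En z f t k True)" by (simp add: eend_def)
        have b: "\<And>z'. z' \<in> set Z0 \<Longrightarrow> jproc z \<le> jproc z'" using I.sortedZ by simp
        have "sim_inv J B h M t k [] Z0 (En z f t k True # X) fr out"
          by (rule inv_start_rej[OF I.sim_inv_axioms prems(3) prems(4) True])
        from Cons.IH[OF this _ prems(3) prems(4)] prems(2) True Nil Cons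
        have IH: "filled t k [] Z0 (En z f t k True # X) out Q' Z' X' fr'"
          by auto
        then show ?thesis using e b Nil Cons unfolding filled_def by (intro conjI ballI) (auto dest!: bspec)
      next
        case False
        then show ?thesis using prems Nil Cons by (auto simp: filled_def)
      qed
    qed (use prems Nil in \<open>auto simp: filled_def\<close>)
  qed
qed


text \<open>What holds between two steps only: no run is due or ripe for a kill, machines are not
  idle without reason, and runs started at this very moment respect the priorities. The last clause
  is the source of \<open>fw_prio\<close> and \<open>rw_prio\<close> below.\<close>

definition state_inv :: "real \<Rightarrow> real state \<Rightarrow> bool" where
  "state_inv T \<sigma> \<longleftrightarrow> sim_inv J B h M T (relno \<sigma>) (fq \<sigma>) (rq \<sigma>) (running \<sigma>) (free \<sigma>) (outs \<sigma>) \<and>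
    pend \<sigma> = drop (relno \<sigma>) J \<and> (\<forall>j<length J. j < relno \<sigma> \<longleftrightarrow> rl j \<le> T) \<and>
    (\<forall>x\<in>set (running \<sigma>). T < eend x \<and> relno \<sigma> < ek x + B) \<and>
    (fq \<sigma> \<noteq> [] \<longrightarrow> free \<sigma> = []) \<and> (rq \<sigma> \<noteq> [] \<longrightarrow> free \<sigma> = [] \<or> h \<le> rejs (running \<sigma>)) \<and>
    (\<forall>x\<in>set (running \<sigma>). estart x = T \<longrightarrow>
      (if erej x then fq \<sigma> = [] \<and> (\<forall>z\<in>set (rq \<sigma>). jproc (ejob x) \<le> jproc z)
       else (\<forall>q\<in>set (fq \<sigma>). better (ejob x) q)))"

section \<open>Progress of single steps\<close>

lemma nt_gt:
  assumes "state_inv T \<sigma>" "\<not> idle \<sigma>"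
  shows "T < nt \<sigma>"
proof -
  consider x where "x \<in> set (running \<sigma>)" "nt \<sigma> = eend x" | "pend \<sigma> \<noteq> []" "nt \<sigma> = jrel (hd (pend \<sigma>))"
    using next_time_in[of "pend \<sigma>" "running \<sigma>"] assms(2) by (auto simp: nt_def idle_def)
  then show ?thesis
  proof cases
    case 1
    then show ?thesis using assms by (auto simp: state_inv_def)
  next
    case 2
    then have "relno \<sigma> < length J" "hd (pend \<sigma>) = J ! relno \<sigma>"
      using assms by (auto simp: state_inv_def hd_drop_conv_nth)
    then show ?thesis using 2 assms by (auto simp: state_inv_def not_le[symmetric])
  qed
qed

lemma step_state:
  assumes inv: "state_inv T \<sigma>" and "\<not> idle \<sigma>" and t_def: "t = nt \<sigma>" and \<sigma>': "\<sigma>' = step B h \<sigma>"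
  shows "state_inv t \<sigma>'" "meas \<sigma>' < meas \<sigma>" "set (outs \<sigma>) \<subseteq> set (outs \<sigma>')"
    "a \<in> set (outs \<sigma>') \<Longrightarrow> a \<in> set (outs \<sigma>) \<or> (ostop a = t \<and> okey a \<in> xkey ` set (running \<sigma>))"
    "x \<in> set (running \<sigma>) \<Longrightarrow> x \<in> set (running \<sigma>') \<or> (\<exists>a\<in>set (outs \<sigma>'). okey a = xkey x)"
    "y \<in> set (running \<sigma>') \<Longrightarrow> y \<in> set (running \<sigma>) \<or> estart y = t"
proof -
  obtain pd k Q Z X fr out where \<sigma>: "\<sigma> = St pd k Q Z X fr out" by (cases \<sigma>)
  have "T < t" using nt_gt assms by simp
  have t: "t = next_time pd X" using t_def \<sigma> by (simp add: nt_def)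
  interpret I: sim_inv J B h M T k Q Z X fr out using inv \<sigma> by (simp add: state_inv_def)
  have pd: "pd = drop k J" and kT: "\<And>j. j < length J \<Longrightarrow> j < k \<longleftrightarrow> rl j \<le> T"
    and XT: "\<And>x. x \<in> set X \<Longrightarrow> T < eend x \<and> k < ek x + B"
    using inv \<sigma> by (auto simp: state_inv_def)
  have tX: "t \<le> eend x" if "x \<in> set X" for x using next_time_le(1)[OF that] t by simp
  have I1: "sim_inv J B h M t k Q Z X fr out"
  proof (unfold_locales, goal_cases)
    case (8 x) then show ?case using I.ent[of x] tX[of x] \<open>T < t\<close> by auto
  next
    case (9 a) then show ?case using I.outD[of a] \<open>T < t\<close> by auto
  qed (fact I.k_le I.dist I.mach_dist I.mach_set I.jobQ I.jobZ I.jobX I.few I.many I.out_out I.out_X I.done_gone I.done_last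
     I.somewhere I.freshQ I.rejZ I.rejX I.cap I.sortedQ I.sortedZ)+
  obtain pd' k' Q1 where ar: "arrive t pd k Q = (pd', k', Q1)" by (metis prod_cases3)
  obtain X1 fr1 Z1 out' where pu: "purge B t k' X [] fr Z out = (X1, fr1, Z1, out')" by (metis prod_cases4)
  obtain Q' Z' X' fr' where fi: "fill h t k' fr1 Q1 Z1 X1 = (Q', Z', X', fr')" by (metis prod_cases4)
  have ne: "\<not> (pd = [] \<and> X = [])" using assms \<sigma> by (auto simp: idle_def)
  have eq: "\<sigma>' = St pd' k' Q' Z' X' fr' out'"
    unfolding \<sigma>' \<sigma> step.simps if_not_P[OF ne] by (simp add: t[symmetric] ar pu fi Let_def)
  have kt: "rl j \<le> t" if "j < k" for j using kT[of j] that I.k_le \<open>T < t\<close> by force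
  have A: "sim_inv J B h M t k' Q1 Z X fr out" "pd' = drop k' J" "k \<le> k'" "\<And>j. j < length J \<Longrightarrow> j < k' \<longleftrightarrow> rl j \<le> t"
    "length pd' + length Q1 = length pd + length Q"
    using inv_arrive[OF I1 pd ar kt] by auto
  have k'J: "k' \<le> length J" using A(1) by (rule sim_inv.k_le)
  have k': "k' = relsd t" using relsd_eq[OF A(4) k'J] by simp
  have kT': "k = relsd T" using relsd_eq[OF kT I.k_le] by simp
  \<comment> \<open>The next arrival is itself an event, so everything released before
    \<open>t\<close> was already released at \<open>T\<close>. The releases since the start of the
    run therefore number \<open>k - ek x\<close>, which is less than \<open>B\<close>.\<close>
  have fewX: "estart x < t \<and> card {j. j < length J \<and> estart x < rl j \<and> rl j < t} < B" if x: "x \<in> set X" for x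
  proof -
    have e: "estart x \<le> T" "ek x = relsd (estart x)" using I.ent[OF x] by auto
    have "{j. j < length J \<and> estart x < rl j \<and> rl j < t} \<subseteq> {j. j < length J \<and> estart x < rl j \<and> rl j \<le> T}"
    proof
      fix j assume j: "j \<in> {j. j < length J \<and> estart x < rl j \<and> rl j < t}"
      have "j < k"
      proof (rule ccontr)
        assume "\<not> j < k"
        then have kj: "k < length J" "rl k \<le> rl j" using j rl_mono[of k j] by auto
        then have "pd = J ! k # drop (Suc k) J" using pd by (simp add: Cons_nth_drop_Suc)
        then have "t \<le> rl k" using next_time_le(2) t by metis
        then show False using kj j by auto
      qed
      then show "j \<in> {j. j < length J \<and> estart x < rl j \<and> rl j \<le> T}" using j kT[of j] by auto
    qed
    then have "card {j. j < length J \<and> estart x < rl j \<and> rl j < t} \<le> card {j. j < length J \<and> estart x < rl j \<and> rl j \<le> T}"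
      by (intro card_mono) auto
    also have "\<dots> = k - ek x" using relsd_diff[OF e(1)] e(2) kT' by simp
    also have "\<dots> < B" using XT[OF x] B_pos by linarith
    finally show ?thesis using e \<open>T < t\<close> by simp
  qed
  have P: "sim_inv J B h M t k' Q1 Z1 X1 fr1 out'" "\<And>x. x \<in> set X1 \<Longrightarrow> x \<in> set X \<and> t < eend x \<and> k' < ek x + B"
    "set out \<subseteq> set out'" "\<And>a. a \<in> set out' \<Longrightarrow> a \<in> set out \<or> (ostop a = t \<and> okey a \<in> xkey ` set X)"
    "\<And>x. x \<in> set X \<Longrightarrow> x \<in> set X1 \<or> (\<exists>a\<in>set out'. okey a = xkey x)"
    "length Z1 + length X1 + length (filter (\<lambda>x. eend x \<le> t) X) \<le> length Z + length X"
    using inv_purge[of t k' Q1 Z "[]" X fr out X1 fr1 Z1 out', OF _ pu k' fewX] A(1) by (auto simp: purged_def)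
  have kt': "rl j \<le> t" if "j < k'" for j using A(4)[of j] that k'J by auto
  have F: "sim_inv J B h M t k' Q' Z' X' fr' out'" "Q' \<noteq> [] \<longrightarrow> fr' = []" "Z' \<noteq> [] \<longrightarrow> fr' = [] \<or> h \<le> rejs X'"
    "set X1 \<subseteq> set X'" "length Q' + length Z' + length X' = length Q1 + length Z1 + length X1"
    "\<And>x. x \<in> set X' \<Longrightarrow> x \<in> set X1 \<or> (estart x = t \<and> ek x = k' \<and> t < eend x \<and>
      (if erej x then Q' = [] \<and> (\<forall>z\<in>set Z'. jproc (ejob x) \<le> jproc z) else (\<forall>q\<in>set Q'. better (ejob x) q)))"
    using inv_fill[OF P(1) fi k' kt'] by (auto simp: filled_def)
  show "state_inv t \<sigma>'"
    unfolding state_inv_def eq state.sel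
  proof (intro conjI ballI impI allI)
    fix x assume x: "x \<in> set X'"
    show "t < eend x" "k' < ek x + B" using F(6)[OF x] P(2)[of x] B_pos by auto
    assume "estart x = t"
    then have "x \<notin> set X1" using P(2)[of x] fewX[of x] by auto
    then show "if erej x then Q' = [] \<and> (\<forall>z\<in>set Z'. jproc (ejob x) \<le> jproc z) else \<forall>q\<in>set Q'. better (ejob x) q"
      using F(6)[OF x] by simp
  qed (use F(1-3) A(2,4) in auto)
  show "set (outs \<sigma>) \<subseteq> set (outs \<sigma>')" using P(3) by (simp add: \<sigma> eq)
  show "a \<in> set (outs \<sigma>') \<Longrightarrow> a \<in> set (outs \<sigma>) \<or> (ostop a = t \<and> okey a \<in> xkey ` set (running \<sigma>))"
    using P(4) by (simp add: \<sigma> eq)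
  show "x \<in> set (running \<sigma>) \<Longrightarrow> x \<in> set (running \<sigma>') \<or> (\<exists>a\<in>set (outs \<sigma>'). okey a = xkey x)"
    using P(5)[of x] F(4) by (auto simp: \<sigma> eq)
  show "y \<in> set (running \<sigma>') \<Longrightarrow> y \<in> set (running \<sigma>) \<or> estart y = t"
    using P(2)[of y] F(6)[of y] by (auto simp: \<sigma> eq)
  have "length pd' \<le> length pd" using A(2,3) pd by simp
  \<comment> \<open>An event is an arrival, which shortens the pending list, or the end of a run,
    which leaves the running list for good.\<close>
  moreover have "length pd' < length pd \<or> 0 < length (filter (\<lambda>x. eend x \<le> t) X)"
  proof -
    have "(pd \<noteq> [] \<and> next_time pd X = jrel (hd pd)) \<or> (\<exists>x\<in>set X. next_time pd X = eend x)"
      using next_time_in[of pd X] ne by blast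
    then show ?thesis
  proof (elim disjE)
    assume "pd \<noteq> [] \<and> next_time pd X = jrel (hd pd)"
    then obtain j pd0 where "pd = j # pd0" "jrel j \<le> t" using t by (cases pd) auto
    then show ?thesis using arrive_less[of t j pd0 k Q] ar by auto
  next
    assume "\<exists>x\<in>set X. next_time pd X = eend x"
    then show ?thesis using t by (auto simp: filter_empty_conv)
  qed
  qed
  ultimately show "meas \<sigma>' < meas \<sigma>"
    using A(5) P(6) F(5) unfolding \<sigma> eq meas_def state.sel by linarith
qed

text \<open>Open runs end at the next event or later, and all that a step adds starts or ends at
  that event. Nothing is visible of it before.\<close>

lemma same_until_step:
  assumes "state_inv T \<sigma>" "\<not> idle \<sigma>" "\<theta> < nt \<sigma>"
  shows "same_until \<theta> (all_runs \<sigma>) (all_runs (step B h \<sigma>))"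
proof -
  let ?\<sigma>' = "step B h \<sigma>"
  note S = step_state[OF assms(1,2) refl refl]
  have e: "\<theta> < eend x" if "x \<in> set (running \<sigma>)" for x
    using next_time_le(1)[OF that, of "pend \<sigma>"] assms(3) by (simp add: nt_def)
  have e': "\<theta> < eend x" if "x \<in> set (running ?\<sigma>')" for x
    using S(1) that assms(3) by (force simp: state_inv_def)
  have okey_le: "ostart a = estart x" if "okey a = xkey x" for a x using that by (simp add: okey_def xkey_def)
  show ?thesis
    unfolding same_until_key
  proof (intro conjI set_eqI iffI)
    fix \<kappa> assume "\<kappa> \<in> run_key ` {a \<in> all_runs \<sigma>. start a \<le> \<theta>}"
    then consider a where "a \<in> set (outs \<sigma>)" "\<kappa> = okey a" "ostart a \<le> \<theta>"
      | x where "x \<in> set (running \<sigma>)" "\<kappa> = xkey x" "estart x \<le> \<theta>" by (auto simp: all_runs_def)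
    then show "\<kappa> \<in> run_key ` {a \<in> all_runs ?\<sigma>'. start a \<le> \<theta>}"
    proof cases
      case 1
      then show ?thesis using S(3) by (intro image_eqI[of _ _ "orun_run a"]) (auto simp: all_runs_def)
    next
      case 2
      from S(5)[OF 2(1)] show ?thesis
      proof
        assume "x \<in> set (running ?\<sigma>')"
        then show ?thesis using 2 by (intro image_eqI[of _ _ "ent_run x"]) (auto simp: all_runs_def)
      next
        assume "\<exists>a\<in>set (outs ?\<sigma>'). okey a = xkey x"
        then obtain a where "a \<in> set (outs ?\<sigma>')" "okey a = xkey x" by blast
        then show ?thesis using 2 okey_le[of a x] by (intro image_eqI[of _ _ "orun_run a"]) (auto simp: all_runs_def)
      qed
    qed
  next
    fix \<kappa> assume "\<kappa> \<in> run_key ` {a \<in> all_runs ?\<sigma>'. start a \<le> \<theta>}"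
    then consider a where "a \<in> set (outs ?\<sigma>')" "\<kappa> = okey a" "ostart a \<le> \<theta>"
      | x where "x \<in> set (running ?\<sigma>')" "\<kappa> = xkey x" "estart x \<le> \<theta>" by (auto simp: all_runs_def)
    then show "\<kappa> \<in> run_key ` {a \<in> all_runs \<sigma>. start a \<le> \<theta>}"
    proof cases
      case 1
      from S(4)[OF 1(1)] show ?thesis
      proof
        assume "a \<in> set (outs \<sigma>)"
        then show ?thesis using 1 by (intro image_eqI[of _ _ "orun_run a"]) (auto simp: all_runs_def)
      next
        assume "ostop a = nt \<sigma> \<and> okey a \<in> xkey ` set (running \<sigma>)"
        then obtain x where "x \<in> set (running \<sigma>)" "okey a = xkey x" by blast
        then show ?thesis using 1 okey_le[of a x] by (intro image_eqI[of _ _ "ent_run x"]) (auto simp: all_runs_def)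
      qed
    next
      case 2
      then have "x \<in> set (running \<sigma>)" using S(6)[OF 2(1)] assms(3) by auto
      then show ?thesis using 2 by (intro image_eqI[of _ _ "ent_run x"]) (auto simp: all_runs_def)
    qed
  next
    fix a assume "a \<in> {a \<in> all_runs \<sigma>. stop a \<le> \<theta>}"
    then show "a \<in> {a \<in> all_runs ?\<sigma>'. stop a \<le> \<theta>}" using e S(3) by (fastforce simp: all_runs_def)
  next
    fix a assume "a \<in> {a \<in> all_runs ?\<sigma>'. stop a \<le> \<theta>}"
    then obtain o' where o': "o' \<in> set (outs ?\<sigma>')" "a = orun_run o'" "ostop o' \<le> \<theta>"
      using e' by (fastforce simp: all_runs_def)
    then have "o' \<in> set (outs \<sigma>)" using S(4)[OF o'(1)] assms(3) by auto
    then show "a \<in> {a \<in> all_runs \<sigma>. stop a \<le> \<theta>}" using o' by (auto simp: all_runs_def)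
  qed
qed

section \<open>The simulation as a whole\<close>

lemma step_idle: "idle \<sigma> \<Longrightarrow> step B h \<sigma> = \<sigma>"
  by (cases \<sigma>) (simp add: idle_def)

lemma loop_idle: "idle \<sigma> \<Longrightarrow> loop B h N \<sigma> = \<sigma>"
  by (induction N) (simp_all add: step_idle)

lemma same_until_loop:
  "state_inv T \<sigma> \<Longrightarrow> (\<not> idle \<sigma> \<Longrightarrow> \<theta> < nt \<sigma>) \<Longrightarrow> same_until \<theta> (all_runs \<sigma>) (all_runs (loop B h N \<sigma>))"
proof (induction N arbitrary: T \<sigma>)
  case 0
  then show ?case by (simp add: same_until_def)
next
  case (Suc N)
  show ?case
  proof (cases "idle \<sigma>")
    case True
    then show ?thesis by (simp add: step_idle loop_idle same_until_def)
  next
    case False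
    note S = step_state(1)[OF Suc.prems(1) False refl refl]
    have "same_until \<theta> (all_runs (step B h \<sigma>)) (all_runs (loop B h N (step B h \<sigma>)))"
      using nt_gt[OF S] Suc.prems(2)[OF False] by (intro Suc.IH[OF S]) simp
    moreover have "same_until \<theta> (all_runs \<sigma>) (all_runs (step B h \<sigma>))"
      using same_until_step[OF Suc.prems(1) False] Suc.prems(2)[OF False] .
    ultimately show ?thesis by (simp add: same_until_def)
  qed
qed

lemma loop_final:
  "state_inv T \<sigma> \<Longrightarrow> meas \<sigma> \<le> N \<Longrightarrow> idle (loop B h N \<sigma>) \<and> (\<exists>T'. state_inv T' (loop B h N \<sigma>))"
proof (induction N arbitrary: T \<sigma>)
  case 0
  then show ?case by (auto simp: meas_def idle_def)
next
  case (Suc N)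
  show ?case
  proof (cases "idle \<sigma>")
    case True
    then show ?thesis using Suc.prems by (auto simp: step_idle loop_idle)
  next
    case False
    note S = step_state(1,2)[OF Suc.prems(1) False refl refl]
    then show ?thesis using Suc.IH[OF S(1)] Suc.prems(2) by simp
  qed
qed

text \<open>Stop the simulation before its first event after \<open>\<theta>\<close>: the state
  reached agrees up to \<open>\<theta>\<close> with the final schedule. In this way invariants of
  states become statements about the finished schedule at an arbitrary time.\<close>

lemma snapshot:
  "state_inv T \<sigma> \<Longrightarrow> T \<le> \<theta> \<Longrightarrow> meas \<sigma> \<le> N \<Longrightarrow> \<exists>T' \<sigma>'. state_inv T' \<sigma>' \<and> T' \<le> \<theta> \<and>
    same_until \<theta> (all_runs \<sigma>') (all_runs (loop B h N \<sigma>)) \<and> (\<forall>j<length J. rl j \<le> \<theta> \<longleftrightarrow> j < relno \<sigma>') \<and>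
    (\<forall>x\<in>set (running \<sigma>'). \<theta> < eend x)"
proof (induction N arbitrary: T \<sigma>)
  case 0
  then have id: "idle \<sigma>" by (auto simp: meas_def idle_def)
  have "length J \<le> relno \<sigma>" using 0 id by (auto simp: state_inv_def idle_def)
  then have "rl j \<le> \<theta>" if "j < length J" for j using 0 that by (force simp: state_inv_def)
  then show ?case using 0 id \<open>length J \<le> relno \<sigma>\<close> by (intro exI[of _ T] exI[of _ \<sigma>]) (auto simp: same_until_def idle_def)
next
  case (Suc N)
  show ?case
  proof (cases "idle \<sigma>")
    case True
    have "length J \<le> relno \<sigma>" using Suc.prems True by (auto simp: state_inv_def idle_def)
    then have "rl j \<le> \<theta>" if "j < length J" for j using Suc.prems that by (force simp: state_inv_def)
    then show ?thesis using Suc.prems True \<open>length J \<le> relno \<sigma>\<close>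
      by (intro exI[of _ T] exI[of _ \<sigma>]) (auto simp: same_until_def idle_def step_idle loop_idle)
  next
    case False
    note S = step_state(1,2)[OF Suc.prems(1) False refl refl]
    show ?thesis
    proof (cases "nt \<sigma> \<le> \<theta>")
      case True
      then show ?thesis using Suc.IH[OF S(1) True] S(2) Suc.prems(3) by simp
    next
      case lt: False
      then have same: "same_until \<theta> (all_runs \<sigma>) (all_runs (loop B h (Suc N) \<sigma>))"
        by (intro same_until_loop[OF Suc.prems(1)]) simp
      have "rl j \<le> \<theta> \<longleftrightarrow> j < relno \<sigma>" if j: "j < length J" for j
      proof
        assume "j < relno \<sigma>"
        then show "rl j \<le> \<theta>" using j Suc.prems by (force simp: state_inv_def)
      next
        assume le: "rl j \<le> \<theta>"
        show "j < relno \<sigma>"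
        proof (rule ccontr)
          assume "\<not> j < relno \<sigma>"
          then have kj: "relno \<sigma> < length J" "rl (relno \<sigma>) \<le> rl j" using j rl_mono[of "relno \<sigma>" j] by auto
          then have "pend \<sigma> = J ! relno \<sigma> # drop (Suc (relno \<sigma>)) J"
            using Suc.prems(1) by (simp add: state_inv_def Cons_nth_drop_Suc)
          then have "nt \<sigma> \<le> rl (relno \<sigma>)" unfolding nt_def by (rule next_time_le(2))
          then show False using kj lt le by linarith
        qed
      qed
      moreover have "\<theta> < eend x" if "x \<in> set (running \<sigma>)" for x
        using next_time_le(1)[OF that, of "pend \<sigma>"] lt by (simp add: nt_def)
      ultimately show ?thesis using same Suc.prems by blast
    qed
  qed
qed

text \<open>The machines are listed in descending order because the program produces them by
  counting down.\<close>

definition init :: "real state" where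
  "init = St J 0 [] [] [] (rev [0..<M]) []"

text \<open>The clock starts at a negative time, since jobs released at 0 must not count as released
  already.\<close>

lemma init_inv: "state_inv (- 1) init"
proof -
  have "sim_inv J B h M (- 1) 0 [] [] [] (rev [0..<M]) []"
    by unfold_locales auto
  moreover have "\<not> rl j \<le> - 1" if "j < length J" for j using rel_nonneg[OF that] by simp
  ultimately show ?thesis by (auto simp: state_inv_def init_def)
qed

lemma meas_init: "meas init = 2 * length J"
  by (simp add: meas_def init_def)

end

section \<open>Flow time of schedules with the restart discipline\<close>

text \<open>Indicators of half-open intervals, like the runs themselves. Integrating sums of them
  turns a bound valid at every moment into one on total lengths.\<close>

definition iv :: "real \<Rightarrow> real \<Rightarrow> real \<Rightarrow> real" where
  "iv l u \<theta> = of_bool (l \<le> \<theta> \<and> \<theta> < u)"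

lemma iv_nonneg [simp]: "0 \<le> iv l u \<theta>"
  by (simp add: iv_def)

lemma iv_integral: "l \<le> u \<Longrightarrow> has_bochner_integral lborel (iv l u) (u - l)"
proof -
  assume "l \<le> u"
  moreover have "iv l u = indicator {l..<u}"
    by (auto simp: iv_def indicator_def fun_eq_iff)
  ultimately show ?thesis
    using has_bochner_integral_real_indicator[of "{l..<u}" lborel] by simp
qed

lemma sum_iv_integral:
  assumes "finite I" "\<And>i. i \<in> I \<Longrightarrow> l i \<le> u i"
  shows "has_bochner_integral lborel (\<lambda>\<theta>. \<Sum>i\<in>I. w i * iv (l i) (u i) \<theta>) (\<Sum>i\<in>I. w i * (u i - l i))"
  using assms by (intro has_bochner_integral_sum has_bochner_integral_mult_right iv_integral) auto

lemma sum_iv_integral_1: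
  assumes "finite I" "\<And>i. i \<in> I \<Longrightarrow> l i \<le> u i"
  shows "has_bochner_integral lborel (\<lambda>\<theta>. \<Sum>i\<in>I. iv (l i) (u i) \<theta>) (\<Sum>i\<in>I. u i - l i)"
  using sum_iv_integral[where w = "\<lambda>_. 1", OF assms] by simp

lemma has_bochner_integral_le:
  fixes f g :: "real \<Rightarrow> real"
  assumes "has_bochner_integral lborel f x" "has_bochner_integral lborel g y" "\<And>\<theta>. f \<theta> \<le> g \<theta>"
  shows "x \<le> y"
  using integral_mono[of lborel f g] assms by (simp add: has_bochner_integral_iff)

section \<open>Lower bounds for preemptive schedules\<close>

lemma valid_runsD:
  assumes "valid_runs m J V" "a \<in> V"
  shows "job a < length J" "machine a < m" "release (J ! job a) \<le> start a" "start a < stop a"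
  using assms by (simp_all add: valid_runs_def)

lemma valid_runs_disjoint:
  "valid_runs m J V \<Longrightarrow> a \<in> V \<Longrightarrow> b \<in> V \<Longrightarrow> a \<noteq> b \<Longrightarrow> machine a = machine b \<or> job a = job b \<Longrightarrow> disjoint_time a b"
  unfolding valid_runs_def by blast

lemma valid_runs_active_le:
  assumes "valid_runs m J V"
  shows "card {a \<in> V. start a \<le> \<theta> \<and> \<theta> < stop a} \<le> m"
proof -
  let ?A = "{a \<in> V. start a \<le> \<theta> \<and> \<theta> < stop a}"
  have "inj_on machine ?A"
  proof (rule inj_onI, rule ccontr)
    fix a b assume "a \<in> ?A" "b \<in> ?A" "machine a = machine b" "a \<noteq> b"
    then have "disjoint_time a b" using assms by (simp add: valid_runs_def)
    then show False using \<open>a \<in> ?A\<close> \<open>b \<in> ?A\<close> by (auto simp: disjoint_time_def)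
  qed
  moreover have "machine ` ?A \<subseteq> {..<m}" using assms by (auto simp: valid_runs_def)
  ultimately have "card ?A \<le> card {..<m}" by (intro card_inj_on_le) auto
  then show ?thesis by simp
qed

lemma sum_iv_eq_card:
  "finite V \<Longrightarrow> (\<Sum>a\<in>V. iv (l a) (u a) \<theta>) = card {a \<in> V. l a \<le> \<theta> \<and> \<theta> < u a}"
  by (simp add: iv_def of_bool_def sum.If_cases Int_def)

text \<open>Jobs released from \<open>T\<close> on that are complete at \<open>t\<close> fit into the capacity of \<open>[T, t]\<close>; the others
  are alive.\<close>

lemma preemptive_volume:
  assumes pre: "preemptive_schedule m J V" and "T \<le> t"
    and R: "\<And>j. j \<in> R \<Longrightarrow> j < length J \<and> T \<le> release (J ! j) \<and> release (J ! j) \<le> t \<and> proc (J ! j) \<le> x"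
    and x: "0 \<le> x"
  shows "(\<Sum>j\<in>R. proc (J ! j)) \<le> real m * (t - T) +
    x * card {j. j < length J \<and> release (J ! j) \<le> t \<and> t < Defs.completion V j}"
proof -
  define N where "N = {j. j < length J \<and> release (J ! j) \<le> t \<and> t < Defs.completion V j}"
  define R1 where "R1 = R - N"
  define V1 where "V1 = {a \<in> V. job a \<in> R1}"
  have val: "valid_runs m J V" and fin: "finite V"
    using pre unfolding preemptive_schedule_def valid_runs_def by blast+
  have eq: "(\<Sum>a | a \<in> V \<and> job a = j. stop a - start a) = proc (J ! j)" if "j < length J" for j
    using pre that unfolding preemptive_schedule_def by blast
  have finR: "finite R" using R by (intro finite_subset[of R "{..<length J}"]) auto
  have V1T: "T \<le> start a \<and> start a < stop a \<and> stop a \<le> t" if "a \<in> V1" for a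
  proof -
    have "T \<le> release (J ! job a)" "release (J ! job a) \<le> start a" "start a < stop a"
      using that R[of "job a"] valid_runsD[OF val, of a] unfolding V1_def R1_def by blast+
    moreover have "stop a \<le> Defs.completion V (job a)"
      unfolding Defs.completion_def using fin that by (intro Max_ge) (auto simp: V1_def)
    moreover have "Defs.completion V (job a) \<le> t" using that R[of "job a"] by (auto simp: V1_def R1_def N_def)
    ultimately show ?thesis by linarith
  qed
  have "(\<Sum>j\<in>R1. proc (J ! j)) = (\<Sum>j\<in>R1. \<Sum>a | a \<in> V \<and> job a = j. stop a - start a)"
    using R eq by (intro sum.cong refl) (metis DiffD1 R1_def)
  also have "\<dots> = (\<Sum>j\<in>R1. \<Sum>a | a \<in> V1 \<and> job a = j. stop a - start a)"
    by (intro sum.cong refl) (auto simp: V1_def)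
  also have "\<dots> = (\<Sum>a\<in>V1. stop a - start a)"
    by (rule sum.group) (use fin finR in \<open>auto simp: V1_def R1_def\<close>)
  also have "\<dots> \<le> real m * (t - T)"
  proof (rule has_bochner_integral_le)
    show "has_bochner_integral lborel (\<lambda>\<theta>. \<Sum>a\<in>V1. iv (start a) (stop a) \<theta>)
        (\<Sum>a\<in>V1. stop a - start a)"
      by (rule sum_iv_integral_1) (use fin V1T less_imp_le V1_def in auto)
    show "has_bochner_integral lborel (\<lambda>\<theta>. real m * iv T t \<theta>) (real m * (t - T))"
      using \<open>T \<le> t\<close> by (intro has_bochner_integral_mult_right iv_integral)
    fix \<theta>
    let ?A = "{a \<in> V1. start a \<le> \<theta> \<and> \<theta> < stop a}"
    have "card ?A \<le> card {a \<in> V. start a \<le> \<theta> \<and> \<theta> < stop a}"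
      using fin by (intro card_mono) (auto simp: V1_def)
    also have "\<dots> \<le> m" by (rule valid_runs_active_le[OF val])
    finally have "card ?A \<le> m" .
    have "real (card ?A) \<le> real m * iv T t \<theta>"
    proof (cases "?A = {}")
      case True
      show ?thesis unfolding True by simp
    next
      case False
      then obtain a where "a \<in> ?A" by blast
      then have "T \<le> start a" "stop a \<le> t" "start a \<le> \<theta>" "\<theta> < stop a" using V1T[of a] by blast+
      then have "T \<le> \<theta> \<and> \<theta> < t" by linarith
      then show ?thesis using \<open>card ?A \<le> m\<close> by (simp add: iv_def)
    qed
    then show "(\<Sum>a\<in>V1. iv (start a) (stop a) \<theta>) \<le> real m * iv T t \<theta>"
      using fin by (simp add: sum_iv_eq_card V1_def)
  qed
  finally have 1: "(\<Sum>j\<in>R1. proc (J ! j)) \<le> real m * (t - T)" .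
  have "(\<Sum>j\<in>R \<inter> N. proc (J ! j)) \<le> (\<Sum>j\<in>R \<inter> N. x)" using R by (intro sum_mono) blast
  also have "\<dots> = x * card (R \<inter> N)" by simp
  also have "\<dots> \<le> x * card N" using x by (intro mult_left_mono) (auto intro!: card_mono simp: N_def)
  finally have "(\<Sum>j\<in>R \<inter> N. proc (J ! j)) \<le> x * card N" .
  with 1 show ?thesis by (subst sum.Int_Diff[OF finR, of _ N]) (simp add: R1_def N_def)
qed

text \<open>The runs of one job are disjoint in time, so their lengths add up within the span from
  release to completion.\<close>

lemma preemptive_flow_ge_proc:
  assumes pre: "preemptive_schedule m J V" and j: "j < length J" and pos: "0 < proc (J ! j)"
  shows "proc (J ! j) \<le> Defs.completion V j - release (J ! j)"
proof -
  let ?V = "{a \<in> V. job a = j}"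
  have val: "valid_runs m J V" using pre unfolding preemptive_schedule_def by blast
  have fin: "finite ?V" using pre unfolding preemptive_schedule_def valid_runs_def by simp
  have eq: "(\<Sum>a\<in>?V. stop a - start a) = proc (J ! j)"
    using pre j unfolding preemptive_schedule_def by blast
  have V: "release (J ! j) \<le> start a \<and> start a < stop a \<and> stop a \<le> Defs.completion V j" if "a \<in> ?V" for a
  proof -
    have "valid_runs m J V" using pre unfolding preemptive_schedule_def by blast
    then show ?thesis using that valid_runsD[of m J V a] fin
      unfolding Defs.completion_def by (auto intro!: Max_ge)
  qed
  have "?V \<noteq> {}" using eq pos by (metis less_irrefl sum.empty)
  then obtain b where "b \<in> ?V" by blast
  then have le: "release (J ! j) \<le> Defs.completion V j" using V[of b] by simp
  have "(\<Sum>a\<in>?V. stop a - start a) \<le> Defs.completion V j - release (J ! j)"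
  proof (rule has_bochner_integral_le)
    show "has_bochner_integral lborel (\<lambda>\<theta>. \<Sum>a\<in>?V. iv (start a) (stop a) \<theta>)
        (\<Sum>a\<in>?V. stop a - start a)"
      by (rule sum_iv_integral_1) (use fin V less_imp_le in blast)+
    show "has_bochner_integral lborel (iv (release (J ! j)) (Defs.completion V j)) (Defs.completion V j - release (J ! j))"
      using le by (rule iv_integral)
    fix \<theta>
    let ?A = "{a \<in> ?V. start a \<le> \<theta> \<and> \<theta> < stop a}"
    have "a = b" if "a \<in> ?A" "b \<in> ?A" for a b
    proof (rule ccontr)
      assume "a \<noteq> b"
      then have "disjoint_time a b" using that by (intro valid_runs_disjoint[OF val]) auto
      then show False using that by (auto simp: disjoint_time_def)
    qed
    moreover have "finite ?A" by (rule finite_subset[OF _ fin]) auto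
    ultimately have "card ?A \<le> Suc 0" by (subst card_le_Suc0_iff_eq) auto
    have "real (card ?A) \<le> iv (release (J ! j)) (Defs.completion V j) \<theta>"
    proof (cases "?A = {}")
      case True
      show ?thesis unfolding True by simp
    next
      case False
      then obtain a where "a \<in> ?A" by blast
      then have "release (J ! j) \<le> start a" "stop a \<le> Defs.completion V j" "start a \<le> \<theta>" "\<theta> < stop a"
        using V[of a] by blast+
      then have "release (J ! j) \<le> \<theta> \<and> \<theta> < Defs.completion V j" by linarith
      then show ?thesis using \<open>card ?A \<le> Suc 0\<close> by (simp add: iv_def)
    qed
    then show "(\<Sum>a\<in>?V. iv (start a) (stop a) \<theta>) \<le> iv (release (J ! j)) (Defs.completion V j) \<theta>"
      using fin by (simp add: sum_iv_eq_card)
  qed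
  with eq show ?thesis by simp
qed

section \<open>Waiting jobs, and what the analysis assumes of a schedule\<close>

locale flow_setting =
  fixes m n \<beta> :: nat and J :: "real job list" and S :: schedule and cl :: "nat \<Rightarrow> int"
begin

definition r :: "nat \<Rightarrow> real" where "r j = release (J ! j)"

definition p :: "nat \<Rightarrow> real" where "p j = proc (J ! j)"

definition act :: "real \<Rightarrow> run set" where
  "act \<theta> = {a \<in> S. start a \<le> \<theta> \<and> \<theta> < stop a}"

definition first :: "run \<Rightarrow> bool" where
  "first a \<longleftrightarrow> (\<forall>b\<in>S. job b = job a \<longrightarrow> start a \<le> start b)"

text \<open>\<open>fw \<theta>\<close> are the fresh jobs waiting at time \<open>\<theta>\<close>, \<open>rw \<theta>\<close> the killed jobs waiting for a restart.\<close>

definition fw :: "real \<Rightarrow> nat set" where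
  "fw \<theta> = {j. j < n \<and> r j \<le> \<theta> \<and> (\<forall>a\<in>S. job a = j \<longrightarrow> \<theta> < start a)}"

definition rw :: "real \<Rightarrow> nat set" where
  "rw \<theta> = {j. j < n \<and> (\<exists>a\<in>S. job a = j \<and> start a \<le> \<theta>) \<and>
     (\<exists>a\<in>S. job a = j \<and> \<theta> < start a) \<and> (\<forall>a\<in>act \<theta>. job a \<noteq> j)}"

end

text \<open>The analysis knows the schedule only through these properties; the simulation comes in
  again when \<open>alg_analysis\<close> verifies them. Priorities are required at the starts of
  runs only, and whatever arrives during a run is controlled by \<open>few\<close>.\<close>

locale restart_analysis = flow_setting +
  assumes inst: "is_instance J" and len: "length J = n"
    and m2: "2 \<le> m" and b2: "2 \<le> \<beta>" and nb: "n \<le> m * \<beta>\<^sup>2"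
    and valid: "valid_runs m J S"
    and cl_lower: "\<And>j. j < n \<Longrightarrow> real \<beta> powi cl j \<le> p j"
    and cl_upper: "\<And>j. j < n \<Longrightarrow> p j < real \<beta> powi (cl j + 1)"
    and run_len: "\<And>a. a \<in> S \<Longrightarrow> stop a - start a \<le> p (job a)"
    and all_run: "\<And>j. j < n \<Longrightarrow> \<exists>a\<in>S. job a = j"
    and retry: "\<And>a b. a \<in> S \<Longrightarrow> b \<in> S \<Longrightarrow> job a = job b \<Longrightarrow> start a < start b \<Longrightarrow>
      stop a - start a < p (job a)"
    and fw_busy: "\<And>\<theta>. fw \<theta> \<noteq> {} \<Longrightarrow> m \<le> card (act \<theta>)"
    and fw_prio: "\<And>a j. a \<in> S \<Longrightarrow> j \<in> fw (start a) \<Longrightarrow>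
      first a \<and> (cl (job a) < cl j \<or> cl (job a) = cl j \<and> j < job a)"
    and few: "\<And>a. a \<in> S \<Longrightarrow> card {j. j < n \<and> start a < r j \<and> r j < stop a} < m * \<beta>"
    and killed_many: "\<And>a. a \<in> S \<Longrightarrow> stop a - start a < p (job a) \<Longrightarrow>
      m * \<beta> \<le> card {j. j < n \<and> start a < r j \<and> r j \<le> stop a}"
    and rw_busy: "\<And>\<theta>. rw \<theta> \<noteq> {} \<Longrightarrow> m \<le> card (act \<theta>) \<or> m div 2 \<le> card {a \<in> act \<theta>. \<not> first a}"
    and rw_cap: "\<And>\<theta>. card {a \<in> act \<theta>. \<not> first a} \<le> m div 2"
    and rw_prio: "\<And>a j. a \<in> S \<Longrightarrow> \<not> first a \<Longrightarrow> j \<in> rw (start a) \<Longrightarrow> p (job a) \<le> p j"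
begin

lemma finS: "finite S"
  using valid by (simp add: valid_runs_def)

lemma runD:
  assumes "a \<in> S"
  shows "job a < n" "machine a < m" "r (job a) \<le> start a" "start a < stop a"
  using valid assms len by (auto simp: valid_runs_def r_def)

lemma run_disjoint:
  "a \<in> S \<Longrightarrow> b \<in> S \<Longrightarrow> a \<noteq> b \<Longrightarrow> machine a = machine b \<or> job a = job b \<Longrightarrow> disjoint_time a b"
  using valid by (auto simp: valid_runs_def)

lemma p_pos: "j < n \<Longrightarrow> 0 < p j"
  using inst len by (auto simp: is_instance_def p_def)

lemma r_mono: "i \<le> j \<Longrightarrow> j < n \<Longrightarrow> r i \<le> r j"
  using inst len sorted_nth_mono[of "map fst J" i j] by (auto simp: is_instance_def r_def)

lemma fin_act [simp]: "finite (act \<theta>)"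
  using finS by (simp add: act_def)

lemma fin_fw [simp]: "finite (fw \<theta>)" and fin_rw [simp]: "finite (rw \<theta>)"
  by (simp_all add: fw_def rw_def)

lemma fw_lt: "j \<in> fw \<theta> \<Longrightarrow> j < n" and rw_lt: "j \<in> rw \<theta> \<Longrightarrow> j < n"
  by (auto simp: fw_def rw_def)

lemma card_act_le: "card (act \<theta>) \<le> m"
  unfolding act_def by (rule valid_runs_active_le[OF valid])

section \<open>Counting kills and restarts\<close>

definition killed :: "run set" where
  "killed = {a \<in> S. stop a - start a < p (job a)}"

lemma killed_S: "a \<in> killed \<Longrightarrow> a \<in> S" by (simp add: killed_def)

lemma fin_killed: "finite killed" using finS by (simp add: killed_def)

text \<open>Each kill accounts for \<open>m * \<beta>\<close> releases after the start and up to the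
  end of the run. Such intervals, open on the left, are disjoint even where runs touch, and there
  are only \<open>n \<le> \<beta> * (m * \<beta>)\<close> releases.\<close>

lemma card_killed_disjoint:
  assumes T: "T \<subseteq> killed" and disj: "\<And>a b. a \<in> T \<Longrightarrow> b \<in> T \<Longrightarrow> a \<noteq> b \<Longrightarrow> disjoint_time a b"
  shows "card T \<le> \<beta>"
proof -
  let ?N = "\<lambda>a. {j. j < n \<and> start a < r j \<and> r j \<le> stop a}"
  have fin: "finite T" using T fin_killed finite_subset by blast
  have "(\<Sum>a\<in>T. m * \<beta>) \<le> (\<Sum>a\<in>T. card (?N a))"
    using T killed_many by (intro sum_mono) (auto simp: killed_def)
  also have "\<dots> = card (\<Union>a\<in>T. ?N a)"
  proof (rule card_UN_disjoint[symmetric])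
    show "\<forall>a\<in>T. \<forall>b\<in>T. a \<noteq> b \<longrightarrow> ?N a \<inter> ?N b = {}"
      using disj by (fastforce simp: disjoint_time_def)
  qed (use fin in auto)
  also have "\<dots> \<le> card {..<n}" by (intro card_mono) auto
  also have "\<dots> \<le> \<beta> * (m * \<beta>)" using nb by (simp add: power2_eq_square ac_simps)
  finally have "card T * (m * \<beta>) \<le> \<beta> * (m * \<beta>)" by simp
  then show ?thesis using m2 b2 by simp
qed

lemma card_killed_machine: "card {a \<in> killed. machine a = i} \<le> \<beta>"
  by (rule card_killed_disjoint) (auto simp: killed_def intro: run_disjoint)

lemma card_killed_job: "card {a \<in> killed. job a = j} \<le> \<beta>"
  by (rule card_killed_disjoint) (auto simp: killed_def intro: run_disjoint)

lemma card_killed: "card killed \<le> m * \<beta>"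
proof -
  have "killed = (\<Union>i<m. {a \<in> killed. machine a = i})"
    using runD(2) killed_S by auto
  moreover have "card (\<Union>i<m. {a \<in> killed. machine a = i}) \<le> (\<Sum>i<m. card {a \<in> killed. machine a = i})"
    by (rule card_UN_le) simp
  ultimately have "card killed \<le> (\<Sum>i<m. card {a \<in> killed. machine a = i})" by simp
  also have "\<dots> \<le> (\<Sum>i<m. \<beta>)" by (intro sum_mono card_killed_machine)
  finally show ?thesis by simp
qed

lemma job_runs_start_inj: "a \<in> S \<Longrightarrow> b \<in> S \<Longrightarrow> job a = job b \<Longrightarrow> start a = start b \<Longrightarrow> a = b"
  using run_disjoint[of a b] runD(4)[of a] runD(4)[of b] by (force simp: disjoint_time_def)

text \<open>All runs of the job but the last were killed, and all but the first are restarts.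
  Removing either one leaves equally many.\<close>

lemma card_nonfirst_job: "card {a \<in> S. job a = j \<and> \<not> first a} \<le> card {a \<in> killed. job a = j}"
proof (cases "{a \<in> S. job a = j} = {}")
  case True
  then have "{a \<in> S. job a = j \<and> \<not> first a} = {}" by blast
  then show ?thesis by (metis card.empty le0)
next
  case False
  let ?R = "{a \<in> S. job a = j}"
  have fin: "finite ?R" using finS by simp
  obtain f where f: "f \<in> ?R" "\<And>b. b \<in> ?R \<Longrightarrow> start f \<le> start b"
    using arg_min_if_finite(1)[OF fin False, of start] arg_min_least[OF fin False, of _ start] by blast
  obtain l where l: "l \<in> ?R" "\<And>b. b \<in> ?R \<Longrightarrow> start b \<le> start l"
    using arg_min_if_finite(1)[OF fin False, of "\<lambda>a. - start a"]
      arg_min_least[OF fin False, of _ "\<lambda>a. - start a"] by fastforce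
  have "first f" using f by (auto simp: first_def)
  have "{a \<in> S. job a = j \<and> \<not> first a} \<subseteq> ?R - {f}" using \<open>first f\<close> by auto
  then have "card {a \<in> S. job a = j \<and> \<not> first a} \<le> card (?R - {f})" using fin by (intro card_mono) auto
  also have "\<dots> = card (?R - {l})" using f(1) l(1) fin by (simp add: card_Diff_singleton)
  also have "\<dots> \<le> card {a \<in> killed. job a = j}"
  proof (rule card_mono)
    show "finite {a \<in> killed. job a = j}" using fin_killed by simp
    show "?R - {l} \<subseteq> {a \<in> killed. job a = j}"
    proof
      fix a assume a: "a \<in> ?R - {l}"
      then have "start a < start l" using l job_runs_start_inj[of a l]
        by (metis (mono_tags, lifting) DiffE insertI1 mem_Collect_eq order_le_less)
      then show "a \<in> {a \<in> killed. job a = j}" using a l retry[of a l] by (auto simp: killed_def)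
    qed
  qed
  finally show ?thesis .
qed

lemma card_by_job: "T \<subseteq> S \<Longrightarrow> card T = (\<Sum>j<n. card {a \<in> T. job a = j})"
proof -
  assume T: "T \<subseteq> S"
  then have fin: "finite T" using finS finite_subset by blast
  have "T = (\<Union>j\<in>{..<n}. {a \<in> T. job a = j})" using T runD(1) by auto
  then have "card T = card (\<Union>j\<in>{..<n}. {a \<in> T. job a = j})" by simp
  also have "\<dots> = (\<Sum>j<n. card {a \<in> T. job a = j})"
    using fin by (intro card_UN_disjoint) auto
  finally show ?thesis .
qed

lemma card_nonfirst: "card {a \<in> S. \<not> first a} \<le> m * \<beta>"
proof -
  have "card {a \<in> S. \<not> first a} = (\<Sum>j<n. card {a \<in> S. job a = j \<and> \<not> first a})"
    by (subst card_by_job) (auto intro!: sum.cong arg_cong[of _ _ card])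
  also have "\<dots> \<le> (\<Sum>j<n. card {a \<in> killed. job a = j})"
    by (intro sum_mono card_nonfirst_job)
  also have "\<dots> = card killed" using killed_S by (subst card_by_job[of killed]) auto
  finally show ?thesis using card_killed by simp
qed

lemma first_job_inj: "inj_on job {a \<in> S. first a}"
  by (rule inj_onI, rule job_runs_start_inj) (auto simp: first_def intro!: order_antisym)

text \<open>The witness is the latest run started by \<open>\<theta>\<close>: since the job runs
  again later, \<open>retry\<close> shows that it was killed. The last property says that the job
  stays idle from then to \<open>\<theta>\<close>.\<close>

lemma rw_killed:
  assumes "j \<in> rw \<theta>"
  obtains b where "b \<in> killed" "job b = j" "stop b \<le> \<theta>" "\<And>a. a \<in> S \<Longrightarrow> job a = j \<Longrightarrow> a \<noteq> b \<Longrightarrow> stop a \<le> start b \<or> \<theta> < start a"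
proof -
  let ?R = "{a \<in> S. job a = j \<and> start a \<le> \<theta>}"
  have fin: "finite ?R" and ne: "?R \<noteq> {}" using finS assms by (auto simp: rw_def)
  obtain b where b: "b \<in> ?R" "\<And>a. a \<in> ?R \<Longrightarrow> start a \<le> start b"
    using arg_min_if_finite(1)[OF fin ne, of "\<lambda>a. - start a"]
      arg_min_least[OF fin ne, of _ "\<lambda>a. - start a"] by fastforce
  obtain l where l: "l \<in> S" "job l = j" "\<theta> < start l" using assms by (auto simp: rw_def)
  have "b \<in> killed" using b l retry[of b l] by (auto simp: killed_def)
  moreover have "stop b \<le> \<theta>" using assms b(1) by (force simp: rw_def act_def)
  moreover have "stop a \<le> start b \<or> \<theta> < start a" if a: "a \<in> S" "job a = j" "a \<noteq> b" for a
  proof (cases "start a \<le> \<theta>")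
    case True
    then have "start a \<le> start b" using a b by auto
    then show ?thesis using run_disjoint[of a b] a b(1) runD(4)[of b] by (auto simp: disjoint_time_def)
  qed simp
  ultimately show ?thesis using that b(1) by blast
qed

lemma card_rw: "card (rw \<theta>) \<le> m * \<beta>"
proof -
  have "rw \<theta> \<subseteq> job ` killed" using rw_killed by blast
  then have "card (rw \<theta>) \<le> card killed" using fin_killed surj_card_le by blast
  then show ?thesis using card_killed by simp
qed

text \<open>The cap of \<open>m div 2\<close> on restarts leaves half of the machines to first runs
  whenever all are busy. First runs are what can be charged: over the whole schedule their length is
  at most the total processing time.\<close>

lemma card_first_act: "m \<le> card (act \<theta>) \<Longrightarrow> real m \<le> 2 * card {a \<in> act \<theta>. first a}"
proof -
  assume "m \<le> card (act \<theta>)"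
  moreover have "card (act \<theta>) = card {a \<in> act \<theta>. first a} + card {a \<in> act \<theta>. \<not> first a}"
    by (subst card_Un_disjoint[symmetric]) (auto intro: arg_cong[of _ _ card])
  ultimately show ?thesis using rw_cap[of \<theta>] by linarith
qed

text \<open>A job that waits for its restart at \<open>\<theta>\<close> but did not do so when \<open>a\<close> was started, was killed
  during \<open>a\<close>; no machine kills twice during \<open>a\<close>, because this takes \<open>m \<beta>\<close> releases.\<close>

lemma rw_le_start:
  assumes a: "a \<in> act \<theta>"
  shows "card (rw \<theta>) \<le> card (rw (start a)) + m"
proof -
  let ?K = "{b \<in> killed. start a < stop b \<and> stop b \<le> \<theta>}"
  have aS: "a \<in> S" "start a \<le> \<theta>" "\<theta> < stop a" using a by (auto simp: act_def)
  have "rw \<theta> \<subseteq> rw (start a) \<union> job ` ?K"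
  proof
    fix j assume j: "j \<in> rw \<theta>"
    from rw_killed[OF j] obtain b where b: "b \<in> killed" "job b = j" "stop b \<le> \<theta>"
      "\<And>a. a \<in> S \<Longrightarrow> job a = j \<Longrightarrow> a \<noteq> b \<Longrightarrow> stop a \<le> start b \<or> \<theta> < start a" by metis
    show "j \<in> rw (start a) \<union> job ` ?K"
    proof (cases "start a < stop b")
      case True then show ?thesis using b by auto
    next
      case False
      have "b \<in> S" using b killed_S by blast
      then have bs: "start b < stop b" using runD by blast
      have "\<exists>c\<in>S. job c = j \<and> start c \<le> start a" using \<open>b \<in> S\<close> bs False b(2)
        by (intro bexI[of _ b]) auto
      moreover have "\<exists>c\<in>S. job c = j \<and> start a < start c"
        using j aS by (force simp: rw_def)
      moreover have "job c \<noteq> j" if "c \<in> act (start a)" for c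
        using that b(4)[of c] bs False aS by (cases "c = b") (auto simp: act_def)
      ultimately show ?thesis using j by (simp add: rw_def)
    qed
  qed
  then have "card (rw \<theta>) \<le> card (rw (start a) \<union> job ` ?K)"
    using fin_killed by (intro card_mono) auto
  also have "\<dots> \<le> card (rw (start a)) + card (job ` ?K)" by (rule card_Un_le)
  also have "card (job ` ?K) \<le> card ?K" using fin_killed by (intro card_image_le) auto
  also have "card ?K \<le> card {..<m}"
  proof (rule card_inj_on_le[of machine])
    show "inj_on machine ?K"
    proof (rule inj_onI, rule ccontr)
      have *: False if "b \<in> ?K" "c \<in> ?K" "stop b \<le> start c" for b c
      proof -
        have "m * \<beta> \<le> card {j. j < n \<and> start c < r j \<and> r j \<le> stop c}"
          using that by (intro killed_many) (auto simp: killed_def)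
        also have "\<dots> \<le> card {j. j < n \<and> start a < r j \<and> r j < stop a}"
          using that aS by (intro card_mono) auto
        finally show False using few[OF aS(1)] by simp
      qed
      fix b c assume "b \<in> ?K" "c \<in> ?K" "machine b = machine c" "b \<noteq> c"
      with *[of b c] *[of c b] run_disjoint[of b c] show False
        by (auto simp: disjoint_time_def killed_def)
    qed
  qed (use runD killed_S in auto)
  finally show ?thesis by simp
qed


section \<open>Waiting jobs at one moment against the optimum\<close>

definition alive :: "schedule \<Rightarrow> real \<Rightarrow> nat set" where
  "alive V \<theta> = {j. j < n \<and> r j \<le> \<theta> \<and> \<theta> < Defs.completion V j}"

text \<open>The finitely many moments at which the active runs or the released jobs can
  change.\<close>

definition E :: "real set" where
  "E = start ` S \<union> stop ` S \<union> r ` {..<n}"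

lemma finE: "finite E" using finS by (simp add: E_def)

lemma act_const: "e \<le> \<theta> \<Longrightarrow> (\<And>x. x \<in> E \<Longrightarrow> x \<le> \<theta> \<Longrightarrow> x \<le> e) \<Longrightarrow> act e = act \<theta>"
proof -
  assume 1: "e \<le> \<theta>" and 2: "\<And>x. x \<in> E \<Longrightarrow> x \<le> \<theta> \<Longrightarrow> x \<le> e"
  have "start a \<le> e \<longleftrightarrow> start a \<le> \<theta>" "e < stop a \<longleftrightarrow> \<theta> < stop a" if "a \<in> S" for a
    using 1 2[of "start a"] 2[of "stop a"] that by (auto simp: E_def not_less[symmetric] simp del: not_less)
  then show ?thesis unfolding act_def by blast
qed

lemma beta_powi_mono: "i \<le> k \<Longrightarrow> real \<beta> powi i \<le> real \<beta> powi k"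
  using b2 by (intro power_int_increasing) auto

lemma p_le_class: "j < n \<Longrightarrow> cl j < c \<Longrightarrow> p j \<le> real \<beta> powi c"
  using cl_upper[of j] beta_powi_mono[of "cl j + 1" c] by linarith

text \<open>\<open>T1\<close> is the start of the period up to \<open>t\<close> in which all machines run fresh jobs of class at most \<open>c\<close>.
  Only \<open>m \<beta>\<close> of the class \<open>c\<close> jobs can be older, since they arrived during the run that ended at \<open>T1\<close>.  Of the
  others let \<open>j0\<close> be the oldest and \<open>T0\<close> the last start in the period of a job less urgent than \<open>j0\<close>.  Then
  from \<open>T0\<close> on the machines work on jobs released after \<open>T0\<close>, up to the runs active at \<open>T0\<close> and at most
  \<open>m \<beta>\<close> jobs of lower class, and the volume left is compared with the optimum.\<close>

lemma class_waiting:
  assumes pre: "preemptive_schedule m J V"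
    and busy: "m \<le> card (act t)" and cls: "\<And>a. a \<in> act t \<Longrightarrow> first a \<and> cl (job a) \<le> c"
  shows "real (card {j \<in> fw t. cl j = c}) \<le> \<beta> * card (alive V t) + 3 * m * \<beta>"
proof -
  define good where "good \<theta> \<longleftrightarrow> m \<le> card (act \<theta>) \<and> (\<forall>a\<in>act \<theta>. first a \<and> cl (job a) \<le> c)" for \<theta>
  \<comment> \<open>Restricting to event times makes the set finite, so that it has a least element.
    It contains the last event up to \<open>t\<close>, because \<open>act\<close> does not change
    from there to \<open>t\<close>.\<close>
  define E' where "E' = {\<theta> \<in> E. \<theta> \<le> t \<and> (\<forall>\<theta>'. \<theta> \<le> \<theta>' \<and> \<theta>' \<le> t \<longrightarrow> good \<theta>')}"
  have "act t \<noteq> {}" using busy m2 by auto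
  then have ne: "{x \<in> E. x \<le> t} \<noteq> {}" by (auto simp: act_def E_def)
  have "Max {x \<in> E. x \<le> t} \<in> E'"
  proof -
    define e where "e = Max {x \<in> E. x \<le> t}"
    have e: "e \<in> E" "e \<le> t" "\<And>x. x \<in> E \<Longrightarrow> x \<le> t \<Longrightarrow> x \<le> e"
      using Max_in[OF _ ne] finE unfolding e_def by auto
    have "act \<theta> = act t" if "e \<le> \<theta>" "\<theta> \<le> t" for \<theta>
    proof (rule act_const[OF that(2)])
      fix x assume "x \<in> E" "x \<le> t"
      then show "x \<le> \<theta>" using e(3)[of x] that(1) by linarith
    qed
    then have "good \<theta>" if "e \<le> \<theta>" "\<theta> \<le> t" for \<theta>
      unfolding good_def using that busy cls by metis
    then show ?thesis unfolding E'_def e_def[symmetric] using e(1,2) by simp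
  qed
  then have E'ne: "E' \<noteq> {}" by auto
  have finE': "finite E'" using finE by (simp add: E'_def)
  define T1 where "T1 = Min E'"
  have "T1 \<in> E'" unfolding T1_def by (rule Min_in[OF finE' E'ne])
  then have T1: "T1 \<le> t" "T1 \<in> E" "\<And>\<theta>. T1 \<le> \<theta> \<Longrightarrow> \<theta> \<le> t \<Longrightarrow> good \<theta>" by (auto simp: E'_def)

  define L where "L = {j. j < n \<and> r j < T1 \<and> (\<forall>a\<in>S. job a = j \<longrightarrow> T1 < start a) \<and> cl j \<le> c}"
  have cardL: "card L \<le> m * \<beta>"
  proof (cases "L = {}")
    case False
    then obtain j1 where j1: "j1 \<in> L" by blast
    \<comment> \<open>By minimality of \<open>T1\<close>, \<open>good\<close> fails at some
      \<open>\<theta>\<close> between \<open>e\<close> and \<open>T1\<close>. All of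
      \<open>L\<close> waits at \<open>\<theta>\<close>, so every machine is busy and the failure is
      due to a run \<open>\<kappa>\<close> that is a restart or has a class above \<open>c\<close>.
      It ends exactly at \<open>T1\<close>, and no job of \<open>L\<close> can have been waiting
      when it started.\<close>
    define e where "e = Max {x \<in> E. x < T1}"
    have ne1: "{x \<in> E. x < T1} \<noteq> {}" using j1 by (auto simp: L_def E_def)
    have e: "e \<in> E" "e < T1" "\<And>x. x \<in> E \<Longrightarrow> x < T1 \<Longrightarrow> x \<le> e"
      using Max_in[OF _ ne1] finE unfolding e_def by auto
    have "e \<notin> E'" using e(2) Min_le[OF finE'] unfolding T1_def by force
    then obtain \<theta> where \<theta>: "e \<le> \<theta>" "\<theta> \<le> t" "\<not> good \<theta>" using e T1(1) by (auto simp: E'_def)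
    have \<theta>1: "\<theta> < T1" using \<theta>(2,3) T1(3)[of \<theta>] by (meson not_le)
    have Lfw: "L \<subseteq> fw \<theta>"
    proof
      fix j assume j: "j \<in> L"
      then have "r j \<in> E" "r j < T1" by (auto simp: L_def E_def)
      then have "r j \<le> \<theta>" using e(3)[of "r j"] \<theta>(1) by simp
      then show "j \<in> fw \<theta>" using j \<theta>1 by (force simp: L_def fw_def)
    qed
    then have "m \<le> card (act \<theta>)" using j1 by (intro fw_busy) auto
    then obtain \<kappa> where \<kappa>: "\<kappa> \<in> act \<theta>" "\<not> (first \<kappa> \<and> cl (job \<kappa>) \<le> c)"
      using \<theta>(3) by (auto simp: good_def)
    then have \<kappa>S: "\<kappa> \<in> S" "start \<kappa> \<le> \<theta>" "\<theta> < stop \<kappa>" by (auto simp: act_def)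
    have st: "stop \<kappa> = T1"
    proof (rule order_antisym)
      show "T1 \<le> stop \<kappa>" using e(3)[of "stop \<kappa>"] \<theta>(1) \<kappa>S by (force simp: E_def)
      show "stop \<kappa> \<le> T1"
      proof (rule ccontr)
        assume "\<not> stop \<kappa> \<le> T1"
        then have "\<kappa> \<in> act T1" using \<kappa>S \<theta>1 by (simp add: act_def)
        then show False using T1(3)[of T1] T1(1) \<kappa>(2) by (auto simp: good_def)
      qed
    qed
    have "L \<subseteq> {j. j < n \<and> start \<kappa> < r j \<and> r j < stop \<kappa>}"
    proof
      fix j assume j: "j \<in> L"
      have "start \<kappa> < r j"
      proof (rule ccontr)
        assume "\<not> start \<kappa> < r j"
        then have "j \<in> fw (start \<kappa>)" using j \<kappa>S \<theta>1 by (force simp: fw_def L_def)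
        from fw_prio[OF \<kappa>S(1) this] show False using \<kappa>(2) j by (auto simp: L_def)
      qed
      then show "j \<in> {j. j < n \<and> start \<kappa> < r j \<and> r j < stop \<kappa>}" using j st by (auto simp: L_def)
    qed
    then have "card L \<le> card {j. j < n \<and> start \<kappa> < r j \<and> r j < stop \<kappa>}" by (intro card_mono) auto
    then show ?thesis using few[OF \<kappa>S(1)] by simp
  qed simp
  define W where "W = {j \<in> fw t. cl j = c}"
  define W' where "W' = {j \<in> W. T1 \<le> r j}"
  have finW: "finite W" "finite W'" by (simp_all add: W_def W'_def)
  have "W - W' \<subseteq> L" using T1(1) by (force simp: W_def W'_def L_def fw_def)
  then have "card (W - W') \<le> m * \<beta>" using cardL card_mono[of L "W - W'"] by (force simp: L_def)
  moreover have "card W \<le> card (W - W') + card W'"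
    using card_Un_le[of "W - W'" W'] by (simp add: W'_def Un_absorb2 Un_commute)
  ultimately have W1: "card W \<le> m * \<beta> + card W'" by simp
  have W2: "real (card W') \<le> \<beta> * card (alive V t) + 2 * m * \<beta>"
  proof (cases "W' = {}")
    case False
    define j0 where "j0 = Min W'"
    have j0: "j0 \<in> W'" "\<And>j. j \<in> W' \<Longrightarrow> j0 \<le> j"
      unfolding j0_def using False finW by auto
    have j0': "j0 < n" "T1 \<le> r j0" "j0 \<in> fw t" "cl j0 = c" "r j0 \<le> t"
      using j0(1) by (auto simp: W'_def W_def fw_def)
    \<comment> \<open>A job of the same class that is older than \<open>j0\<close> is never started
      while \<open>j0\<close> waits. Hence these starts do not come after the release of
      \<open>j0\<close>, and \<open>T0 \<le> r j0\<close> follows.\<close>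
    define LS where "LS = {start a |a. a \<in> S \<and> T1 < start a \<and> start a \<le> t \<and> cl (job a) = c \<and> job a < j0}"
    have finLS: "finite LS" using finS by (auto simp: LS_def)
    define T0 where "T0 = Max (insert T1 LS)"
    have T0in: "T0 \<in> insert T1 LS" unfolding T0_def using finLS by (intro Max_in) auto
    have T0ge: "T1 \<le> T0" "\<And>x. x \<in> LS \<Longrightarrow> x \<le> T0" unfolding T0_def using finLS by auto
    have T0t: "T0 \<le> t" using T0in T1(1) by (auto simp: LS_def)
    have T0r: "T0 \<le> r j0"
    proof (rule ccontr)
      assume *: "\<not> T0 \<le> r j0"
      then obtain a where a: "a \<in> S" "T0 = start a" "start a \<le> t" "cl (job a) = c" "job a < j0"
        using T0in j0' by (auto simp: LS_def)
      then have "j0 \<in> fw (start a)" using j0' * by (force simp: fw_def)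
      from fw_prio[OF a(1) this] show False using a j0' by auto
    qed
    \<comment> \<open>Jobs of lower class left over at \<open>T0\<close>. For \<open>T0 = T1\<close>
      they belong to \<open>L\<close>; otherwise a job of class \<open>c\<close> is started at
      \<open>T0\<close>, so there are none.\<close>
    define L0 where "L0 = {j. j < n \<and> r j < T0 \<and> (\<forall>a\<in>S. job a = j \<longrightarrow> T0 < start a) \<and> cl j < c}"
    have cardL0: "card L0 \<le> m * \<beta>"
    proof (cases "T0 = T1")
      case True
      then have "L0 \<subseteq> L" by (auto simp: L0_def L_def)
      then show ?thesis using cardL card_mono[of L L0] by (force simp: L_def)
    next
      case False
      then obtain a where a: "a \<in> S" "T0 = start a" "cl (job a) = c" using T0in by (auto simp: LS_def)
      have "L0 = {}"
      proof (rule ccontr)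
        assume "L0 \<noteq> {}"
        then obtain j where j: "j \<in> L0" by blast
        then have "j \<in> fw (start a)" using a by (force simp: fw_def L0_def)
        from fw_prio[OF a(1) this] show False using a j by (auto simp: L0_def)
      qed
      then show ?thesis by simp
    qed
    define y where "y = real \<beta> powi c"
    have y: "0 < y" using b2 by (simp add: y_def)
    have x: "real \<beta> powi (c + 1) = \<beta> * y" using b2 by (simp add: y_def power_int_add)
    define G where "G = {a \<in> S. start a \<le> t \<and> T0 < stop a}"
    define lo where "lo a = max (start a) T0" for a :: run
    define hi where "hi a = min (stop a) t" for a :: run
    have finG: "finite G" using finS by (simp add: G_def)
    have Gfirst: "first a \<and> cl (job a) \<le> c" if "a \<in> G" for a
    proof -
      have "a \<in> act (lo a)" using that runD(4)[of a] by (auto simp: G_def act_def lo_def)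
      moreover have "good (lo a)" using that T0ge T0t by (intro T1(3)) (auto simp: lo_def G_def)
      ultimately show ?thesis by (auto simp: good_def)
    qed
    have "real m * (t - T0) \<le> (\<Sum>a\<in>G. hi a - lo a)"
    proof (rule has_bochner_integral_le)
      show "has_bochner_integral lborel (\<lambda>\<theta>. real m * iv T0 t \<theta>) (real m * (t - T0))"
        using T0t by (intro has_bochner_integral_mult_right iv_integral)
      have "lo a \<le> hi a" if "a \<in> G" for a
        using that runD(4)[of a] T0t by (auto simp: G_def lo_def hi_def)
      then show "has_bochner_integral lborel (\<lambda>\<theta>. \<Sum>a\<in>G. iv (lo a) (hi a) \<theta>) (\<Sum>a\<in>G. hi a - lo a)"
        using finG by (intro sum_iv_integral_1)
      fix \<theta>
      have "real m \<le> card {a \<in> G. lo a \<le> \<theta> \<and> \<theta> < hi a}" if "T0 \<le> \<theta>" "\<theta> < t"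
      proof -
        have "m \<le> card (act \<theta>)" using T1(3)[of \<theta>] that T0ge by (auto simp: good_def)
        moreover have "act \<theta> = {a \<in> G. lo a \<le> \<theta> \<and> \<theta> < hi a}"
          using that by (auto simp: act_def G_def lo_def hi_def)
        ultimately show ?thesis by simp
      qed
      then show "real m * iv T0 t \<theta> \<le> (\<Sum>a\<in>G. iv (lo a) (hi a) \<theta>)"
        by (subst sum_iv_eq_card[OF finG]) (auto simp: iv_def)
    qed
    also have "\<dots> = (\<Sum>a | a \<in> G \<and> start a \<le> T0. hi a - lo a) + (\<Sum>a | a \<in> G \<and> T0 < start a. hi a - lo a)"
      using finG by (subst sum.union_disjoint[symmetric]) (auto intro: sum.cong)
    \<comment> \<open>At most \<open>m\<close> runs are under way at \<open>T0\<close>, and their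
      classes limit each length to \<open>\<beta> * y\<close>.\<close>
    also have "(\<Sum>a | a \<in> G \<and> start a \<le> T0. hi a - lo a) \<le> (\<Sum>a | a \<in> G \<and> start a \<le> T0. \<beta> * y)"
    proof (rule sum_mono)
      fix a assume a: "a \<in> {a. a \<in> G \<and> start a \<le> T0}"
      have "hi a - lo a \<le> stop a - start a" by (simp add: hi_def lo_def)
      also have "\<dots> \<le> p (job a)" using a by (intro run_len) (auto simp: G_def)
      also have "\<dots> \<le> \<beta> * y" using p_le_class[of "job a" "c + 1"] Gfirst[of a] a runD(1)[of a]
        by (auto simp: x G_def)
      finally show "hi a - lo a \<le> \<beta> * y" .
    qed
    also have "\<dots> = \<beta> * y * card {a. a \<in> G \<and> start a \<le> T0}" by simp
    also have "\<dots> \<le> \<beta> * y * m"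
    proof -
      have "{a. a \<in> G \<and> start a \<le> T0} \<subseteq> act T0" by (auto simp: G_def act_def)
      then have "card {a. a \<in> G \<and> start a \<le> T0} \<le> m" using card_act_le[of T0] card_mono[of "act T0"]
        by (meson fin_act order_trans)
      then show ?thesis using y by (intro mult_left_mono) auto
    qed
    also have "(\<Sum>a | a \<in> G \<and> T0 < start a. hi a - lo a) \<le> (\<Sum>a | a \<in> G \<and> T0 < start a. p (job a))"
    proof (rule sum_mono)
      fix a assume a: "a \<in> {a. a \<in> G \<and> T0 < start a}"
      have "hi a - lo a \<le> stop a - start a" by (simp add: hi_def lo_def)
      also have "\<dots> \<le> p (job a)" using a by (intro run_len) (auto simp: G_def)
      finally show "hi a - lo a \<le> p (job a)" .
    qed
    also have "\<dots> = (\<Sum>j\<in>job ` {a. a \<in> G \<and> T0 < start a}. p j)"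
    proof -
      have "{a. a \<in> G \<and> T0 < start a} \<subseteq> {a \<in> S. first a}" using Gfirst by (auto simp: G_def)
      then have "inj_on job {a. a \<in> G \<and> T0 < start a}" by (rule inj_on_subset[OF first_job_inj])
      then show ?thesis by (simp add: sum.reindex)
    qed
    \<comment> \<open>A job started after \<open>T0\<close> but released before it cannot have class
      \<open>c\<close>: it would be older than \<open>j0\<close>, so its start would lie in
      \<open>LS\<close> beyond the maximum \<open>T0\<close>. It is therefore in
      \<open>L0\<close>.\<close>
    also have "\<dots> \<le> (\<Sum>j\<in>L0 \<union> ({j. j < n \<and> T0 \<le> r j \<and> r j \<le> t \<and> cl j \<le> c} - fw t). p j)"
    proof (rule sum_mono2)
      show "job ` {a. a \<in> G \<and> T0 < start a} \<subseteq> L0 \<union> ({j. j < n \<and> T0 \<le> r j \<and> r j \<le> t \<and> cl j \<le> c} - fw t)"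
      proof (rule image_subsetI)
        fix a assume "a \<in> {a. a \<in> G \<and> T0 < start a}"
        then have a: "a \<in> G" "T0 < start a" "a \<in> S" "start a \<le> t" by (auto simp: G_def)
        note f = Gfirst[OF a(1)] runD[OF a(3)]
        show "job a \<in> L0 \<union> ({j. j < n \<and> T0 \<le> r j \<and> r j \<le> t \<and> cl j \<le> c} - fw t)"
        proof (cases "T0 \<le> r (job a)")
          case True
          then show ?thesis using f a by (auto simp: fw_def)
        next
          case False
          have "cl (job a) \<noteq> c"
          proof
            assume *: "cl (job a) = c"
            have "job a < j0" using r_mono[of j0 "job a"] False T0r f by force
            then have "start a \<in> LS" using * a T0ge by (auto simp: LS_def)
            then show False using T0ge(2) a(2) by force
          qed
          then have "job a \<in> L0" using f a False by (force simp: L0_def first_def)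
          then show ?thesis by simp
        qed
      qed
    qed (auto simp: L0_def intro: less_imp_le p_pos)
    also have "\<dots> = (\<Sum>j\<in>L0. p j) + (\<Sum>j\<in>{j. j < n \<and> T0 \<le> r j \<and> r j \<le> t \<and> cl j \<le> c} - fw t. p j)"
      by (rule sum.union_disjoint) (auto simp: L0_def)
    also have "(\<Sum>j\<in>L0. p j) \<le> (\<Sum>j\<in>L0. y)"
      by (intro sum_mono) (auto simp: L0_def y_def intro: p_le_class)
    also have "\<dots> = y * card L0" by simp
    also have "\<dots> \<le> y * (m * \<beta>)" using y cardL0 by (intro mult_left_mono) (auto simp flip: of_nat_mult)
    finally have 1: "real m * (t - T0) \<le> \<beta> * y * m + (y * (m * \<beta>) +
      (\<Sum>j\<in>{j. j < n \<and> T0 \<le> r j \<and> r j \<le> t \<and> cl j \<le> c} - fw t. p j))" by simp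
    have 2: "(\<Sum>j\<in>{j. j < n \<and> T0 \<le> r j \<and> r j \<le> t \<and> cl j \<le> c}. p j) \<le> m * (t - T0) + \<beta> * y * card (alive V t)"
      unfolding p_def r_def alive_def
      using p_le_class[of _ "c + 1", unfolded x p_def] y
      by (subst (2) len[symmetric], intro preemptive_volume[OF pre T0t]) (auto simp: len)
    have "y * card W' = (\<Sum>j\<in>W'. y)" by simp
    also have "\<dots> \<le> (\<Sum>j\<in>W'. p j)"
      unfolding y_def by (intro sum_mono) (auto simp: W'_def W_def fw_def intro: cl_lower)
    also have "\<dots> \<le> (\<Sum>j\<in>{j. j < n \<and> T0 \<le> r j \<and> r j \<le> t \<and> cl j \<le> c} \<inter> fw t. p j)"
    proof (rule sum_mono2)
      show "W' \<subseteq> {j. j < n \<and> T0 \<le> r j \<and> r j \<le> t \<and> cl j \<le> c} \<inter> fw t"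
      proof
        fix j assume j: "j \<in> W'"
        then have "j \<in> fw t" "j < n" "cl j = c" "r j \<le> t" by (auto simp: W'_def W_def fw_def)
        moreover have "r j0 \<le> r j" using j0(2)[OF j] \<open>j < n\<close> by (rule r_mono)
        ultimately show "j \<in> {j. j < n \<and> T0 \<le> r j \<and> r j \<le> t \<and> cl j \<le> c} \<inter> fw t" using T0r by auto
      qed
    qed (auto intro: less_imp_le p_pos)
    also have "\<dots> = (\<Sum>j\<in>{j. j < n \<and> T0 \<le> r j \<and> r j \<le> t \<and> cl j \<le> c}. p j)
        - (\<Sum>j\<in>{j. j < n \<and> T0 \<le> r j \<and> r j \<le> t \<and> cl j \<le> c} - fw t. p j)"
      by (subst sum.Int_Diff[of _ _ "fw t"]) auto
    \<comment> \<open>The capacity \<open>m * (t - T0)\<close> cancels between \<open>1\<close> and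
      \<open>2\<close>. What remains is \<open>m * \<beta> * y\<close> for the runs active at
      \<open>T0\<close> and the same for \<open>L0\<close>.\<close>
    also have "\<dots> \<le> y * (\<beta> * card (alive V t) + 2 * m * \<beta>)"
      using 1 2 by (simp add: algebra_simps)
    finally show ?thesis using y by simp
  qed simp
  show ?thesis using W1 W2 unfolding W_def[symmetric] by (simp flip: of_nat_mult of_nat_add)
qed


text \<open>A job waiting behind runs that are all shorter by a factor \<open>\<beta>\<^sup>2\<close> is counted by the last summand;
  the runs are so short that this waiting time is at most the processing time of the waiting job.\<close>

lemma fw_bound:
  assumes pre: "preemptive_schedule m J V"
  shows "real (card (fw \<theta>)) \<le> (\<Sum>a | a \<in> act \<theta> \<and> first a. 20 * real \<beta> + card {j. j < n \<and> \<beta>\<^sup>2 * p (job a) \<le> p j} / m)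
    + 3 * real \<beta> * real (card (alive V \<theta>))"
proof (cases "fw \<theta> = {}")
  case True
  then show ?thesis by (simp add: sum_nonneg)
next
  case False
  note busy = fw_busy[OF False]
  define \<sigma> where "\<sigma> a = real (card {j. j < n \<and> \<beta>\<^sup>2 * p (job a) \<le> p j})" for a :: run
  define F where "F = {a \<in> act \<theta>. first a}"
  have finF: "finite F" by (simp add: F_def)
  have m_F: "real m \<le> 2 * card F" unfolding F_def by (rule card_first_act[OF busy])
  have mb: "real m * \<beta> \<le> 2 * \<beta> * card F" using mult_right_mono[OF m_F, of \<beta>] by (simp add: mult_ac)
  \<comment> \<open>A job that would have been preferred to \<open>a\<close> cannot have been
    waiting at the start of \<open>a\<close>. It arrived during \<open>a\<close>, where
    \<open>few\<close> applies.\<close>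
  have newcomers: "card A \<le> m * \<beta>" if a: "a \<in> act \<theta>" and A: "A \<subseteq> fw \<theta>"
    and low: "\<And>j. j \<in> A \<Longrightarrow> \<not> (first a \<and> cl (job a) \<le> cl j)" for a A
  proof -
    have aS: "a \<in> S" "start a \<le> \<theta>" "\<theta> < stop a" using a by (auto simp: act_def)
    have "A \<subseteq> {j. j < n \<and> start a < r j \<and> r j < stop a}"
    proof
      fix j assume j: "j \<in> A"
      then have jf: "j < n" "r j \<le> \<theta>" "\<And>b. b \<in> S \<Longrightarrow> job b = j \<Longrightarrow> \<theta> < start b" using A by (auto simp: fw_def)
      have "start a < r j"
      proof (rule ccontr)
        assume "\<not> start a < r j"
        then have "j \<in> fw (start a)" using jf aS(2) by (force simp: fw_def)
        from fw_prio[OF aS(1) this] show False using low[OF j] by auto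
      qed
      then show "j \<in> {j. j < n \<and> start a < r j \<and> r j < stop a}" using jf aS by auto
    qed
    then have "card A \<le> card {j. j < n \<and> start a < r j \<and> r j < stop a}" by (intro card_mono) auto
    then show ?thesis using few[OF aS(1)] by simp
  qed
  \<comment> \<open>Here \<open>10 = 1 + 3 * 3\<close>: one \<open>m * \<beta>\<close> for the
    classes below \<open>u\<close>, and three for each of the classes \<open>u\<close>,
    \<open>u + 1\<close> and \<open>u + 2\<close>. Each of these three also costs
    \<open>\<beta>\<close> times the jobs alive in the optimum.\<close>
  have "real (card (fw \<theta>)) \<le> 10 * (real m * \<beta>) + 3 * real \<beta> * real (card (alive V \<theta>)) + (\<Sum>a\<in>F. \<sigma> a / m)"
  proof (cases "\<exists>a\<in>act \<theta>. \<not> first a")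
    case True
    then have "card (fw \<theta>) \<le> m * \<beta>" using newcomers[of _ "fw \<theta>"] by auto
    then have "real (card (fw \<theta>)) \<le> real m * \<beta>" by (simp flip: of_nat_mult)
    moreover have "0 \<le> (\<Sum>a\<in>F. \<sigma> a / m)" by (simp add: \<sigma>_def sum_nonneg)
    moreover have "0 \<le> real m * \<beta>" "0 \<le> 3 * real \<beta> * real (card (alive V \<theta>))" by simp_all
    ultimately show ?thesis by linarith
  next
    case False
    then have F: "F = act \<theta>" by (auto simp: F_def)
    have ane: "act \<theta> \<noteq> {}" using busy m2 by auto
    define u where "u = Max (cl ` job ` act \<theta>)"
    have u: "\<And>a. a \<in> act \<theta> \<Longrightarrow> cl (job a) \<le> u" "u \<in> cl ` job ` act \<theta>"
      unfolding u_def using ane by (auto intro!: Max_in)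
    then obtain \<kappa> where \<kappa>: "\<kappa> \<in> act \<theta>" "cl (job \<kappa>) = u" by auto
    let ?C = "\<lambda>c. {j \<in> fw \<theta>. cl j = c}"
    let ?A = "{j \<in> fw \<theta>. cl j < u}" and ?D = "{j \<in> fw \<theta>. u + 3 \<le> cl j}"
    have "fw \<theta> \<subseteq> ?A \<union> (?C u \<union> (?C (u + 1) \<union> (?C (u + 2) \<union> ?D)))" by auto
    then have "card (fw \<theta>) \<le> card (?A \<union> (?C u \<union> (?C (u + 1) \<union> (?C (u + 2) \<union> ?D))))"
      by (intro card_mono) auto
    also have "\<dots> \<le> card ?A + (card (?C u) + (card (?C (u + 1)) + (card (?C (u + 2)) + card ?D)))"
      by (intro order_trans[OF card_Un_le] add_left_mono order_refl)
    finally have 0: "real (card (fw \<theta>)) \<le> card ?A + (card (?C u) + (card (?C (u + 1)) + (card (?C (u + 2)) + card ?D)))"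
      by linarith
    have C: "real (card (?C c)) \<le> \<beta> * card (alive V \<theta>) + 3 * (real m * \<beta>)" if "u \<le> c" for c
    proof -
      have "first a \<and> cl (job a) \<le> c" if "a \<in> act \<theta>" for a
        using False u(1)[OF that] that \<open>u \<le> c\<close> by auto
      from class_waiting[OF pre busy this] show ?thesis by simp
    qed
    have "card ?A \<le> m * \<beta>" using \<kappa> by (intro newcomers[of \<kappa>]) auto
    then have A: "real (card ?A) \<le> real m * \<beta>" by (simp flip: of_nat_mult)
    \<comment> \<open>Active jobs are shorter than \<open>\<beta>\<close> to the power
      \<open>u + 1\<close>, while jobs in \<open>?D\<close> have at least the power
      \<open>u + 3\<close>.\<close>
    have \<sigma>: "real (card ?D) \<le> \<sigma> a" if "a \<in> F" for a
      unfolding \<sigma>_def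
    proof (intro of_nat_mono card_mono)
      show "?D \<subseteq> {j. j < n \<and> \<beta>\<^sup>2 * p (job a) \<le> p j}"
      proof
        fix j assume j: "j \<in> ?D"
        then have jn: "j < n" using fw_lt by blast
        have ja: "job a < n" using that runD(1) by (auto simp: F_def act_def)
        have "\<beta>\<^sup>2 * p (job a) \<le> \<beta>\<^sup>2 * real \<beta> powi (u + 1)"
          using p_le_class[OF ja, of "u + 1"] u(1)[of a] that by (intro mult_left_mono) (auto simp: F)
        also have "\<dots> = real \<beta> powi (u + 3)" using b2
          by (simp add: power_int_add power2_eq_square numeral_3_eq_3 power3_eq_cube)
        also have "\<dots> \<le> real \<beta> powi cl j" using j by (intro beta_powi_mono) auto
        also have "\<dots> \<le> p j" using jn by (rule cl_lower)
        finally show "j \<in> {j. j < n \<and> \<beta>\<^sup>2 * p (job a) \<le> p j}" using jn by simp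
      qed
    qed auto
    have "real m * card ?D \<le> card F * real (card ?D)" using busy by (intro mult_right_mono) (auto simp: F)
    also have "\<dots> = (\<Sum>a\<in>F. real (card ?D))" by simp
    also have "\<dots> \<le> (\<Sum>a\<in>F. \<sigma> a)" using \<sigma> by (intro sum_mono) simp
    finally have "real (card ?D) \<le> (\<Sum>a\<in>F. \<sigma> a / m)"
      using m2 by (simp add: sum_divide_distrib[symmetric] field_simps)
    then show ?thesis using 0 A C[of u] C[of "u + 1"] C[of "u + 2"] by simp
  qed
  \<comment> \<open>The \<open>m\<close> shares of \<open>10 * \<beta>\<close> are carried by the
    first runs alone; as these occupy at least half of the machines, each share at most
    doubles.\<close>
  also have "10 * (real m * \<beta>) \<le> (\<Sum>a\<in>F. 20 * real \<beta>)" using mb by (simp add: mult_ac)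
  finally show ?thesis unfolding F_def[symmetric] \<sigma>_def[symmetric] by (simp add: sum.distrib)
qed

text \<open>If all machines are busy, the first runs pay for the at most \<open>m * \<beta>\<close>
  jobs. Otherwise \<open>m div 2\<close> restarts are active and share the cost; the factor 3 comes
  from \<open>m \<le> 3 * (m div 2)\<close> for \<open>m \<ge> 2\<close>. Their share refers to the
  jobs waiting at the start of the restart, not at \<open>\<theta>\<close>, so that it is constant
  during the run and can be integrated.\<close>

lemma rw_bound:
  "real (card (rw \<theta>)) \<le> (\<Sum>a | a \<in> act \<theta> \<and> first a. 2 * real \<beta>) +
     (\<Sum>a | a \<in> act \<theta> \<and> \<not> first a. 3 / m * (card (rw (start a)) + m))"
proof (cases "rw \<theta> = {}")
  case True
  then show ?thesis by (simp add: sum_nonneg)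
next
  case False
  show ?thesis
  proof (cases "m \<le> card (act \<theta>)")
    case True
    have "real (card (rw \<theta>)) \<le> real m * \<beta>" using card_rw[of \<theta>] by (simp flip: of_nat_mult)
    also have "\<dots> \<le> 2 * card {a \<in> act \<theta>. first a} * real \<beta>"
      using card_first_act[OF True] by (intro mult_right_mono) auto
    also have "\<dots> = (\<Sum>a | a \<in> act \<theta> \<and> first a. 2 * real \<beta>)" by simp
    also have "\<dots> \<le> (\<Sum>a | a \<in> act \<theta> \<and> first a. 2 * real \<beta>) +
     (\<Sum>a | a \<in> act \<theta> \<and> \<not> first a. 3 / m * (card (rw (start a)) + m))" by (simp add: sum_nonneg)
    finally show ?thesis by simp
  next
    case ff: False
    let ?G = "{a \<in> act \<theta>. \<not> first a}"
    have "m div 2 \<le> card ?G" using rw_busy[OF False] ff by simp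
    then have "m \<le> 3 * card ?G" using m2 by linarith
    then have "real m * card (rw \<theta>) \<le> real (3 * card ?G) * card (rw \<theta>)" by (intro mult_right_mono) (auto simp only: of_nat_le_iff)
    also have "\<dots> = (\<Sum>a\<in>?G. 3 * real (card (rw \<theta>)))" by simp
    also have "\<dots> \<le> (\<Sum>a\<in>?G. 3 * real (card (rw (start a)) + m))"
      using rw_le_start by (intro sum_mono mult_left_mono) (auto simp only: of_nat_le_iff)
    finally have "real (card (rw \<theta>)) \<le> (\<Sum>a\<in>?G. 3 / m * (card (rw (start a)) + m))"
      using m2 by (simp add: sum_divide_distrib[symmetric] field_simps sum_distrib_left[symmetric])
    also have "\<dots> \<le> (\<Sum>a | a \<in> act \<theta> \<and> first a. 2 * real \<beta>) + \<dots>" by (simp add: sum_nonneg)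
    finally show ?thesis by simp
  qed
qed

text \<open>An unfinished job that is neither fresh nor running was started before and has a later
  run, namely the one ending at its completion; so it waits for a restart.\<close>

lemma flow_pointwise:
  "(\<Sum>j<n. iv (r j) (Defs.completion S j) \<theta>) \<le> real (card (fw \<theta>)) + real (card (rw \<theta>)) + real (card (act \<theta>))"
proof -
  have "{j \<in> {..<n}. r j \<le> \<theta> \<and> \<theta> < Defs.completion S j} \<subseteq> (fw \<theta> \<union> rw \<theta>) \<union> job ` act \<theta>"
  proof
    fix j assume j: "j \<in> {j \<in> {..<n}. r j \<le> \<theta> \<and> \<theta> < Defs.completion S j}"
    have "{a \<in> S. job a = j} \<noteq> {}" using all_run[of j] j by auto
    then have "Defs.completion S j \<in> stop ` {a \<in> S. job a = j}"
      unfolding Defs.completion_def using finS by (intro Max_in) auto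
    then obtain b where b: "b \<in> S" "job b = j" "\<theta> < stop b" using j by auto
    show "j \<in> (fw \<theta> \<union> rw \<theta>) \<union> job ` act \<theta>"
    proof (cases "j \<in> fw \<theta> \<or> j \<in> job ` act \<theta>")
      case False
      have jn: "j < n" "r j \<le> \<theta>" using j by auto
      have "\<exists>a\<in>S. job a = j \<and> start a \<le> \<theta>" using False jn by (simp add: fw_def) (metis not_le)
      moreover have "\<exists>a\<in>S. job a = j \<and> \<theta> < start a"
      proof (rule bexI[of _ b], rule conjI)
        show "\<theta> < start b" using False b by (auto simp: act_def not_le[symmetric])
      qed (use b in auto)
      moreover have "\<forall>a\<in>act \<theta>. job a \<noteq> j" using False by blast
      ultimately have "j \<in> rw \<theta>" unfolding rw_def using jn by blast
      then show ?thesis by blast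
    qed auto
  qed
  then have "card {j \<in> {..<n}. r j \<le> \<theta> \<and> \<theta> < Defs.completion S j} \<le> card ((fw \<theta> \<union> rw \<theta>) \<union> job ` act \<theta>)"
    by (intro card_mono) auto
  also have "\<dots> \<le> card (fw \<theta> \<union> rw \<theta>) + card (job ` act \<theta>)" by (rule card_Un_le)
  also have "\<dots> \<le> (card (fw \<theta>) + card (rw \<theta>)) + card (act \<theta>)"
    by (intro add_mono card_Un_le card_image_le) simp
  finally show ?thesis by (simp add: sum_iv_eq_card flip: of_nat_add)
qed

section \<open>Integration of the weights over time\<close>

lemma sum_first_le: "(\<Sum>a | a \<in> S \<and> first a. p (job a)) \<le> (\<Sum>j<n. p j)"
proof -
  have "(\<Sum>a | a \<in> S \<and> first a. p (job a)) = (\<Sum>j\<in>job ` {a \<in> S. first a}. p j)"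
    by (simp add: sum.reindex[OF first_job_inj])
  also have "\<dots> \<le> (\<Sum>j<n. p j)"
    using runD(1) by (intro sum_mono2) (auto intro: less_imp_le p_pos)
  finally show ?thesis .
qed

text \<open>A single job is killed at most \<open>\<beta>\<close> times, its runs being disjoint in
  time, and it has no more restarts than kills.\<close>

lemma sum_nonfirst_le: "(\<Sum>a | a \<in> S \<and> \<not> first a. p (job a)) \<le> \<beta> * (\<Sum>j<n. p j)"
proof -
  have "(\<Sum>a | a \<in> S \<and> \<not> first a. p (job a)) = (\<Sum>j<n. \<Sum>a | a \<in> {a \<in> S. \<not> first a} \<and> job a = j. p (job a))"
    using runD(1) finS by (intro sum.group[symmetric]) auto
  also have "\<dots> = (\<Sum>j<n. card {a \<in> S. job a = j \<and> \<not> first a} * p j)"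
    by (intro sum.cong refl) (simp add: conj_ac)
  also have "\<dots> \<le> (\<Sum>j<n. \<beta> * p j)"
    using order_trans[OF card_nonfirst_job card_killed_job]
    by (intro sum_mono mult_right_mono) (auto intro: less_imp_le p_pos)
  finally show ?thesis by (simp add: sum_distrib_left)
qed

text \<open>The constant is \<open>30 + 3\<close>: the weights of the runs integrate to at most
  \<open>30 * \<beta>\<close> times the total processing time, and the pointwise comparison with the
  optimum contributes \<open>3 * \<beta>\<close>.\<close>

theorem flow_le:
  assumes pre: "preemptive_schedule m J V"
  shows "total_flow_time J S \<le> 33 * real \<beta> * total_flow_time J V"
proof -
  define P where "P = (\<Sum>j<n. p j)"
  have P0: "0 \<le> P" unfolding P_def by (intro sum_nonneg) (auto intro: less_imp_le p_pos)
  define \<sigma> where "\<sigma> a = real (card {j. j < n \<and> \<beta>\<^sup>2 * p (job a) \<le> p j})" for a :: run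
  \<comment> \<open>The weights add up the bounds for the three groups of unfinished jobs. A first
    run has 1 for its own job, \<open>20 * \<beta> + \<sigma> a / m\<close> from
    \<open>fw_bound\<close> and \<open>2 * \<beta>\<close> from \<open>rw_bound\<close>; a restart
    has 1 for its own job and \<open>3 / m * (card (rw (start a)) + m)\<close>.\<close>
  define w where "w a = (if first a then 1 + 22 * \<beta> + \<sigma> a / m else 4 + 3 / m * card (rw (start a)))" for a :: run
  have V: "p j \<le> Defs.completion V j - r j" if "j < n" for j
    unfolding p_def r_def using preemptive_flow_ge_proc[OF pre] that p_pos[OF that] len by (simp add: p_def)
  have PV: "P \<le> total_flow_time J V"
    unfolding P_def total_flow_time_def len using V by (intro sum_mono) (auto simp: r_def)
  have comp: "r j \<le> Defs.completion S j" if j: "j < n" for j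
  proof -
    obtain a where a: "a \<in> S" "job a = j" using all_run[OF j] by blast
    then have "stop a \<le> Defs.completion S j" unfolding Defs.completion_def using finS by (intro Max_ge) auto
    then show ?thesis using runD[OF a(1)] a(2) by auto
  qed
  have "(\<Sum>j<n. Defs.completion S j - r j) \<le>
     (\<Sum>a\<in>S. w a * (stop a - start a)) + 3 * real \<beta> * (\<Sum>j<n. Defs.completion V j - r j)"
  proof (rule has_bochner_integral_le)
    show "has_bochner_integral lborel (\<lambda>\<theta>. \<Sum>j<n. iv (r j) (Defs.completion S j) \<theta>) (\<Sum>j<n. Defs.completion S j - r j)"
      using comp by (intro sum_iv_integral_1) auto
    have "r j \<le> Defs.completion V j" if "j < n" for j using V[OF that] p_pos[OF that] by linarith
    then show "has_bochner_integral lborel (\<lambda>\<theta>. (\<Sum>a\<in>S. w a * iv (start a) (stop a) \<theta>) +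
        3 * real \<beta> * (\<Sum>j<n. iv (r j) (Defs.completion V j) \<theta>))
      ((\<Sum>a\<in>S. w a * (stop a - start a)) + 3 * real \<beta> * (\<Sum>j<n. Defs.completion V j - r j))"
      using finS runD(4)
      by (intro has_bochner_integral_add has_bochner_integral_mult_right sum_iv_integral sum_iv_integral_1)
        (auto intro: less_imp_le)
    fix \<theta>
    have alv: "(\<Sum>j<n. iv (r j) (Defs.completion V j) \<theta>) = card (alive V \<theta>)"
      by (simp add: sum_iv_eq_card alive_def)
    have "(\<Sum>a\<in>S. w a * iv (start a) (stop a) \<theta>) = (\<Sum>a\<in>act \<theta>. w a)"
      using finS by (simp add: iv_def of_bool_def act_def Int_def if_distrib sum.If_cases cong: if_cong)
    also have "\<dots> = (\<Sum>a | a \<in> act \<theta> \<and> first a. w a) + (\<Sum>a | a \<in> act \<theta> \<and> \<not> first a. w a)"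
      by (subst sum.union_disjoint[symmetric]) (auto intro: sum.cong)
    also have "(\<Sum>a | a \<in> act \<theta> \<and> first a. w a) =
       (\<Sum>a | a \<in> act \<theta> \<and> first a. 1 :: real) + ((\<Sum>a | a \<in> act \<theta> \<and> first a. 20 * real \<beta> + \<sigma> a / m) +
       (\<Sum>a | a \<in> act \<theta> \<and> first a. 2 * real \<beta>))"
      by (simp only: sum.distrib[symmetric]) (intro sum.cong, auto simp: w_def)
    also have "(\<Sum>a | a \<in> act \<theta> \<and> \<not> first a. w a) =
       (\<Sum>a | a \<in> act \<theta> \<and> \<not> first a. 1 :: real) + (\<Sum>a | a \<in> act \<theta> \<and> \<not> first a. 3 / m * (card (rw (start a)) + m))"
      using m2 by (simp only: sum.distrib[symmetric]) (intro sum.cong, auto simp: w_def field_simps)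
    finally have ws: "(\<Sum>a\<in>S. w a * iv (start a) (stop a) \<theta>) = real (card {a \<in> act \<theta>. first a}) + real (card {a \<in> act \<theta>. \<not> first a})
       + (\<Sum>a | a \<in> act \<theta> \<and> first a. 20 * real \<beta> + \<sigma> a / m) +
       ((\<Sum>a | a \<in> act \<theta> \<and> first a. 2 * real \<beta>) + (\<Sum>a | a \<in> act \<theta> \<and> \<not> first a. 3 / m * (card (rw (start a)) + m)))"
      by simp
    have "card (act \<theta>) = card {a \<in> act \<theta>. first a} + card {a \<in> act \<theta>. \<not> first a}"
      by (subst card_Un_disjoint[symmetric]) (auto intro: arg_cong[of _ _ card])
    then have "real (card (act \<theta>)) = real (card {a \<in> act \<theta>. first a}) + real (card {a \<in> act \<theta>. \<not> first a})"
      by linarith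
    then show "(\<Sum>j<n. iv (r j) (Defs.completion S j) \<theta>) \<le> (\<Sum>a\<in>S. w a * iv (start a) (stop a) \<theta>) +
        3 * real \<beta> * (\<Sum>j<n. iv (r j) (Defs.completion V j) \<theta>)"
      using flow_pointwise[of \<theta>] fw_bound[OF pre, of \<theta>] rw_bound[of \<theta>]
      unfolding ws alv \<sigma>_def by linarith
  qed
  moreover have "(\<Sum>a\<in>S. w a * (stop a - start a)) \<le> 30 * real \<beta> * P"
  proof -
    have len_p: "stop a - start a \<le> p (job a)" "0 \<le> p (job a)" if "a \<in> S" for a
      using run_len[OF that] runD[OF that] p_pos[of "job a"] by auto
    have "(\<Sum>a\<in>S. w a * (stop a - start a)) \<le> (\<Sum>a\<in>S. w a * p (job a))"
      using len_p by (intro sum_mono mult_left_mono) (auto simp: w_def \<sigma>_def)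
    also have "\<dots> = (\<Sum>a | a \<in> S \<and> first a. w a * p (job a)) + (\<Sum>a | a \<in> S \<and> \<not> first a. w a * p (job a))"
      using finS by (subst sum.union_disjoint[symmetric]) (auto intro: sum.cong)
    also have "(\<Sum>a | a \<in> S \<and> first a. w a * p (job a)) \<le> (\<Sum>a | a \<in> S \<and> first a. (1 + 22 * \<beta>) * p (job a)) + P"
    proof -
      have "(\<Sum>a | a \<in> S \<and> first a. \<sigma> a * p (job a)) \<le> real m * P"
      proof -
        \<comment> \<open>The jobs counted by \<open>\<sigma> a\<close> are each at least
          \<open>\<beta>\<^sup>2 * p (job a)\<close> long. With at most
          \<open>n \<le> m * \<beta>\<^sup>2\<close> first runs, the sum is at most
          \<open>m * P\<close>, and the weight divides it by \<open>m\<close>.\<close>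
        have "\<sigma> a * p (job a) \<le> P / \<beta>\<^sup>2" if a: "a \<in> S" for a
        proof -
          have "\<sigma> a * (\<beta>\<^sup>2 * p (job a)) = (\<Sum>j | j < n \<and> \<beta>\<^sup>2 * p (job a) \<le> p j. \<beta>\<^sup>2 * p (job a))"
            by (simp add: \<sigma>_def)
          also have "\<dots> \<le> (\<Sum>j | j < n \<and> \<beta>\<^sup>2 * p (job a) \<le> p j. p j)" by (intro sum_mono) auto
          also have "\<dots> \<le> P" unfolding P_def by (intro sum_mono2) (auto intro: less_imp_le p_pos)
          finally show ?thesis using b2 by (simp add: field_simps)
        qed
        then have "(\<Sum>a | a \<in> S \<and> first a. \<sigma> a * p (job a)) \<le> (\<Sum>a | a \<in> S \<and> first a. P / \<beta>\<^sup>2)"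
          by (intro sum_mono) auto
        also have "\<dots> = card {a \<in> S. first a} * (P / \<beta>\<^sup>2)" by simp
        also have "\<dots> \<le> (real m * \<beta>\<^sup>2) * (P / \<beta>\<^sup>2)"
        proof (rule mult_right_mono)
          have "card {a \<in> S. first a} \<le> card {..<n}"
            using runD(1) by (intro card_inj_on_le[OF first_job_inj]) auto
          then have "card {a \<in> S. first a} \<le> m * \<beta>\<^sup>2" using nb by simp
          then show "real (card {a \<in> S. first a}) \<le> real m * \<beta>\<^sup>2"
            by (simp flip: of_nat_mult of_nat_power)
        qed (use P0 in simp)
        also have "\<dots> = real m * P" using b2 by simp
        finally show ?thesis .
      qed
      then have "(\<Sum>a | a \<in> S \<and> first a. \<sigma> a / m * p (job a)) \<le> P"
        using m2 by (simp add: sum_divide_distrib[symmetric] field_simps)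
      moreover have "(\<Sum>a | a \<in> S \<and> first a. w a * p (job a)) = (\<Sum>a | a \<in> S \<and> first a. (1 + 22 * \<beta>) * p (job a)) +
          (\<Sum>a | a \<in> S \<and> first a. \<sigma> a / m * p (job a))"
        by (simp only: sum.distrib[symmetric]) (intro sum.cong, auto simp: w_def algebra_simps)
      ultimately show ?thesis by linarith
    qed
    also have "(\<Sum>a | a \<in> S \<and> first a. (1 + 22 * \<beta>) * p (job a)) \<le> (1 + 22 * \<beta>) * P"
      using sum_first_le by (simp only: sum_distrib_left[symmetric] P_def) (intro mult_left_mono, auto)
    also have "(\<Sum>a | a \<in> S \<and> \<not> first a. w a * p (job a)) \<le> 4 * (\<beta> * P) + 3 * real \<beta> * P"
    proof -
      \<comment> \<open>Restarts are made shortest first, so the waiting jobs are at least as long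
        as the restarted one. With at most \<open>m * \<beta>\<close> restarts, the division by
        \<open>m\<close> leaves \<open>3 * \<beta> * P\<close>.\<close>
      have "card (rw (start a)) * p (job a) \<le> P" if a: "a \<in> S" "\<not> first a" for a
      proof -
        have "card (rw (start a)) * p (job a) = (\<Sum>j\<in>rw (start a). p (job a))" by simp
        also have "\<dots> \<le> (\<Sum>j\<in>rw (start a). p j)" using rw_prio[OF a] by (intro sum_mono) auto
        also have "\<dots> \<le> P" unfolding P_def by (intro sum_mono2) (auto intro: less_imp_le p_pos rw_lt)
        finally show ?thesis .
      qed
      then have "(\<Sum>a | a \<in> S \<and> \<not> first a. card (rw (start a)) * p (job a)) \<le> (\<Sum>a | a \<in> S \<and> \<not> first a. P)"
        by (intro sum_mono) auto
      also have "\<dots> = card {a \<in> S. \<not> first a} * P" by simp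
      also have "\<dots> \<le> (real m * \<beta>) * P"
        using card_nonfirst P0 by (intro mult_right_mono) (auto simp flip: of_nat_mult)
      finally have "(\<Sum>a | a \<in> S \<and> \<not> first a. 3 / m * card (rw (start a)) * p (job a)) \<le> 3 * real \<beta> * P"
        using m2 by (simp add: sum_divide_distrib[symmetric] sum_distrib_left[symmetric] field_simps)
      moreover have "(\<Sum>a | a \<in> S \<and> \<not> first a. 4 * p (job a)) \<le> 4 * (\<beta> * P)"
        using sum_nonfirst_le by (simp add: sum_distrib_left[symmetric] P_def)
      moreover have "(\<Sum>a | a \<in> S \<and> \<not> first a. w a * p (job a)) = (\<Sum>a | a \<in> S \<and> \<not> first a. 4 * p (job a)) +
        (\<Sum>a | a \<in> S \<and> \<not> first a. 3 / m * card (rw (start a)) * p (job a))"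
        by (simp only: sum.distrib[symmetric]) (intro sum.cong, auto simp: w_def algebra_simps)
      ultimately show ?thesis by linarith
    qed
    \<comment> \<open>The coefficient is
      \<open>(1 + 22 * \<beta>) + 1 + 4 * \<beta> + 3 * \<beta>\<close>; the constant 2 is absorbed
      by \<open>2 \<le> \<beta>\<close>.\<close>
    finally have "(\<Sum>a\<in>S. w a * (stop a - start a)) \<le> 2 * P + 29 * (\<beta> * P)" by (simp add: algebra_simps)
    also have "\<dots> \<le> \<beta> * P + 29 * (\<beta> * P)" using b2 P0 by (intro add_right_mono mult_right_mono) auto
    finally show ?thesis by (simp add: mult_ac)
  qed
  moreover have "30 * real \<beta> * P \<le> 30 * real \<beta> * total_flow_time J V" using PV by (intro mult_left_mono) auto
  ultimately show ?thesis unfolding total_flow_time_def len r_def by (simp add: algebra_simps)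
qed

end

section \<open>The online algorithm\<close>

locale finished_run = jobs J B h M for J :: "real jrec list" and B h M +
  fixes N :: nat
  assumes N: "2 * length J \<le> N" and M_pos: "J \<noteq> [] \<Longrightarrow> 0 < M" and h_pos: "0 < h"
begin

definition final :: "real state" where
  "final = loop B h N init"

definition S :: schedule where
  "S = orun_run ` set (outs final)"

lemma final_idle: "pend final = []" "running final = []"
  and final_inv: "\<exists>T. state_inv T final"
  using loop_final[OF init_inv, of N] N unfolding final_def meas_init by (auto simp: idle_def)

lemma S_all_runs: "S = all_runs final"
  by (simp add: S_def all_runs_def final_idle)

text \<open>A job still queued in the idle final state would require that no machine is free or that
  \<open>h\<close> restarts are running. No run is open, and \<open>M\<close> and \<open>h\<close>
  are positive.\<close>

lemma final_sim:
  obtains T where "sim_inv J B h M T (length J) [] [] [] (free final) (outs final)"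
proof -
  obtain T where T: "state_inv T final" using final_inv by blast
  then interpret sim_inv J B h M T "relno final" "fq final" "rq final" "running final" "free final" "outs final"
    by (simp add: state_inv_def)
  have k: "relno final = length J" using T k_le by (simp add: state_inv_def final_idle)
  have "fq final = []" "rq final = []"
  proof -
    have "False" if "q \<in> set (fq final) \<or> q \<in> set (rq final)" for q
    proof -
      have "free final = []" using that T h_pos by (cases "fq final"; cases "rq final") (auto simp: state_inv_def final_idle)
      then have "{..<M} = {}" using mach_set by (simp add: final_idle)
      then have "M = 0" by (simp add: lessThan_empty_iff)
      moreover have "J \<noteq> []" using that jobQ[of q] jobZ[of q] k by auto
      ultimately show False using M_pos by simp
    qed
    then show "fq final = []" "rq final = []" by (metis list.set_intros(1) neq_Nil_conv)+
  qed
  then show ?thesis using that[of T] sim_inv_axioms by (simp add: k final_idle)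
qed

lemma S_run:
  assumes "a \<in> S"
  shows "job a < length J" "machine a < M" "rl (job a) \<le> start a" "start a < stop a" "stop a - start a \<le> pj (job a)"
    "card {j. j < length J \<and> start a < rl j \<and> rl j < stop a} < B"
    "stop a - start a < pj (job a) \<Longrightarrow> B \<le> card {j. j < length J \<and> start a < rl j \<and> rl j \<le> stop a}"
proof -
  from final_sim obtain T where "sim_inv J B h M T (length J) [] [] [] (free final) (outs final)" .
  then interpret sim_inv J B h M T "length J" "[]" "[]" "[]" "free final" "outs final" .
  obtain o' where o': "o' \<in> set (outs final)" "a = orun_run o'" using assms by (auto simp: S_def)
  show "job a < length J" "machine a < M" "rl (job a) \<le> start a" "start a < stop a" "stop a - start a \<le> pj (job a)"
    "card {j. j < length J \<and> start a < rl j \<and> rl j < stop a} < B"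
    "stop a - start a < pj (job a) \<Longrightarrow> B \<le> card {j. j < length J \<and> start a < rl j \<and> rl j \<le> stop a}"
    using outD[OF o'(1)] few[OF o'(1)] many[OF o'(1)] o'(2) by auto
qed

lemma S_disjoint:
  assumes "a \<in> S" "b \<in> S" "a \<noteq> b" "machine a = machine b \<or> job a = job b"
  shows "disjoint_time a b"
proof -
  from final_sim obtain T where "sim_inv J B h M T (length J) [] [] [] (free final) (outs final)" .
  then interpret sim_inv J B h M T "length J" "[]" "[]" "[]" "free final" "outs final" .
  show ?thesis using assms out_out by (fastforce simp: S_def disjoint_time_def)
qed

lemma S_last:
  assumes "a \<in> S" "b \<in> S" "stop a - start a = pj (job a)" "job b = job a" "b \<noteq> a"
  shows "stop b - start b < pj (job b) \<and> stop b \<le> start a"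
proof -
  from final_sim obtain T where "sim_inv J B h M T (length J) [] [] [] (free final) (outs final)" .
  then interpret sim_inv J B h M T "length J" "[]" "[]" "[]" "free final" "outs final" .
  obtain u v where uv: "u \<in> set (outs final)" "v \<in> set (outs final)" "a = orun_run u" "b = orun_run v"
    using assms by (auto simp: S_def)
  then have "v \<noteq> u" using assms by auto
  then show ?thesis using done_last[of u v] uv assms by simp
qed

lemma S_completes:
  assumes "j < length J"
  shows "\<exists>a\<in>S. job a = j \<and> stop a - start a = pj j"
proof -
  from final_sim obtain T where "sim_inv J B h M T (length J) [] [] [] (free final) (outs final)" .
  then interpret sim_inv J B h M T "length J" "[]" "[]" "[]" "free final" "outs final" .
  show ?thesis using somewhere[OF assms] by (auto simp: S_def)
qed

lemma S_key_inj:
  assumes "a \<in> S" "b \<in> S" "run_key a = run_key b"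
  shows "a = b"
  using S_disjoint[OF assms(1,2)] S_run(4)[OF assms(1)] S_run(4)[OF assms(2)] assms(3)
  by (fastforce simp: run_key_def disjoint_time_def)

text \<open>The snapshot in terms of the finished schedule. A run active at \<open>\<theta>\<close>
  is matched with a running entry by its key only, because its end, possibly a kill, is not
  determined yet.\<close>

lemma S_snapshot:
  assumes "- 1 \<le> \<theta>"
  obtains T \<sigma> where "T \<le> \<theta>" "state_inv T \<sigma>" "\<And>j. j < length J \<Longrightarrow> rl j \<le> \<theta> \<longleftrightarrow> j < relno \<sigma>"
    "\<And>u. u \<in> set (outs \<sigma>) \<Longrightarrow> orun_run u \<in> S \<and> ostop u \<le> \<theta>"
    "\<And>x. x \<in> set (running \<sigma>) \<Longrightarrow> \<exists>a\<in>S. run_key a = xkey x \<and> start a \<le> \<theta> \<and> \<theta> < stop a"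
    "\<And>a. a \<in> S \<Longrightarrow> start a \<le> \<theta> \<Longrightarrow> stop a \<le> \<theta> \<and> a \<in> orun_run ` set (outs \<sigma>) \<or>
       \<theta> < stop a \<and> run_key a \<in> xkey ` set (running \<sigma>)"
proof -
  obtain T \<sigma> where sn: "state_inv T \<sigma>" "T \<le> \<theta>" "same_until \<theta> (all_runs \<sigma>) S"
    "\<And>j. j < length J \<Longrightarrow> rl j \<le> \<theta> \<longleftrightarrow> j < relno \<sigma>" "\<And>x. x \<in> set (running \<sigma>) \<Longrightarrow> \<theta> < eend x"
    using snapshot[OF init_inv assms, of N] N unfolding S_all_runs final_def meas_init by blast
  interpret sim_inv J B h M T "relno \<sigma>" "fq \<sigma>" "rq \<sigma>" "running \<sigma>" "free \<sigma>" "outs \<sigma>"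
    using sn(1) by (simp add: state_inv_def)
  have D: "{a \<in> S. stop a \<le> \<theta>} = orun_run ` set (outs \<sigma>)"
  proof -
    have "{a \<in> S. stop a \<le> \<theta>} = {a \<in> all_runs \<sigma>. stop a \<le> \<theta>}" using sn(3) by (simp add: same_until_key)
    also have "\<dots> = orun_run ` set (outs \<sigma>)"
      using sn(5) outD sn(2) by (fastforce simp: all_runs_def)
    finally show ?thesis .
  qed
  have K: "run_key ` {a \<in> S. start a \<le> \<theta>} = okey ` set (outs \<sigma>) \<union> xkey ` set (running \<sigma>)"
  proof -
    have "{a \<in> all_runs \<sigma>. start a \<le> \<theta>} = all_runs \<sigma>"
      using outD ent sn(2) by (fastforce simp: all_runs_def)
    moreover have "run_key ` {a \<in> S. start a \<le> \<theta>} = run_key ` {a \<in> all_runs \<sigma>. start a \<le> \<theta>}"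
      using sn(3) by (simp add: same_until_key)
    ultimately show ?thesis by (simp add: all_runs_def image_Un image_image)
  qed
  have disj: "okey u \<noteq> xkey x" if "u \<in> set (outs \<sigma>)" "x \<in> set (running \<sigma>)" for u x
    using out_X[OF that] outD[OF that(1)] by (auto simp: okey_def xkey_def)
  show ?thesis
  proof (rule that[OF sn(2,1,4)])
    fix u assume u: "u \<in> set (outs \<sigma>)"
    then have "orun_run u \<in> {a \<in> S. stop a \<le> \<theta>}" unfolding D by blast
    then show "orun_run u \<in> S \<and> ostop u \<le> \<theta>" by simp
  next
    fix x assume x: "x \<in> set (running \<sigma>)"
    then have "xkey x \<in> run_key ` {a \<in> S. start a \<le> \<theta>}" unfolding K by blast
    then obtain a where a: "a \<in> S" "start a \<le> \<theta>" "run_key a = xkey x" by auto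
    have "\<theta> < stop a"
    proof (rule ccontr)
      assume "\<not> \<theta> < stop a"
      then have "a \<in> orun_run ` set (outs \<sigma>)" using a D by auto
      then show False using disj a(3) x by auto
    qed
    then show "\<exists>a\<in>S. run_key a = xkey x \<and> start a \<le> \<theta> \<and> \<theta> < stop a" using a by blast
  next
    fix a assume a: "a \<in> S" "start a \<le> \<theta>"
    show "stop a \<le> \<theta> \<and> a \<in> orun_run ` set (outs \<sigma>) \<or> \<theta> < stop a \<and> run_key a \<in> xkey ` set (running \<sigma>)"
    proof (cases "stop a \<le> \<theta>")
      case True
      then show ?thesis using a D by blast
    next
      case False
      have "run_key a \<notin> okey ` set (outs \<sigma>)"
      proof
        assume "run_key a \<in> okey ` set (outs \<sigma>)"
        then obtain u where u: "u \<in> set (outs \<sigma>)" "run_key a = run_key (orun_run u)" by auto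
        then have "orun_run u \<in> {a \<in> S. stop a \<le> \<theta>}" unfolding D by blast
        then show False using S_key_inj[of a "orun_run u"] a u False by auto
      qed
      moreover have "run_key a \<in> okey ` set (outs \<sigma>) \<union> xkey ` set (running \<sigma>)" using a K by blast
      ultimately show ?thesis using False by auto
    qed
  qed
qed

end

section \<open>Parameters and properties of the algorithm\<close>

definition cls :: "nat \<Rightarrow> real \<Rightarrow> int" where
  "cls \<beta> x = \<lfloor>log \<beta> x\<rfloor>"

definition jrecs :: "nat \<Rightarrow> real job list \<Rightarrow> real jrec list" where
  "jrecs \<beta> J = map (\<lambda>i. JR i (release (J ! i)) (proc (J ! i)) (cls \<beta> (proc (J ! i)))) [0..<length J]"

text \<open>The alternative \<open>n < b\<close> matters only for \<open>m = 0\<close>.\<close>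

definition base :: "nat \<Rightarrow> nat \<Rightarrow> nat" where
  "base n m = (LEAST b. 2 \<le> b \<and> (n < b \<or> n \<le> m * b\<^sup>2))"

definition alg :: "nat \<Rightarrow> nat \<Rightarrow> real job list \<Rightarrow> schedule" where
  "alg n m J = orun_run ` set (outs (loop (m * base n m) (m div 2) (2 * n)
     (St (jrecs (base n m) J) 0 [] [] [] (rev [0..<min n m]) [])))"

lemma base_spec: "2 \<le> base n m" "n < base n m \<or> n \<le> m * (base n m)\<^sup>2"
proof -
  have "2 \<le> n + 2 \<and> (n < n + 2 \<or> n \<le> m * (n + 2)\<^sup>2)" by simp
  from LeastI[of "\<lambda>b. 2 \<le> b \<and> (n < b \<or> n \<le> m * b\<^sup>2)", OF this]
  show "2 \<le> base n m" "n < base n m \<or> n \<le> m * (base n m)\<^sup>2" by (simp_all add: base_def)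
qed

lemma base_cover:
  assumes "0 < m"
  shows "n \<le> m * (base n m)\<^sup>2"
proof -
  have "base n m \<le> m * (base n m)\<^sup>2" using assms by (simp add: power2_eq_square)
  then show ?thesis using base_spec(2)[of n m] by linarith
qed

text \<open>If \<open>b + 1\<close> is least and \<open>b \<ge> 2\<close>, then \<open>b\<close>
  violates the condition, so \<open>m * b\<^sup>2 < n\<close>. Passing from \<open>b\<close> to
  \<open>b + 1\<close> costs less than a factor 2.\<close>

lemma base_le:
  assumes "0 < m"
  shows "real (base n m) \<le> 2 * max 1 (sqrt (real n / real m))"
proof (cases "base n m = 2")
  case False
  define b where "b = base n m - 1"
  have b: "2 \<le> b" "base n m = Suc b" using base_spec(1)[of n m] False by (auto simp: b_def)
  have "\<not> (2 \<le> b \<and> (n < b \<or> n \<le> m * b\<^sup>2))"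
    using not_less_Least[of b "\<lambda>b. 2 \<le> b \<and> (n < b \<or> n \<le> m * b\<^sup>2)"] b by (simp add: base_def)
  then have "m * b\<^sup>2 < n" using b by auto
  then have "real m * (real b)\<^sup>2 < real n" by (metis of_nat_less_iff of_nat_mult of_nat_power)
  then have "(real b)\<^sup>2 < real n / real m" using assms by (simp add: field_simps)
  then have "real b \<le> sqrt (real n / real m)" by (intro real_le_rsqrt) simp
  moreover have "1 \<le> real b" using b by simp
  ultimately show ?thesis using b(2) by (simp add: max_def del: real_sqrt_ge_1_iff)
qed simp

lemma length_jrecs [simp]: "length (jrecs \<beta> J) = length J"
  by (simp add: jrecs_def)

lemma jrecs_Nil_iff [simp]: "jrecs \<beta> J = [] \<longleftrightarrow> J = []"
  by (simp add: jrecs_def)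

lemma nth_jrecs [simp]:
  "j < length J \<Longrightarrow> jrecs \<beta> J ! j = JR j (release (J ! j)) (proc (J ! j)) (cls \<beta> (proc (J ! j)))"
  by (simp add: jrecs_def)

lemma instD:
  assumes "is_instance J" "j < length J"
  shows "0 \<le> release (J ! j)" "0 < proc (J ! j)"
  using assms nth_mem[of j J] unfolding is_instance_def by blast+

lemma jobs_jrecs:
  assumes "is_instance J" "0 < B"
  shows "jobs (jrecs \<beta> J) B"
proof
  have "map jrel (jrecs \<beta> J) = map release J" by (intro nth_equalityI) auto
  then show "sorted (map jrel (jrecs \<beta> J))" using assms by (simp add: is_instance_def)
qed (use assms instD in auto)

lemma finished_jrecs:
  assumes "is_instance J" "length J \<le> n" "2 \<le> m"
  shows "finished_run (jrecs \<beta> J) (m * base n m) (m div 2) (min n m) (2 * n)"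
proof -
  have "0 < m * base n m" using base_spec(1)[of n m] assms by simp
  have "0 < min n m" if "J \<noteq> []" using that assms by (cases J) auto
  then show ?thesis using jobs_jrecs[OF assms(1) \<open>0 < m * base n m\<close>, of \<beta>] assms
    by (intro finished_run.intro finished_run_axioms.intro) auto
qed

lemma alg_eq:
  assumes "is_instance J" "length J \<le> n" "2 \<le> m"
  shows "alg n m J = finished_run.S (jrecs (base n m) J) (m * base n m) (m div 2) (min n m) (2 * n)"
proof -
  interpret finished_run "jrecs (base n m) J" "m * base n m" "m div 2" "min n m" "2 * n"
    by (rule finished_jrecs[OF assms])
  show ?thesis by (simp add: alg_def S_def final_def init_def)
qed

lemma alg_kill_restart:
  assumes "is_instance J" "length J \<le> n" "2 \<le> m"
  shows "kill_restart_schedule m J (alg n m J)"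
proof -
  interpret finished_run "jrecs (base n m) J" "m * base n m" "m div 2" "min n m" "2 * n"
    by (rule finished_jrecs[OF assms])
  have eq: "alg n m J = S" by (rule alg_eq[OF assms])
  show ?thesis
    unfolding kill_restart_schedule_def valid_runs_def eq
  proof (intro conjI ballI allI impI)
    show "finite S" by (simp add: S_def)
  next
    fix a b assume "a \<in> S" "b \<in> S" "a \<noteq> b \<and> (machine a = machine b \<or> job a = job b)"
    then show "disjoint_time a b" using S_disjoint by blast
  next
    fix j assume j: "j < length J"
    then obtain a where a: "a \<in> S" "job a = j" "stop a - start a = proc (J ! j)"
      using S_completes[of j] by auto
    then show "\<exists>a\<in>S. job a = j \<and> stop a - start a = proc (J ! j) \<and>
        (\<forall>b\<in>S. job b = j \<and> b \<noteq> a \<longrightarrow> stop b - start b < proc (J ! j) \<and> stop b \<le> start a)"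
      using j S_last[of a] by (intro bexI[of _ a]) auto
  qed (use S_run in force)+
qed

text \<open>Statements about a time \<open>\<theta>\<close> are read off the snapshot at
  \<open>\<theta>\<close>, and the priority of a run \<open>a\<close> off the snapshot at
  \<open>start a\<close>.\<close>

lemma alg_analysis:
  assumes inst: "is_instance J" and len: "length J = n" and m2: "2 \<le> m"
  shows "restart_analysis m n (base n m) J (alg n m J) (\<lambda>j. cls (base n m) (proc (J ! j)))"
proof -
  let ?\<beta> = "base n m" and ?cl = "\<lambda>j. cls (base n m) (proc (J ! j))"
  have le: "length J \<le> n" using len by simp
  interpret finished_run "jrecs ?\<beta> J" "m * ?\<beta>" "m div 2" "min n m" "2 * n"
    by (rule finished_jrecs[OF inst le m2])
  have eq: "alg n m J = S" by (rule alg_eq[OF inst le m2])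
  interpret F: flow_setting m n ?\<beta> J S ?cl .
  note [simp] = len
  have r: "rl j = F.r j" "pj j = F.p j" if "j < n" for j using that by (simp_all add: F.r_def F.p_def)
  have b2: "2 \<le> ?\<beta>" by (rule base_spec)
  have start0: "0 \<le> start a" if "a \<in> S" for a
    using S_run(1,3)[OF that] rel_nonneg[of "job a"] by force
  have runr: "F.r (job a) \<le> start a" "stop a - start a \<le> F.p (job a)"
    "card {j. j < n \<and> start a < F.r j \<and> F.r j < stop a} < m * ?\<beta>"
    "stop a - start a < F.p (job a) \<Longrightarrow> m * ?\<beta> \<le> card {j. j < n \<and> start a < F.r j \<and> F.r j \<le> stop a}" if "a \<in> S" for a
  proof -
    have e: "{j. j < n \<and> start a < F.r j \<and> F.r j < stop a} = {j. j < length (jrecs ?\<beta> J) \<and> start a < rl j \<and> rl j < stop a}"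
      "{j. j < n \<and> start a < F.r j \<and> F.r j \<le> stop a} = {j. j < length (jrecs ?\<beta> J) \<and> start a < rl j \<and> rl j \<le> stop a}"
      using r by auto
    have jn: "job a < n" using S_run(1)[OF that] by simp
    show "F.r (job a) \<le> start a" "stop a - start a \<le> F.p (job a)"
      "card {j. j < n \<and> start a < F.r j \<and> F.r j < stop a} < m * ?\<beta>"
      "stop a - start a < F.p (job a) \<Longrightarrow> m * ?\<beta> \<le> card {j. j < n \<and> start a < F.r j \<and> F.r j \<le> stop a}"
      unfolding e using S_run[OF that] r[OF jn] by simp_all
  qed
  have snap: "\<exists>T \<sigma>. T \<le> \<theta> \<and> state_inv T \<sigma> \<and>
     (\<forall>j\<in>F.fw \<theta>. \<exists>q\<in>set (fq \<sigma>). jid q = j \<and> q = jrecs ?\<beta> J ! j) \<and>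
     (\<forall>j\<in>F.rw \<theta>. \<exists>z\<in>set (rq \<sigma>). jid z = j \<and> z = jrecs ?\<beta> J ! j) \<and>
     card (F.act \<theta>) = length (running \<sigma>) \<and> card {a \<in> F.act \<theta>. \<not> F.first a} = rejs (running \<sigma>) \<and>
     (\<forall>a\<in>F.act \<theta>. \<exists>x\<in>set (running \<sigma>). run_key a = xkey x \<and> (erej x \<longleftrightarrow> \<not> F.first a) \<and> ejob x = jrecs ?\<beta> J ! job a)"
    if \<theta>: "- 1 \<le> \<theta>" for \<theta>
  proof (rule S_snapshot[OF \<theta>])
    fix T \<sigma> assume sn: "T \<le> \<theta>" "state_inv T \<sigma>"
      "\<And>j. j < length (jrecs ?\<beta> J) \<Longrightarrow> rl j \<le> \<theta> \<longleftrightarrow> j < relno \<sigma>"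
      "\<And>u. u \<in> set (outs \<sigma>) \<Longrightarrow> orun_run u \<in> S \<and> ostop u \<le> \<theta>"
      "\<And>x. x \<in> set (running \<sigma>) \<Longrightarrow> \<exists>a\<in>S. run_key a = xkey x \<and> start a \<le> \<theta> \<and> \<theta> < stop a"
      "\<And>a. a \<in> S \<Longrightarrow> start a \<le> \<theta> \<Longrightarrow> stop a \<le> \<theta> \<and> a \<in> orun_run ` set (outs \<sigma>) \<or>
         \<theta> < stop a \<and> run_key a \<in> xkey ` set (running \<sigma>)"
    interpret I: sim_inv "jrecs ?\<beta> J" "m * ?\<beta>" "m div 2" "min n m" T "relno \<sigma>" "fq \<sigma>" "rq \<sigma>" "running \<sigma>" "free \<sigma>" "outs \<sigma>"
      using sn(2) by (simp add: state_inv_def)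
    have keyx: "job a = jid (ejob x)" "machine a = emach x" "start a = estart x" if "run_key a = xkey x" for a x
      using that by (auto simp: run_key_def xkey_def)
    have xkey_inj: "x = y" if "x \<in> set (running \<sigma>)" "y \<in> set (running \<sigma>)" "jid (ejob x) = jid (ejob y)" for x y
      using I.dist that by (auto simp: distinct_map inj_on_def)
    have A1: "\<exists>x\<in>set (running \<sigma>). run_key a = xkey x" if "a \<in> F.act \<theta>" for a
      using sn(6)[of a] that by (auto simp: F.act_def)
    have rej: "erej x \<longleftrightarrow> \<not> F.first a" if a: "a \<in> F.act \<theta>" and x: "x \<in> set (running \<sigma>)" "run_key a = xkey x" for a x
    proof
      assume "erej x"
      then obtain u where u: "u \<in> set (outs \<sigma>)" "ojob u = jid (ejob x)" using I.rejX[OF x(1)] by blast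
      then have "ostop u \<le> estart x" using I.out_X[OF u(1) x(1)] by simp
      then have "ostart u < start a" using I.outD[OF u(1)] keyx[OF x(2)] by linarith
      then show "\<not> F.first a" using sn(4)[OF u(1)] u(2) keyx[OF x(2)] unfolding F.first_def
        by (auto intro!: bexI[of _ "orun_run u"])
    next
      assume "\<not> F.first a"
      then obtain b where b: "b \<in> S" "job b = job a" "start b < start a" by (auto simp: F.first_def)
      have "start b \<le> \<theta>" using b a by (auto simp: F.act_def)
      from sn(6)[OF b(1) this] show "erej x"
      proof (elim disjE conjE)
        assume "run_key b \<in> xkey ` set (running \<sigma>)"
        then obtain y where y: "y \<in> set (running \<sigma>)" "run_key b = xkey y" by auto
        then have "x = y" using xkey_inj[OF x(1) y(1)] keyx[OF x(2)] keyx[OF y(2)] b by simp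
        then show ?thesis using keyx[OF x(2)] keyx[OF y(2)] b by simp
      next
        assume "b \<in> orun_run ` set (outs \<sigma>)"
        then show ?thesis using I.rejX[OF x(1)] b keyx[OF x(2)] by auto
      qed
    qed
    \<comment> \<open>This matching of active runs with running entries is a bijection. It turns the
      cardinalities into the length of the list and the number of its restarts.\<close>
    define f where "f a = (SOME x. x \<in> set (running \<sigma>) \<and> run_key a = xkey x)" for a
    have f: "f a \<in> set (running \<sigma>)" "run_key a = xkey (f a)" if "a \<in> F.act \<theta>" for a
      using A1[OF that] someI_ex[of "\<lambda>x. x \<in> set (running \<sigma>) \<and> run_key a = xkey x"] unfolding f_def by blast+
    have finj: "inj_on f (F.act \<theta>)"
      by (rule inj_onI) (metis (no_types, lifting) f(2) S_key_inj F.act_def mem_Collect_eq)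
    have fimg: "f ` F.act \<theta> = set (running \<sigma>)"
    proof
      show "f ` F.act \<theta> \<subseteq> set (running \<sigma>)" using f by auto
      show "set (running \<sigma>) \<subseteq> f ` F.act \<theta>"
      proof
        fix x assume x: "x \<in> set (running \<sigma>)"
        then obtain a where a: "a \<in> S" "run_key a = xkey x" "start a \<le> \<theta> \<and> \<theta> < stop a" using sn(5) by blast
        then have aa: "a \<in> F.act \<theta>" by (simp add: F.act_def)
        have "f a = x" using xkey_inj[OF f(1)[OF aa] x] keyx[OF a(2)] keyx[OF f(2)[OF aa]] by simp
        then show "x \<in> f ` F.act \<theta>" using aa by blast
      qed
    qed
    have dr: "distinct (running \<sigma>)" using I.dist by (simp add: distinct_map)
    have "card (F.act \<theta>) = card (set (running \<sigma>))" using card_image[OF finj] fimg by simp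
    then have c1: "card (F.act \<theta>) = length (running \<sigma>)" using distinct_card[OF dr] by simp
    have "erej (f a) \<longleftrightarrow> \<not> F.first a" if "a \<in> F.act \<theta>" for a
      using rej[OF that f[OF that]] .
    then have "f ` {a \<in> F.act \<theta>. \<not> F.first a} = {x \<in> f ` F.act \<theta>. erej x}" by blast
    then have fe: "f ` {a \<in> F.act \<theta>. \<not> F.first a} = set (filter erej (running \<sigma>))" by (simp add: fimg)
    have "inj_on f {a \<in> F.act \<theta>. \<not> F.first a}" using finj by (rule inj_on_subset) auto
    then have "card {a \<in> F.act \<theta>. \<not> F.first a} = card (set (filter erej (running \<sigma>)))"
      using fe by (simp only: card_image[symmetric])
    then have c2: "card {a \<in> F.act \<theta>. \<not> F.first a} = rejs (running \<sigma>)"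
      using distinct_card[of "filter erej (running \<sigma>)"] dr by (simp add: rejs_conv)
    have fwQ: "\<exists>q\<in>set (fq \<sigma>). jid q = j \<and> q = jrecs ?\<beta> J ! j" if j: "j \<in> F.fw \<theta>" for j
    proof -
      have jk: "j < n" "j < relno \<sigma>" "\<And>a. a \<in> S \<Longrightarrow> job a = j \<Longrightarrow> \<theta> < start a"
        using j sn(3)[of j] r[of j] by (auto simp: F.fw_def)
      have no_out: "ojob u \<noteq> j" if u: "u \<in> set (outs \<sigma>)" for u
      proof
        assume "ojob u = j"
        then have "\<theta> < ostart u" using jk(3)[of "orun_run u"] sn(4)[OF u] by simp
        then show False using sn(4)[OF u] I.outD[OF u] by linarith
      qed
      have no_X: "jid (ejob x) \<noteq> j" if x: "x \<in> set (running \<sigma>)" for x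
      proof
        assume "jid (ejob x) = j"
        moreover obtain a where "a \<in> S" "run_key a = xkey x" "start a \<le> \<theta>" using sn(5)[OF x] by blast
        ultimately show False using jk(3)[of a] keyx[of a x] by simp
      qed
      have "j \<in> jid ` set (fq \<sigma>)"
      proof -
        have "j \<notin> jid ` set (rq \<sigma>)" using I.rejZ no_out by blast
        moreover have "j \<notin> (jid \<circ> ejob) ` set (running \<sigma>)" using no_X by auto
        ultimately show ?thesis using I.somewhere[OF jk(2)] no_out by blast
      qed
      then show ?thesis using I.jobQ by blast
    qed
    have rwZ: "\<exists>z\<in>set (rq \<sigma>). jid z = j \<and> z = jrecs ?\<beta> J ! j" if j: "j \<in> F.rw \<theta>" for j
    proof -
      obtain a where a: "a \<in> S" "job a = j" "start a \<le> \<theta>" using j by (auto simp: F.rw_def)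
      obtain b where b: "b \<in> S" "job b = j" "\<theta> < start b" using j by (auto simp: F.rw_def)
      have na: "c \<in> F.act \<theta> \<Longrightarrow> job c \<noteq> j" for c using j by (auto simp: F.rw_def)
      have "stop a \<le> \<theta>" using na[of a] a by (force simp: F.act_def)
      then obtain u where u: "u \<in> set (outs \<sigma>)" "a = orun_run u" using sn(6)[OF a(1,3)] by auto
      have jk: "j < relno \<sigma>" using I.outD[OF u(1)] u a by simp
      have no_X: "jid (ejob x) \<noteq> j" if x: "x \<in> set (running \<sigma>)" for x
      proof -
        obtain c where "c \<in> S" "run_key c = xkey x" "start c \<le> \<theta> \<and> \<theta> < stop c" using sn(5)[OF x] by blast
        then show ?thesis using na[of c] keyx[of c x] by (simp add: F.act_def)
      qed
      have no_done: "\<not> (ojob v = j \<and> ostop v - ostart v = pj j)" if v: "v \<in> set (outs \<sigma>)" for v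
      proof
        assume *: "ojob v = j \<and> ostop v - ostart v = pj j"
        have vS: "orun_run v \<in> S" "ostop v \<le> \<theta>" using sn(4)[OF v] by auto
        then have "b \<noteq> orun_run v" using b I.outD[OF v] by auto
        then have "stop b \<le> ostart v" using S_last[OF vS(1) b(1)] * b by simp
        then show False using b vS I.outD[OF v] S_run(4)[OF b(1)] by linarith
      qed
      have "j \<in> jid ` set (rq \<sigma>)"
      proof -
        have "j \<notin> jid ` set (fq \<sigma>)" using I.freshQ[OF _ u(1)] u(2) a(2) by auto
        moreover have "j \<notin> (jid \<circ> ejob) ` set (running \<sigma>)" using no_X by auto
        ultimately show ?thesis using I.somewhere[OF jk] no_done by blast
      qed
      then show ?thesis using I.jobZ by blast
    qed
    have "\<exists>x\<in>set (running \<sigma>). run_key a = xkey x \<and> (erej x \<longleftrightarrow> \<not> F.first a) \<and> ejob x = jrecs ?\<beta> J ! job a"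
      if a: "a \<in> F.act \<theta>" for a
    proof -
      obtain x where x: "x \<in> set (running \<sigma>)" "run_key a = xkey x" using A1[OF a] by blast
      have "ejob x = jrecs ?\<beta> J ! job a" using I.jobX[OF x(1)] keyx(1)[OF x(2)] by metis
      then show ?thesis using x rej[OF a x] by blast
    qed
    then have "\<forall>a\<in>F.act \<theta>. \<exists>x\<in>set (running \<sigma>). run_key a = xkey x \<and> (erej x \<longleftrightarrow> \<not> F.first a) \<and> ejob x = jrecs ?\<beta> J ! job a"
      by blast
    then show ?thesis using fwQ rwZ by (intro exI[of _ T] exI[of _ \<sigma>] conjI sn(1,2) c1 c2 ballI) blast+
  qed
  \<comment> \<open>The simulation has \<open>min n m\<close> machines only. For
    \<open>n \<le> m\<close>, all of them busy and a further job waiting would take more than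
    \<open>n\<close> jobs; so a waiting job implies that the number is \<open>m\<close>.\<close>
  have full: "length (running \<sigma>) = m" if "state_inv T \<sigma>" "free \<sigma> = []" "q \<in> set (fq \<sigma>) \<union> set (rq \<sigma>)" for T \<sigma> q
  proof -
    interpret I: sim_inv "jrecs ?\<beta> J" "m * ?\<beta>" "m div 2" "min n m" T "relno \<sigma>" "fq \<sigma>" "rq \<sigma>" "running \<sigma>" "free \<sigma>" "outs \<sigma>"
      using that(1) by (simp add: state_inv_def)
    have "card (set (map emach (running \<sigma>))) = min n m" using I.mach_set that(2) by simp
    then have eqn: "length (running \<sigma>) = min n m" using I.mach_dist that(2) distinct_card[of "map emach (running \<sigma>)"] by simp
    have "set (map jid (fq \<sigma>) @ map jid (rq \<sigma>) @ map (jid \<circ> ejob) (running \<sigma>)) \<subseteq> {..<n}"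
    proof -
      have "jid q < n" if "q \<in> set (fq \<sigma>)" for q using I.jobQ[OF that] I.k_le by simp
      moreover have "jid q < n" if "q \<in> set (rq \<sigma>)" for q using I.jobZ[OF that] I.k_le by simp
      moreover have "jid (ejob q) < n" if "q \<in> set (running \<sigma>)" for q using I.jobX[OF that] I.k_le by simp
      ultimately show ?thesis by auto
    qed
    then have "card (set (map jid (fq \<sigma>) @ map jid (rq \<sigma>) @ map (jid \<circ> ejob) (running \<sigma>))) \<le> n"
      using card_mono[of "{..<n}"] by (metis card_lessThan finite_lessThan)
    then have "length (fq \<sigma>) + length (rq \<sigma>) + length (running \<sigma>) \<le> n"
      using distinct_card[OF I.dist] by simp
    moreover have "0 < length (fq \<sigma>) + length (rq \<sigma>)" using that(3) by (auto simp: length_pos_if_in_set)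
    ultimately show ?thesis using eqn by (cases "n \<le> m") (simp_all add: min_def)
  qed
  \<comment> \<open>Snapshots are available from time \<open>- 1\<close> on; earlier nothing has
    happened.\<close>
  have before: "F.fw \<theta> = {}" "F.rw \<theta> = {}" "F.act \<theta> = {}" if "\<not> - 1 \<le> \<theta>" for \<theta>
  proof -
    have "F.r j > \<theta>" if "j < n" for j using rel_nonneg[of j] r[OF that] that \<open>\<not> - 1 \<le> \<theta>\<close> by simp
    then show "F.fw \<theta> = {}" by (force simp: F.fw_def)
    have "start a > \<theta>" if "a \<in> S" for a using start0[OF that] \<open>\<not> - 1 \<le> \<theta>\<close> by simp
    then show "F.rw \<theta> = {}" "F.act \<theta> = {}" by (force simp: F.rw_def F.act_def)+
  qed
  have powi: "real ?\<beta> powi cls ?\<beta> x \<le> x" "x < real ?\<beta> powi (cls ?\<beta> x + 1)" if "0 < x" for x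
  proof -
    have e: "real ?\<beta> powi k = real ?\<beta> powr k" for k using b2 by (simp add: powr_real_of_int')
    have x: "x = real ?\<beta> powr (log ?\<beta> x)" using that b2 by simp
    show "real ?\<beta> powi cls ?\<beta> x \<le> x" unfolding e using b2 by (subst (2) x, intro powr_mono) (auto simp: cls_def)
    show "x < real ?\<beta> powi (cls ?\<beta> x + 1)" unfolding e using b2
      by (subst x, intro powr_less_mono) (auto simp: cls_def)
  qed
  show ?thesis
    unfolding eq
  proof (unfold_locales, goal_cases)
    case 1 show ?case by (rule inst)
  next
    case 2 show ?case by (rule len)
  next
    case 3 show ?case by (rule m2)
  next
    case 4 show ?case by (rule b2)
  next
    case 5 show ?case using base_cover m2 by simp
  next
    case 6 show ?case using alg_kill_restart[OF inst le m2] unfolding eq kill_restart_schedule_def by blast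
  next
    case (7 j) then show ?case using powi(1) instD[OF inst] by (simp add: F.p_def)
  next
    case (8 j) then show ?case using powi(2) instD[OF inst] by (simp add: F.p_def)
  next
    case (9 a) then show ?case by (rule runr)
  next
    case (10 j) then show ?case using S_completes[of j] by auto
  next
    case (11 a b)
    have "stop a - start a \<noteq> F.p (job a)"
    proof
      assume *: "stop a - start a = F.p (job a)"
      have jn: "job a < n" using S_run(1)[OF 11(1)] by simp
      have "stop a - start a = pj (job a)" using * r(2)[OF jn] by (rule trans[OF _ sym])
      moreover have "b \<noteq> a" using 11(4) by auto
      ultimately have "stop b \<le> start a" using S_last[OF 11(1,2) _ 11(3)[symmetric]] by blast
      then show False using 11(4) S_run(4)[OF 11(2)] by linarith
    qed
    then show ?case using runr(2)[OF 11(1)] by simp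
  next
    case (12 \<theta>)
    then obtain j where j: "j \<in> F.fw \<theta>" by blast
    then have "- 1 \<le> \<theta>" using before by blast
    from snap[OF this] obtain T \<sigma> where **: "state_inv T \<sigma>" "card (F.act \<theta>) = length (running \<sigma>)"
      "\<forall>j\<in>F.fw \<theta>. \<exists>q\<in>set (fq \<sigma>). jid q = j \<and> q = jrecs ?\<beta> J ! j"
      by (elim exE conjE) (rule that, assumption+)
    then obtain q where "q \<in> set (fq \<sigma>)" using j by blast
    note * = **(1) this **(2)
    then have "free \<sigma> = []" by (cases "fq \<sigma>") (auto simp: state_inv_def)
    then show ?case using full[OF *(1), of q] * by simp
  next
    case (13 a j)
    have "- 1 \<le> start a" using start0[OF 13(1)] by simp
    from snap[OF this] obtain T \<sigma> where sn: "T \<le> start a" "state_inv T \<sigma>"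
     "\<forall>j\<in>F.fw (start a). \<exists>q\<in>set (fq \<sigma>). jid q = j \<and> q = jrecs ?\<beta> J ! j"
     "\<forall>c\<in>F.act (start a). \<exists>x\<in>set (running \<sigma>). run_key c = xkey x \<and> (erej x \<longleftrightarrow> \<not> F.first c) \<and> ejob x = jrecs ?\<beta> J ! job c"
      by (elim exE conjE) (rule that, assumption+)
    obtain q where q: "q \<in> set (fq \<sigma>)" "jid q = j" "q = jrecs ?\<beta> J ! j" using sn(3) 13 by blast
    have "a \<in> F.act (start a)" using 13 S_run(4) by (simp add: F.act_def)
    then obtain x where x: "x \<in> set (running \<sigma>)" "run_key a = xkey x" "erej x \<longleftrightarrow> \<not> F.first a" "ejob x = jrecs ?\<beta> J ! job a"
      using sn(4) by blast
    have "estart x \<le> T" using sn(2) x(1) sim_inv.ent unfolding state_inv_def by blast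
    \<comment> \<open>No entry starts after the time \<open>T\<close> of its state, and
      \<open>T\<close> is at most \<open>start a\<close>. Thus the state belongs to the very moment
      of the start, for which \<open>state_inv\<close> records priorities.\<close>
    then have "estart x = T" using sn(1) x(2) by (simp add: run_key_def xkey_def)
    then have *: "if erej x then fq \<sigma> = [] \<and> (\<forall>z\<in>set (rq \<sigma>). jproc (ejob x) \<le> jproc z)
       else (\<forall>q\<in>set (fq \<sigma>). better (ejob x) q)" using sn(2) x(1) by (simp add: state_inv_def)
    then have "\<not> erej x" using q by auto
    then have "better (ejob x) q" using * q by simp
    moreover have "job a < n" using S_run(1)[OF 13(1)] by simp
    moreover have "j < n" using 13 by (simp add: F.fw_def)
    ultimately show ?case using x q(3) \<open>\<not> erej x\<close> by (simp add: better_def)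
  next
    case (14 a) then show ?case by (rule runr)
  next
    case (15 a) then show ?case by (rule runr)
  next
    case (16 \<theta>)
    then obtain j where j: "j \<in> F.rw \<theta>" by blast
    then have "- 1 \<le> \<theta>" using before by blast
    from snap[OF this] obtain T \<sigma> where **: "state_inv T \<sigma>" "card (F.act \<theta>) = length (running \<sigma>)"
      "card {a \<in> F.act \<theta>. \<not> F.first a} = rejs (running \<sigma>)"
      "\<forall>j\<in>F.rw \<theta>. \<exists>q\<in>set (rq \<sigma>). jid q = j \<and> q = jrecs ?\<beta> J ! j"
      by (elim exE conjE) (rule that, assumption+)
    then obtain q where "q \<in> set (rq \<sigma>)" using j by blast
    note * = **(1) this **(2,3)
    have "free \<sigma> = [] \<or> m div 2 \<le> rejs (running \<sigma>)" using * by (cases "rq \<sigma>") (auto simp: state_inv_def)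
    then show ?case using full[OF *(1), of q] * by auto
  next
    case (17 \<theta>)
    show ?case
    proof (cases "- 1 \<le> \<theta>")
      case True
      from snap[OF this] obtain T \<sigma> where "state_inv T \<sigma>" "card {a \<in> F.act \<theta>. \<not> F.first a} = rejs (running \<sigma>)"
        by (elim exE conjE) (rule that, assumption+)
      then show ?thesis using sim_inv.cap unfolding state_inv_def by (elim conjE) metis
    qed (simp add: before)
  next
    case (18 a j)
    have "- 1 \<le> start a" using start0[OF 18(1)] by simp
    from snap[OF this] obtain T \<sigma> where sn: "T \<le> start a" "state_inv T \<sigma>"
     "\<forall>j\<in>F.rw (start a). \<exists>q\<in>set (rq \<sigma>). jid q = j \<and> q = jrecs ?\<beta> J ! j"
     "\<forall>c\<in>F.act (start a). \<exists>x\<in>set (running \<sigma>). run_key c = xkey x \<and> (erej x \<longleftrightarrow> \<not> F.first c) \<and> ejob x = jrecs ?\<beta> J ! job c"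
      by (elim exE conjE) (rule that, assumption+)
    obtain q where q: "q \<in> set (rq \<sigma>)" "q = jrecs ?\<beta> J ! j" using sn(3) 18 by blast
    have "a \<in> F.act (start a)" using 18 S_run(4) by (simp add: F.act_def)
    then obtain x where x: "x \<in> set (running \<sigma>)" "run_key a = xkey x" "erej x \<longleftrightarrow> \<not> F.first a" "ejob x = jrecs ?\<beta> J ! job a"
      using sn(4) by blast
    have "estart x \<le> T" using sn(2) x(1) sim_inv.ent unfolding state_inv_def by blast
    then have "estart x = T" using sn(1) x(2) by (simp add: run_key_def xkey_def)
    then have "if erej x then fq \<sigma> = [] \<and> (\<forall>z\<in>set (rq \<sigma>). jproc (ejob x) \<le> jproc z)
       else (\<forall>q\<in>set (fq \<sigma>). better (ejob x) q)" using sn(2) x(1) by (simp add: state_inv_def)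
    then have "jproc (ejob x) \<le> jproc q" using x(3) 18(2) q(1) by simp
    moreover have "job a < n" using S_run(1)[OF 18(1)] by simp
    moreover have "j < n" using 18 by (simp add: F.rw_def)
    ultimately show ?case using x(4) q(2) by (simp add: F.p_def)
  qed
qed

section \<open>Independence of jobs not yet released\<close>

definition extend :: "real jrec list \<Rightarrow> real state \<Rightarrow> real state" where
  "extend L \<sigma> = St (pend \<sigma> @ L) (relno \<sigma>) (fq \<sigma>) (rq \<sigma>) (running \<sigma>) (free \<sigma>) (outs \<sigma>)"

lemma arrive_append:
  "arrive t pd k Q = (pd', k', Q') \<Longrightarrow> (\<And>j. j \<in> set L \<Longrightarrow> t < jrel j) \<Longrightarrow>
   arrive t (pd @ L) k Q = (pd' @ L, k', Q')"
proof (induction t pd k Q rule: arrive.induct)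
  case (1 t k Q)
  then show ?case by (cases L) auto
qed (auto split: if_splits)

lemma next_time_append:
  assumes "pd \<noteq> [] \<or> X \<noteq> []" "\<And>j. j \<in> set L \<Longrightarrow> t < jrel j"
  shows "next_time pd X \<le> t \<Longrightarrow> next_time (pd @ L) X = next_time pd X"
    "t < next_time pd X \<Longrightarrow> t < next_time (pd @ L) X"
proof -
  have "(next_time pd X \<le> t \<longrightarrow> next_time (pd @ L) X = next_time pd X) \<and> (t < next_time pd X \<longrightarrow> t < next_time (pd @ L) X)"
  proof (cases "pd = [] \<and> L \<noteq> []")
    case True
    then obtain j L' where L: "L = j # L'" by (cases L) auto
    have X: "X \<noteq> []" using True assms by simp
    have "\<exists>x\<in>set X. next_time [] X = eend x" using next_time_in[of "[]" X] X by auto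
    then obtain x where x: "x \<in> set X" "next_time [] X = eend x" by blast
    have le: "next_time L X \<le> eend y" "next_time [] X \<le> eend y" if "y \<in> set X" for y
      using next_time_le(1)[OF that, of L] next_time_le(1)[OF that, of "[]"] by simp_all
    have j: "t < jrel j" using assms(2) L by simp
    have in': "(\<exists>y\<in>set X. next_time L X = eend y) \<or> next_time L X = jrel j"
      using next_time_in[of L X] L by auto
    show ?thesis using in' le[OF x(1)] x(2) j True by (auto dest: le(2))
  next
    case False
    then show ?thesis by (cases pd) auto
  qed
  then show "next_time pd X \<le> t \<Longrightarrow> next_time (pd @ L) X = next_time pd X"
    "t < next_time pd X \<Longrightarrow> t < next_time (pd @ L) X" by auto
qed

lemma step_extend:
  assumes "\<not> idle \<sigma>" "nt \<sigma> \<le> t" "\<And>j. j \<in> set L \<Longrightarrow> t < jrel j"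
  shows "step B h (extend L \<sigma>) = extend L (step B h \<sigma>)"
proof -
  obtain pd k Q Z X fr out where \<sigma>: "\<sigma> = St pd k Q Z X fr out" by (cases \<sigma>)
  have ne: "\<not> (pd = [] \<and> X = [])" "\<not> (pd @ L = [] \<and> X = [])" using assms(1) by (auto simp: idle_def \<sigma>)
  have nt': "next_time pd X \<le> t" using assms(2) by (simp add: nt_def \<sigma>)
  have nt: "next_time (pd @ L) X = next_time pd X"
    by (rule next_time_append(1)[OF _ assms(3) nt']) (use ne in auto)
  obtain pd' k' Q1 where ar: "arrive (next_time pd X) pd k Q = (pd', k', Q1)" by (metis prod_cases3)
  have "next_time pd X < jrel j" if "j \<in> set L" for j using assms(3)[OF that] nt' by simp
  from arrive_append[OF ar this] have ar': "arrive (next_time pd X) (pd @ L) k Q = (pd' @ L, k', Q1)" .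
  show ?thesis
    unfolding \<sigma> extend_def state.sel step.simps if_not_P[OF ne(1)] if_not_P[OF ne(2)] nt
    by (simp add: ar ar' Let_def split: prod.split)
qed

text \<open>As long as the next event is at most \<open>t\<close>, both simulations take the same
  step. After that neither changes anything visible up to \<open>t\<close>, although their further
  events differ.\<close>

lemma loop_extend:
  assumes "jobs J1 B" "jobs J2 B" "\<And>j. j \<in> set L \<Longrightarrow> t < jrel j"
  shows "jobs.state_inv J1 B h M T1 \<sigma> \<Longrightarrow> jobs.state_inv J2 B h M T2 (extend L \<sigma>) \<Longrightarrow>
    same_until t (all_runs (loop B h N \<sigma>)) (all_runs (loop B h N (extend L \<sigma>)))"
proof (induction N arbitrary: \<sigma> T1 T2)
  case 0
  then show ?case by (simp add: same_until_def all_runs_def extend_def)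
next
  case (Suc N)
  interpret A: jobs J1 B h M by fact
  interpret C: jobs J2 B h M by fact
  show ?case
  proof (cases "\<not> idle \<sigma> \<and> nt \<sigma> \<le> t")
    case True
    have ni: "\<not> idle (extend L \<sigma>)" using True by (auto simp: idle_def extend_def)
    have eq: "step B h (extend L \<sigma>) = extend L (step B h \<sigma>)"
      using True by (intro step_extend[where t = t] assms(3)) auto
    show ?thesis
      using Suc.IH[OF A.step_state(1)[OF Suc.prems(1) _ refl refl] C.step_state(1)[OF Suc.prems(2) ni refl refl, unfolded eq]] True
      by (simp add: eq)
  next
    case False
    have "same_until t (all_runs \<sigma>) (all_runs (loop B h (Suc N) \<sigma>))"
      using False by (intro A.same_until_loop[OF Suc.prems(1)]) auto
    moreover have "same_until t (all_runs (extend L \<sigma>)) (all_runs (loop B h (Suc N) (extend L \<sigma>)))"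
    proof (rule C.same_until_loop[OF Suc.prems(2)])
      assume ni: "\<not> idle (extend L \<sigma>)"
      show "t < nt (extend L \<sigma>)"
      proof (cases "idle \<sigma>")
        case True
        then obtain j L' where "L = j # L'" using ni by (cases L) (auto simp: idle_def extend_def)
        then show ?thesis using True assms(3)[of j] by (simp add: idle_def extend_def nt_def)
      next
        case ni: False
        have "t < next_time (pend \<sigma> @ L) (running \<sigma>)"
          by (rule next_time_append(2)[OF _ assms(3)]) (use ni False in \<open>auto simp: idle_def nt_def\<close>)
        then show ?thesis by (simp add: extend_def nt_def)
      qed
    qed
    moreover have "all_runs (extend L \<sigma>) = all_runs \<sigma>" by (simp add: all_runs_def extend_def)
    ultimately show ?thesis by (simp add: same_until_def)
  qed
qed

lemma sorted_filter_prefix: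
  "sorted (map f xs) \<Longrightarrow> \<exists>L. xs = filter (\<lambda>x. f x \<le> t) xs @ L \<and> (\<forall>x\<in>set L. t < f x)"
proof (induction xs)
  case (Cons x xs)
  then obtain L where L: "xs = filter (\<lambda>x. f x \<le> t) xs @ L" "\<forall>x\<in>set L. t < f x" by auto
  show ?case
  proof (cases "f x \<le> t")
    case True
    then show ?thesis using L by (intro exI[of _ L]) simp
  next
    case False
    then have "\<forall>y\<in>set (x # xs). t < f y" using Cons.prems by force
    moreover from this have "filter (\<lambda>x. f x \<le> t) (x # xs) = []" by (auto simp: filter_empty_conv not_le)
    ultimately show ?thesis by (intro exI[of _ "x # xs"]) simp
  qed
qed simp

lemma alg_online:
  assumes inst: "is_instance J" and len: "length J \<le> n" and m2: "2 \<le> m"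
  shows "same_until t (alg n m (revealed t J)) (alg n m J)"
proof -
  let ?\<beta> = "base n m"
  let ?B = "m * ?\<beta>"
  obtain L where L: "J = revealed t J @ L" "\<forall>x\<in>set L. t < release x"
    using sorted_filter_prefix[of release J t] inst by (auto simp: is_instance_def revealed_def)
  have inst1: "is_instance (revealed t J)"
    using inst by (simp add: is_instance_def revealed_def sorted_filter)
  have len1: "length (revealed t J) \<le> n" using len by (auto simp: revealed_def intro: order_trans[OF length_filter_le])
  define k where "k = length (revealed t J)"
  define L' where "L' = drop k (jrecs ?\<beta> J)"
  have rv: "revealed t J = take k J" unfolding k_def using L(1) by (metis append_eq_conv_conj)
  have kJ: "k \<le> length J" unfolding k_def revealed_def by simp
  have "jrecs ?\<beta> (revealed t J) = take k (jrecs ?\<beta> J)"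
    by (rule nth_equalityI) (use kJ in \<open>auto simp: rv\<close>)
  then have app: "jrecs ?\<beta> J = jrecs ?\<beta> (revealed t J) @ L'" by (simp add: L'_def)
  have relL: "t < jrel j" if "j \<in> set L'" for j
  proof -
    have "\<exists>i<length L'. L' ! i = j" using that by (simp add: in_set_conv_nth)
    then obtain i where i': "i < length L'" "j = L' ! i" by blast
    then have i: "i < length J - k" "j = jrecs ?\<beta> J ! (k + i)"
      using kJ by (simp_all add: L'_def del: nth_jrecs)
    then have "jrel j = release (J ! (k + i))" by simp
    also have "J ! (k + i) = L ! i" using L(1) by (metis k_def nth_append_length_plus)
    also have "t < release (L ! i)"
    proof -
      have "length L = length J - k" using L(1) unfolding k_def by (metis add_diff_cancel_left' length_append)
      then show ?thesis using L(2) i by simp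
    qed
    finally show ?thesis .
  qed
  interpret A: finished_run "jrecs ?\<beta> (revealed t J)" ?B "m div 2" "min n m" "2 * n"
    by (rule finished_jrecs[OF inst1 len1 m2])
  interpret C: finished_run "jrecs ?\<beta> J" ?B "m div 2" "min n m" "2 * n"
    by (rule finished_jrecs[OF inst len m2])
  have ext: "C.init = extend L' A.init" 
    unfolding C.init_def A.init_def extend_def by (simp only: state.sel app[symmetric])
  show ?thesis
    unfolding alg_eq[OF inst1 len1 m2] alg_eq[OF inst len m2] A.S_all_runs C.S_all_runs A.final_def C.final_def ext
    using loop_extend[OF A.jobs_axioms C.jobs_axioms relL A.init_inv C.init_inv[unfolded ext]] by simp
qed

lemma alg_kill_restart_online: "2 \<le> m \<Longrightarrow> kill_restart_online n m (alg n m)"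
  by (simp add: kill_restart_online_def alg_kill_restart alg_online)

text \<open>Keep just the completing run of every job. The lemma shows that the infimum in
  \<open>OPT\<close> is taken over a nonempty set.\<close>

lemma kill_restart_preemptive:
  assumes kr: "kill_restart_schedule m J S" and pos: "\<And>j. j < length J \<Longrightarrow> 0 < proc (J ! j)"
  shows "\<exists>V. preemptive_schedule m J V"
proof -
  have val: "valid_runs m J S" using kr unfolding kill_restart_schedule_def by blast
  have "\<forall>j<length J. \<exists>a\<in>S. job a = j \<and> stop a - start a = proc (J ! j)"
    using kr unfolding kill_restart_schedule_def by blast
  then obtain f where f: "\<And>j. j < length J \<Longrightarrow> f j \<in> S \<and> job (f j) = j \<and> stop (f j) - start (f j) = proc (J ! j)"
    by metis
  define V where "V = f ` {..<length J}"
  have VS: "V \<subseteq> S" using f by (auto simp: V_def)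
  have "finite V" by (simp add: V_def)
  then have "valid_runs m J V"
    unfolding valid_runs_def
  proof (intro conjI ballI impI)
    fix a assume "a \<in> V"
    then have "a \<in> S" using VS by blast
    from valid_runsD[OF val this]
    show "job a < length J" "machine a < m" "release (J ! job a) \<le> start a" "start a < stop a" .
  next
    fix a b assume "a \<in> V" "b \<in> V" "a \<noteq> b \<and> (machine a = machine b \<or> job a = job b)"
    then show "disjoint_time a b" using valid_runs_disjoint[OF val, of a b] VS by blast
  qed
  moreover have "{a \<in> V. job a = j} = {f j}" if "j < length J" for j
    using f that by (auto simp: V_def)
  moreover have "a = b" if "a \<in> V" "b \<in> V" "job a = job b" for a b
    using that f by (auto simp: V_def)
  moreover have "(\<Sum>a | a \<in> V \<and> job a = j. stop a - start a) = proc (J ! j)" if "j < length J" for j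
    using f[OF that] \<open>\<And>j. j < length J \<Longrightarrow> {a \<in> V. job a = j} = {f j}\<close>[OF that] by simp
  ultimately have "preemptive_schedule m J V"
    unfolding preemptive_schedule_def by metis
  then show ?thesis by blast
qed

lemma alg_competitive:
  assumes m2: "2 \<le> m"
  shows "competitive n m (66 * max 1 (sqrt (real n / real m))) (alg n m)"
  unfolding competitive_def
proof (intro allI impI, elim conjE)
  fix J :: "real job list" assume inst: "is_instance J" and len: "length J = n"
  let ?G = "66 * max 1 (sqrt (real n / real m))"
  let ?F = "{total_flow_time J V |V. preemptive_schedule m J V}"
  have bound: "total_flow_time J (alg n m J) \<le> ?G * total_flow_time J V" if V: "preemptive_schedule m J V" for V
  proof -
    interpret restart_analysis m n "base n m" J "alg n m J" "\<lambda>j. cls (base n m) (proc (J ! j))"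
      by (rule alg_analysis[OF inst len m2])
    have "0 \<le> total_flow_time J V" unfolding total_flow_time_def
      using preemptive_flow_ge_proc[OF V] instD(2)[OF inst] by (intro sum_nonneg) (metis lessThan_iff less_imp_le order_less_le_trans)
    moreover have "33 * real (base n m) \<le> ?G" using base_le[of m n] m2 by simp
    ultimately show ?thesis using flow_le[OF V] mult_right_mono by (metis order_trans)
  qed
  have ne: "?F \<noteq> {}"
    using kill_restart_preemptive[OF alg_kill_restart[OF inst _ m2, of n]] len instD(2)[OF inst] by auto
  have G: "0 < ?G" by simp
  \<comment> \<open>After division by the factor the left side is a lower bound of the set itself,
    so it passes to the infimum.\<close>
  have "total_flow_time J (alg n m J) / ?G \<le> Inf ?F"
  proof (rule cInf_greatest[OF ne])
    fix x assume "x \<in> ?F"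
    then show "total_flow_time J (alg n m J) / ?G \<le> x" using bound G by (auto simp: divide_le_eq mult.commute)
  qed
  then show "total_flow_time J (alg n m J) \<le> ?G * OPT m J"
    unfolding OPT_def using G by (simp only: pos_divide_le_eq mult.commute)
qed

section \<open>Program code and its cost\<close>

definition runs :: "program \<Rightarrow> nat \<Rightarrow> val list \<Rightarrow> exp \<Rightarrow> val \<Rightarrow> nat \<Rightarrow> bool" where
  "runs P M env e v k \<longleftrightarrow> (\<exists>t. big_step P env e v t \<and> t \<le> k * (2 * M + 1))"

text \<open>A symbolic evaluator: \<open>C\<close> lists the calls whose results are known, and costs are counted in units of
  \<open>2 M + 1\<close>, which pays for one operation on integers of size at most \<open>M\<close>.\<close>

fun ev :: "((nat \<times> val) \<times> (val \<times> nat)) list \<Rightarrow> nat \<Rightarrow> val list \<Rightarrow> exp \<Rightarrow> (val \<times> nat) option" where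
  "ev C M env (EVar i) = (if i < length env then Some (env ! i, 1) else None)"
| "ev C M env (ENum a) = (if int_size a \<le> M then Some (VNum a, 1) else None)"
| "ev C M env (EOp f e1 e2) = (case ev C M env e1 of Some (VNum a, k1) \<Rightarrow>
     (case ev C M env e2 of Some (VNum b, k2) \<Rightarrow>
       if int_size a \<le> M \<and> int_size b \<le> M then Some (VNum (iop_sem f a b), k1 + k2 + 1) else None
     | _ \<Rightarrow> None) | _ \<Rightarrow> None)"
| "ev C M env (EPair e1 e2) = (case ev C M env e1 of Some (v1, k1) \<Rightarrow>
     (case ev C M env e2 of Some (v2, k2) \<Rightarrow> Some (VPair v1 v2, k1 + k2 + 1) | None \<Rightarrow> None) | None \<Rightarrow> None)"
| "ev C M env (EFst e) = (case ev C M env e of Some (VPair v w, k) \<Rightarrow> Some (v, k + 1) | _ \<Rightarrow> None)"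
| "ev C M env (ESnd e) = (case ev C M env e of Some (VPair v w, k) \<Rightarrow> Some (w, k + 1) | _ \<Rightarrow> None)"
| "ev C M env (EIsPair e) = (case ev C M env e of Some (VPair v w, k) \<Rightarrow> Some (VNum 1, k + 1)
     | Some (VNum a, k) \<Rightarrow> Some (VNum 0, k + 1) | None \<Rightarrow> None)"
| "ev C M env (EIf e e1 e2) = (case ev C M env e of Some (VNum a, k) \<Rightarrow>
     (case (if a \<noteq> 0 then ev C M env e1 else ev C M env e2) of Some (v, k') \<Rightarrow> Some (v, k + k' + 1) | None \<Rightarrow> None)
     | _ \<Rightarrow> None)"
| "ev C M env (ELet e1 e2) = (case ev C M env e1 of Some (v1, k1) \<Rightarrow>
     (case ev C M (v1 # env) e2 of Some (v2, k2) \<Rightarrow> Some (v2, k1 + k2 + 1) | None \<Rightarrow> None) | None \<Rightarrow> None)"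
| "ev C M env (ECall f e) = (case ev C M env e of Some (v, k) \<Rightarrow>
     (case map_of C (f, v) of Some (w, k') \<Rightarrow> Some (w, k + k' + 1) | None \<Rightarrow> None) | None \<Rightarrow> None)"

lemma runs_mono: "runs P M env e v k \<Longrightarrow> k \<le> k' \<Longrightarrow> runs P M env e v k'"
  unfolding runs_def by (meson mult_le_mono1 order_trans)

lemma ev_sound:
  assumes C: "\<And>f v w k. ((f, v), (w, k)) \<in> set C \<Longrightarrow> f < length P \<and> runs P M [v] (P ! f) w k"
  shows "ev C M env e = Some (w, k) \<Longrightarrow> runs P M env e w k"
proof (induction e arbitrary: env w k)
  case (EVar i)
  then show ?case by (auto simp: runs_def split: if_splits intro!: exI[of _ 1] big_step.Var)
next
  case (ENum a)
  then have "int_size a \<le> M" "w = VNum a" "k = 1" by (auto split: if_splits)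
  then show ?case using big_step.Num[of P env a] by (auto simp: runs_def intro!: exI[of _ "int_size a"])
next
  case (EOp f e1 e2)
  then obtain a b k1 k2 where 1: "ev C M env e1 = Some (VNum a, k1)" "ev C M env e2 = Some (VNum b, k2)"
    "int_size a \<le> M" "int_size b \<le> M" "w = VNum (iop_sem f a b)" "k = k1 + k2 + 1"
    by (auto split: option.splits prod.splits val.splits if_splits)
  obtain t1 t2 where "big_step P env e1 (VNum a) t1" "t1 \<le> k1 * (2 * M + 1)"
    "big_step P env e2 (VNum b) t2" "t2 \<le> k2 * (2 * M + 1)"
    using EOp.IH(1)[OF 1(1)] EOp.IH(2)[OF 1(2)] by (auto simp: runs_def)
  moreover have "t1 + t2 + int_size a + int_size b \<le> k * (2 * M + 1)"
    using calculation 1 by (simp add: algebra_simps)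
  ultimately show ?case unfolding runs_def 1(5) using big_step.Op by blast
next
  case (EPair e1 e2)
  then obtain v1 v2 k1 k2 where 1: "ev C M env e1 = Some (v1, k1)" "ev C M env e2 = Some (v2, k2)"
    "w = VPair v1 v2" "k = k1 + k2 + 1" by (auto split: option.splits prod.splits)
  obtain t1 t2 where "big_step P env e1 v1 t1" "t1 \<le> k1 * (2 * M + 1)"
    "big_step P env e2 v2 t2" "t2 \<le> k2 * (2 * M + 1)"
    using EPair.IH(1)[OF 1(1)] EPair.IH(2)[OF 1(2)] by (auto simp: runs_def)
  moreover have "t1 + t2 + 1 \<le> k * (2 * M + 1)"
    using calculation 1 by (simp add: algebra_simps)
  ultimately show ?case unfolding runs_def 1(3) using big_step.Pair by blast
next
  case (EFst e)
  then obtain v k1 where 1: "ev C M env e = Some (VPair w v, k1)" "k = k1 + 1"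
    by (auto split: option.splits prod.splits val.splits)
  obtain t where "big_step P env e (VPair w v) t" "t \<le> k1 * (2 * M + 1)"
    using EFst.IH[OF 1(1)] by (auto simp: runs_def)
  moreover have "t + 1 \<le> k * (2 * M + 1)" using calculation 1 by (simp add: algebra_simps)
  ultimately show ?case unfolding runs_def using big_step.Fst by blast
next
  case (ESnd e)
  then obtain v k1 where 1: "ev C M env e = Some (VPair v w, k1)" "k = k1 + 1"
    by (auto split: option.splits prod.splits val.splits)
  obtain t where "big_step P env e (VPair v w) t" "t \<le> k1 * (2 * M + 1)"
    using ESnd.IH[OF 1(1)] by (auto simp: runs_def)
  moreover have "t + 1 \<le> k * (2 * M + 1)" using calculation 1 by (simp add: algebra_simps)
  ultimately show ?case unfolding runs_def using big_step.Snd by blast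
next
  case (EIsPair e)
  then obtain v k1 where 1: "ev C M env e = Some (v, k1)" "k = k1 + 1"
    "w = (case v of VPair _ _ \<Rightarrow> VNum 1 | VNum _ \<Rightarrow> VNum 0)"
    by (auto split: option.splits prod.splits val.splits)
  obtain t where "big_step P env e v t" "t \<le> k1 * (2 * M + 1)"
    using EIsPair.IH[OF 1(1)] by (auto simp: runs_def)
  moreover have "t + 1 \<le> k * (2 * M + 1)" using calculation 1 by (simp add: algebra_simps)
  ultimately show ?case unfolding runs_def 1(3)
    using big_step.IsPair_True big_step.IsPair_False by (cases v) fastforce+
next
  case (EIf e e1 e2)
  then obtain a k1 k2 where 1: "ev C M env e = Some (VNum a, k1)" "k = k1 + k2 + 1"
    "(if a \<noteq> 0 then ev C M env e1 else ev C M env e2) = Some (w, k2)"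
    by (auto split: option.splits prod.splits val.splits)
  obtain t1 where t1: "big_step P env e (VNum a) t1" "t1 \<le> k1 * (2 * M + 1)"
    using EIf.IH(1)[OF 1(1)] by (auto simp: runs_def)
  show ?case
  proof (cases "a = 0")
    case True
    then have "runs P M env e2 w k2" using EIf.IH(3) 1(3) by simp
    then obtain t2 where "big_step P env e2 w t2" "t2 \<le> k2 * (2 * M + 1)"
      unfolding runs_def by blast
    moreover have "t1 + t2 + 1 \<le> k * (2 * M + 1)" using calculation t1 1 by (simp add: algebra_simps)
    ultimately show ?thesis unfolding runs_def using t1 True big_step.If_False by blast
  next
    case False
    then have "runs P M env e1 w k2" using EIf.IH(2) 1(3) by simp
    then obtain t2 where "big_step P env e1 w t2" "t2 \<le> k2 * (2 * M + 1)"
      unfolding runs_def by blast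
    moreover have "t1 + t2 + 1 \<le> k * (2 * M + 1)" using calculation t1 1 by (simp add: algebra_simps)
    ultimately show ?thesis unfolding runs_def using t1 False big_step.If_True by blast
  qed
next
  case (ELet e1 e2)
  then obtain v1 k1 k2 where 1: "ev C M env e1 = Some (v1, k1)" "ev C M (v1 # env) e2 = Some (w, k2)"
    "k = k1 + k2 + 1" by (auto split: option.splits prod.splits)
  obtain t1 t2 where "big_step P env e1 v1 t1" "t1 \<le> k1 * (2 * M + 1)"
    "big_step P (v1 # env) e2 w t2" "t2 \<le> k2 * (2 * M + 1)"
    using ELet.IH(1)[OF 1(1)] ELet.IH(2)[OF 1(2)] by (auto simp: runs_def)
  moreover have "t1 + t2 + 1 \<le> k * (2 * M + 1)"
    using calculation 1 by (simp add: algebra_simps)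
  ultimately show ?case unfolding runs_def using big_step.Let by blast
next
  case (ECall f e)
  then obtain v k1 k2 where 1: "ev C M env e = Some (v, k1)" "map_of C (f, v) = Some (w, k2)"
    "k = k1 + k2 + 1" by (auto split: option.splits prod.splits)
  have "((f, v), (w, k2)) \<in> set C" using 1(2) by (rule map_of_SomeD)
  then obtain t1 t2 where "big_step P env e v t1" "t1 \<le> k1 * (2 * M + 1)"
    "f < length P" "big_step P [v] (P ! f) w t2" "t2 \<le> k2 * (2 * M + 1)"
    using ECall.IH[OF 1(1)] C by (fastforce simp: runs_def)
  moreover have "t1 + t2 + 1 \<le> k * (2 * M + 1)"
    using calculation 1 by (simp add: algebra_simps)
  ultimately show ?case unfolding runs_def using big_step.Call by blast
qed

text \<open>The form in which all cost bounds are proved. The list \<open>C\<close> holds the calls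
  made by the body, the recursive one included, so induction hypotheses enter through the first
  premise; the second is settled by rewriting with \<open>ev\<close>.\<close>

lemma runsI:
  assumes "\<forall>((f, v), (w, k))\<in>set C. f < length P \<and> runs P M [v] (P ! f) w k"
    and "case ev C M env e of None \<Rightarrow> False | Some (w', k') \<Rightarrow> w' = w \<and> k' \<le> k"
  shows "runs P M env e w k"
proof -
  obtain k' where "ev C M env e = Some (w, k')" "k' \<le> k" using assms(2) by (auto split: option.splits)
  then have "runs P M env e w k'" using assms(1) by (intro ev_sound[of C]) auto
  then show ?thesis using \<open>k' \<le> k\<close> by (rule runs_mono)
qed

text \<open>Tuples are nested to the right. Counting from 0, \<open>p\<close> with index
  \<open>i\<close> selects component \<open>i\<close>, and \<open>s\<close> with index
  \<open>i\<close> the rest from component \<open>i\<close> on.\<close>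

abbreviation "v0 \<equiv> EVar 0"
abbreviation "p1 e \<equiv> EFst (ESnd e)"
abbreviation "s2 e \<equiv> ESnd (ESnd e)"
abbreviation "p2 e \<equiv> EFst (s2 e)"
abbreviation "s3 e \<equiv> ESnd (s2 e)"
abbreviation "p3 e \<equiv> EFst (s3 e)"
abbreviation "s4 e \<equiv> ESnd (s3 e)"
abbreviation "p4 e \<equiv> EFst (s4 e)"
abbreviation "s5 e \<equiv> ESnd (s4 e)"
abbreviation "p5 e \<equiv> EFst (s5 e)"
abbreviation "s6 e \<equiv> ESnd (s5 e)"

text \<open>The numbers in calls are positions in \<open>prog\<close> below.  All times are integers, multiples of \<open>1 / D\<close> for
  a common denominator \<open>D\<close> of the input.\<close>

definition insQ_code :: exp where
  "insQ_code = EIf (EIsPair (ESnd v0))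
     (EIf (EOp ILess (s3 (p1 v0)) (s3 (EFst v0)))
       (EPair (p1 v0) (ECall 1 (EPair (EFst v0) (s2 v0)))) v0)
     v0"

text \<open>The argument, a pair of a job and a list, is at the same time the list with the job in
  front. It is therefore returned unchanged where the insertion takes place.\<close>

definition insZ_code :: exp where
  "insZ_code = EIf (EIsPair (ESnd v0))
     (EIf (EOp ILess (p2 (p1 v0)) (p2 (EFst v0)))
       (EPair (p1 v0) (ECall 2 (EPair (EFst v0) (s2 v0)))) v0)
     v0"

definition min_end_code :: exp where
  "min_end_code = EIf (EIsPair (ESnd v0))
     (ECall 3 (EPair (EIf (EOp ILess (s5 (p1 v0)) (EFst v0)) (s5 (p1 v0)) (EFst v0)) (s2 v0)))
     (EFst v0)"

definition arrive_code :: exp where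
  "arrive_code = EIf (EIsPair (p1 v0))
     (EIf (EOp ILess (EFst v0) (p1 (EFst (p1 v0)))) (ESnd v0)
       (ECall 4 (EPair (EFst v0) (EPair (ESnd (p1 v0)) (EPair (EOp IAdd (p2 v0) (ENum 1))
         (ECall 1 (EPair (EFst (p1 v0)) (s3 v0))))))))
     (ESnd v0)"

definition purge_code :: exp where
  "purge_code = EIf (EIsPair (p1 v0))
     (ELet (EFst (p1 v0)) \<comment> \<open>now \<open>EVar 0\<close> is the run and \<open>EVar 1\<close> the argument\<close>
       (EIf (EOp ILess (p1 (EFst (EVar 1))) (s5 v0))
         (EIf (EOp ILess (p2 (EFst (EVar 1))) (EOp IAdd (p3 v0) (EFst (EFst (EVar 1)))))
           (ECall 5 (EPair (EFst (EVar 1)) (EPair (ESnd (p1 (EVar 1))) (EPair (EPair v0 (p2 (EVar 1))) (s3 (EVar 1))))))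
           (ECall 5 (EPair (EFst (EVar 1)) (EPair (ESnd (p1 (EVar 1))) (EPair (p2 (EVar 1)) (EPair (EPair (p1 v0) (p3 (EVar 1)))
             (EPair (ECall 2 (EPair (EFst v0) (p4 (EVar 1))))
               (EPair (EPair (EFst (EFst v0)) (EPair (p1 v0) (EPair (EPair (p2 v0) (s3 (EFst (EVar 1)))) (EPair (p1 (EFst (EVar 1))) (s3 (EFst (EVar 1)))))))
                 (s5 (EVar 1))))))))))
         (ECall 5 (EPair (EFst (EVar 1)) (EPair (ESnd (p1 (EVar 1))) (EPair (p2 (EVar 1)) (EPair (EPair (p1 v0) (p3 (EVar 1)))
           (EPair (p4 (EVar 1))
             (EPair (EPair (EFst (EFst v0)) (EPair (p1 v0) (EPair (EPair (p2 v0) (s3 (EFst (EVar 1)))) (EPair (p1 (EFst (EVar 1))) (s3 (EFst (EVar 1)))))))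
               (s5 (EVar 1)))))))))))
     (s2 v0)"

definition rejs_code :: exp where
  "rejs_code = EIf (EIsPair v0)
     (EIf (p4 (EFst v0)) (EOp IAdd (ENum 1) (ECall 6 (ESnd v0))) (ECall 6 (ESnd v0)))
     (ENum 0)"

definition new_ent_code :: "exp \<Rightarrow> int \<Rightarrow> exp" where
  "new_ent_code j b = EPair j (EPair (EFst (p1 v0)) (EPair (p1 (EFst v0)) (EPair (s2 (EFst v0))
     (EPair (ENum b) (EOp IAdd (p1 (EFst v0)) (p2 j))))))"

definition fill_code :: exp where
  "fill_code = EIf (EIsPair (p1 v0))
     (EIf (EIsPair (p2 v0))
       (ECall 7 (EPair (EFst v0) (EPair (ESnd (p1 v0)) (EPair (ESnd (p2 v0)) (EPair (p3 v0)
         (EPair (new_ent_code (EFst (p2 v0)) 0) (s4 v0)))))))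
       (EIf (EIsPair (p3 v0))
         (EIf (EOp ILess (ECall 6 (s4 v0)) (EFst (EFst v0)))
           (ECall 7 (EPair (EFst v0) (EPair (ESnd (p1 v0)) (EPair (p2 v0) (EPair (ESnd (p3 v0))
             (EPair (new_ent_code (EFst (p3 v0)) 1) (s4 v0)))))))
           (EPair (p2 v0) (EPair (p3 v0) (EPair (s4 v0) (p1 v0)))))
         (EPair (p2 v0) (EPair (p3 v0) (EPair (s4 v0) (p1 v0))))))
     (EPair (p2 v0) (EPair (p3 v0) (EPair (s4 v0) (p1 v0))))"

text \<open>The sum of the two tests acts as a disjunction. The nested lets bind the event time and
  the results of the arrivals, the closing of runs and the starts, so the argument itself moves from
  index 0 up to index 4.\<close>

definition step_code :: exp where
  "step_code = EIf (EOp IAdd (EIsPair (p1 v0)) (EIsPair (p5 v0)))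
     (ELet (EIf (EIsPair (p1 v0)) (ECall 3 (EPair (p1 (EFst (p1 v0))) (p5 v0)))
        (ECall 3 (EPair (s5 (EFst (p5 v0))) (p5 v0))))
     (ELet (ECall 4 (EPair v0 (EPair (p1 (EVar 1)) (EPair (p2 (EVar 1)) (p3 (EVar 1))))))
     (ELet (ECall 5 (EPair (EPair (EFst (EFst (EVar 2))) (EPair (EVar 1) (EPair (p1 v0) (s2 (EFst (EVar 2))))))
        (EPair (p5 (EVar 2)) (EPair (ENum 0) (EPair (EFst (s6 (EVar 2))) (EPair (p4 (EVar 2)) (ESnd (s6 (EVar 2)))))))))
     (ELet (ECall 7 (EPair (EPair (p1 (EFst (EVar 3))) (EPair (EVar 2) (p1 (EVar 1))))
        (EPair (p1 v0) (EPair (s2 (EVar 1)) (EPair (p2 v0) (EFst v0))))))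
     (EPair (EFst (EVar 2)) (EPair (p1 (EVar 2)) (EPair (EFst v0) (EPair (p1 v0) (EPair (p2 v0)
        (EPair (s3 v0) (s3 (EVar 1)))))))))))) (ESnd v0)"

definition loop_code :: exp where
  "loop_code = EIf (EOp ILess (ENum 0) (EFst v0))
     (ECall 9 (EPair (EOp ISub (EFst v0) (ENum 1)) (EPair (p1 v0) (ECall 8 (ESnd v0)))))
     (s2 v0)"

definition base_code :: exp where
  "base_code = EIf (EOp ILess (EFst v0) (s2 v0)) (s2 v0)
     (EIf (EOp ILess (EOp IMul (p1 v0) (EOp IMul (s2 v0) (s2 v0))) (EFst v0))
       (ECall 10 (EPair (EFst v0) (EPair (p1 v0) (EOp IAdd (s2 v0) (ENum 1))))) (s2 v0))"

definition upto_code :: exp where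
  "upto_code = EIf (EOp ILess (ENum 0) v0)
     (EPair (EOp ISub v0 (ENum 1)) (ECall 11 (EOp ISub v0 (ENum 1)))) (ENum 0)"

text \<open>The logarithm is found in integer arithmetic: numerator or denominator is multiplied by
  the base until the quotient is at least 1 and less than the base, and the last component keeps
  count.\<close>

definition cls_code :: exp where
  "cls_code = EIf (EOp ILess (EFst v0) (p1 v0))
     (ECall 12 (EPair (EOp IMul (EFst v0) (p2 v0)) (EPair (p1 v0) (EPair (p2 v0) (EOp ISub (s3 v0) (ENum 1))))))
     (EIf (EOp ILess (EFst v0) (EOp IMul (p1 v0) (p2 v0))) (s3 v0)
       (ECall 12 (EPair (EFst v0) (EPair (EOp IMul (p1 v0) (p2 v0)) (EPair (p2 v0) (EOp IAdd (s3 v0) (ENum 1)))))))"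

text \<open>The product of all denominators is used rather than their least common multiple: it is
  simpler, and its bit length is still bounded by the input size.\<close>

definition denom_code :: exp where
  "denom_code = EIf (EIsPair v0)
     (EOp IMul (ESnd (EFst (EFst v0))) (EOp IMul (ESnd (ESnd (EFst v0))) (ECall 13 (ESnd v0)))) (ENum 1)"

definition recs_code :: exp where
  "recs_code = EIf (EIsPair (s2 v0))
     (ELet (EFst (s2 v0)) \<comment> \<open>now \<open>EVar 0\<close> is the job and \<open>EVar 1\<close> the argument\<close>
       (EPair
         (EPair (p1 (EVar 1))
           (EPair (EOp IDiv (EOp IMul (EFst (EFst v0)) (EFst (EFst (EVar 1)))) (ESnd (EFst v0)))
             (EPair (EOp IDiv (EOp IMul (EFst (ESnd v0)) (EFst (EFst (EVar 1)))) (s2 v0))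
               (ECall 12 (EPair (EFst (ESnd v0)) (EPair (s2 v0) (EPair (ESnd (EFst (EVar 1))) (ENum 0))))))))
         (ECall 14 (EPair (EFst (EVar 1)) (EPair (EOp IAdd (p1 (EVar 1)) (ENum 1)) (s3 (EVar 1)))))))
     (ENum 0)"

definition main_code :: exp where
  "main_code =
     ELet (ECall 10 (EPair (EFst v0) (EPair (p1 v0) (ENum 2))))
     (ELet (ECall 13 (s2 (EVar 1)))
     (s6 (ECall 9 (EPair (EOp IAdd (EFst (EVar 2)) (EFst (EVar 2)))
       (EPair (EPair (EOp IMul (p1 (EVar 2)) (EVar 1)) (EPair (EOp IDiv (p1 (EVar 2)) (ENum 2)) v0))
         (EPair (ECall 14 (EPair (EPair v0 (EVar 1)) (EPair (ENum 0) (s2 (EVar 2)))))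
           (EPair (ENum 0) (EPair (ENum 0) (EPair (ENum 0) (EPair (ENum 0)
             (EPair (ECall 11 (EIf (EOp ILess (EFst (EVar 2)) (p1 (EVar 2))) (EFst (EVar 2)) (p1 (EVar 2)))) (ENum 0))))))))))))"

definition prog :: program where
  "prog = [main_code, insQ_code, insZ_code, min_end_code, arrive_code, purge_code, rejs_code, fill_code,
     step_code, loop_code, base_code, upto_code, cls_code, denom_code, recs_code]"

lemma prog_nth [simp]:
  "length prog = 15" "prog ! 0 = main_code" "prog ! 1 = insQ_code" "prog ! Suc 0 = insQ_code" "prog ! 2 = insZ_code" "prog ! 3 = min_end_code"
  "prog ! 4 = arrive_code" "prog ! 5 = purge_code" "prog ! 6 = rejs_code" "prog ! 7 = fill_code"
  "prog ! 8 = step_code" "prog ! 9 = loop_code" "prog ! 10 = base_code" "prog ! 11 = upto_code"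
  "prog ! 12 = cls_code" "prog ! 13 = denom_code" "prog ! 14 = recs_code"
  by (simp_all add: prog_def)

section \<open>Encodings, and the cost of the single functions\<close>

definition encj :: "int jrec \<Rightarrow> val" where
  "encj j = VPair (VNum (int (jid j))) (VPair (VNum (jrel j)) (VPair (VNum (jproc j)) (VNum (jcls j))))"

definition ence :: "int ent \<Rightarrow> val" where
  "ence x = VPair (encj (ejob x)) (VPair (VNum (int (emach x))) (VPair (VNum (estart x)) (VPair (VNum (int (ek x)))
     (VPair (VNum (of_bool (erej x))) (VNum (eend x))))))"

definition enco :: "int \<Rightarrow> int orun \<Rightarrow> val" where
  "enco D a = VPair (VNum (int (ojob a))) (VPair (VNum (int (omach a)))
     (VPair (VPair (VNum (ostart a)) (VNum D)) (VPair (VNum (ostop a)) (VNum D))))"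

abbreviation "encjs Q \<equiv> list_val (map encj Q)"
abbreviation "ences X \<equiv> list_val (map ence X)"
abbreviation "encos D out \<equiv> list_val (map (enco D) out)"
abbreviation "encns fr \<equiv> list_val (map (\<lambda>i. VNum (int i)) fr)"

text \<open>The identifier is only copied and never an operand, so its size does not matter for the
  cost. The same holds for the machine number in \<open>oke\<close>.\<close>

definition okj :: "nat \<Rightarrow> int jrec \<Rightarrow> bool" where
  "okj M j \<longleftrightarrow> int_size (jrel j) \<le> M \<and> int_size (jproc j) \<le> M \<and> int_size (jcls j) \<le> M"

definition oke :: "nat \<Rightarrow> int ent \<Rightarrow> bool" where
  "oke M x \<longleftrightarrow> okj M (ejob x) \<and> int_size (estart x) \<le> M \<and> int_size (eend x) \<le> M \<and> int_size (int (ek x)) \<le> M"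

lemma int_size_mono: "0 \<le> a \<Longrightarrow> a \<le> b \<Longrightarrow> int_size a \<le> int_size b"
  by (simp add: int_size_def floorlog_mono nat_mono)

lemma int_size_small [simp]: "int_size 0 = 1" "int_size 1 = 2" "int_size 2 = 3"
  by (simp_all add: int_size_def compute_floorlog floorlog_eq_zero_iff)

text \<open>The factor 50 is a generous bound for the operations outside the recursive call; the
  round constants of the following cost lemmas arise in the same way.\<close>

lemma insQ_runs:
  "okj M j \<Longrightarrow> (\<forall>q\<in>set Q. okj M q) \<Longrightarrow>
   runs prog M [VPair (encj j) (encjs Q)] insQ_code (encjs (insQ j Q)) (50 * (length Q + 1))"
proof (induction Q)
  case Nil
  show ?case by (rule runsI[of "[]"]) (simp_all add: insQ_code_def)
next
  case (Cons q Q)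
  let ?C = "[((1, VPair (encj j) (encjs Q)), (encjs (insQ j Q), 50 * (length Q + 1)))]"
  show ?case
  proof (rule runsI[of ?C])
    show "\<forall>((f, v), (w, k))\<in>set ?C. f < length prog \<and> runs prog M [v] (prog ! f) w k"
      using Cons by simp
    show "case ev ?C M [VPair (encj j) (encjs (q # Q))] insQ_code of None \<Rightarrow> False
      | Some (w', k') \<Rightarrow> w' = encjs (insQ j (q # Q)) \<and> k' \<le> 50 * (length (q # Q) + 1)"
      using Cons.prems by (cases "jcls q < jcls j") (simp_all add: insQ_code_def encj_def[of q] encj_def[of j] okj_def)
  qed
qed

lemma insZ_runs:
  "okj M j \<Longrightarrow> (\<forall>q\<in>set Q. okj M q) \<Longrightarrow>
   runs prog M [VPair (encj j) (encjs Q)] insZ_code (encjs (insZ j Q)) (50 * (length Q + 1))"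
proof (induction Q)
  case Nil
  show ?case by (rule runsI[of "[]"]) (simp_all add: insZ_code_def)
next
  case (Cons q Q)
  let ?C = "[((2, VPair (encj j) (encjs Q)), (encjs (insZ j Q), 50 * (length Q + 1)))]"
  show ?case
  proof (rule runsI[of ?C])
    show "\<forall>((f, v), (w, k))\<in>set ?C. f < length prog \<and> runs prog M [v] (prog ! f) w k"
      using Cons by simp
    show "case ev ?C M [VPair (encj j) (encjs (q # Q))] insZ_code of None \<Rightarrow> False
      | Some (w', k') \<Rightarrow> w' = encjs (insZ j (q # Q)) \<and> k' \<le> 50 * (length (q # Q) + 1)"
      using Cons.prems by (cases "jproc q < jproc j") (simp_all add: insZ_code_def encj_def[of q] encj_def[of j] okj_def)
  qed
qed

lemma min_end_runs:
  "int_size t \<le> M \<Longrightarrow> (\<forall>x\<in>set X. oke M x) \<Longrightarrow>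
   runs prog M [VPair (VNum t) (ences X)] min_end_code (VNum (min_end t X)) (50 * (length X + 1))"
proof (induction X arbitrary: t)
  case Nil
  show ?case by (rule runsI[of "[]"]) (simp_all add: min_end_code_def)
next
  case (Cons x X)
  let ?t = "if eend x < t then eend x else t"
  let ?C = "[((3, VPair (VNum ?t) (ences X)), (VNum (min_end ?t X), 50 * (length X + 1)))]"
  show ?case
  proof (rule runsI[of ?C])
    show "\<forall>((f, v), (w, k))\<in>set ?C. f < length prog \<and> runs prog M [v] (prog ! f) w k"
      using Cons.IH[of ?t] Cons.prems by (simp add: oke_def)
    show "case ev ?C M [VPair (VNum t) (ences (x # X))] min_end_code of None \<Rightarrow> False
      | Some (w', k') \<Rightarrow> w' = VNum (min_end t (x # X)) \<and> k' \<le> 50 * (length (x # X) + 1)"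
      using Cons.prems by (cases "eend x < t") (simp_all add: min_end_code_def ence_def[of x] oke_def)
  qed
qed

text \<open>Neither \<open>k + length pd\<close> nor \<open>length pd + length Q\<close> changes in
  the recursion. So one size bound covers all counters, and one length bound all insertions.\<close>

lemma arrive_runs:
  "arrive t pd k Q = (pd', k', Q') \<Longrightarrow> int_size t \<le> M \<Longrightarrow> (\<forall>j\<in>set pd \<union> set Q. okj M j) \<Longrightarrow>
   int_size (int (k + length pd)) \<le> M \<Longrightarrow> 3 \<le> M \<Longrightarrow>
   runs prog M [VPair (VNum t) (VPair (encjs pd) (VPair (VNum (int k)) (encjs Q)))] arrive_code
     (VPair (encjs pd') (VPair (VNum (int k')) (encjs Q'))) ((length pd + 1) * (50 * (length pd + length Q + 2) + 50))"
proof (induction t pd k Q rule: arrive.induct)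
  case (1 t k Q)
  then show ?case by (intro runsI[of "[]"]) (simp_all add: arrive_code_def)
next
  case (2 t j pd k Q)
  have js: "okj M j" "int_size (jrel j) \<le> M" using 2(4) by (auto simp: okj_def)
  have k: "int_size (int k) \<le> M" using int_size_mono[of "int k" "int (k + length (j # pd))"] 2(5) by simp
  show ?case
  proof (cases "t < jrel j")
    case True
    then show ?thesis using 2 js
      by (intro runsI[of "[]"]) (auto simp add: arrive_code_def encj_def[of j])
  next
    case False
    let ?K = "(length pd + 1) * (50 * (length pd + length (insQ j Q) + 2) + 50)"
    let ?C = "[((1, VPair (encj j) (encjs Q)), (encjs (insQ j Q), 50 * (length Q + 1))),
       ((4, VPair (VNum t) (VPair (encjs pd) (VPair (VNum (int (Suc k))) (encjs (insQ j Q))))),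
         (VPair (encjs pd') (VPair (VNum (int k')) (encjs Q')), ?K))]"
    show ?thesis
    proof (rule runsI[of ?C])
      have "runs prog M [VPair (VNum t) (VPair (encjs pd) (VPair (VNum (int (Suc k))) (encjs (insQ j Q))))] arrive_code
         (VPair (encjs pd') (VPair (VNum (int k')) (encjs Q'))) ?K"
        using 2(2-6) False by (intro 2(1)) (auto simp: add_ac)
      then show "\<forall>((f, v), (w, k))\<in>set ?C. f < length prog \<and> runs prog M [v] (prog ! f) w k"
        using 2(4) insQ_runs[of M j Q] js by simp
      have "(50 * (length Q + 1)) + ?K + 50 \<le> (length (j # pd) + 1) * (50 * (length (j # pd) + length Q + 2) + 50)"
        by (simp add: algebra_simps)
      then show "case ev ?C M [VPair (VNum t) (VPair (encjs (j # pd)) (VPair (VNum (int k)) (encjs Q)))] arrive_code of None \<Rightarrow> False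
        | Some (w', k'') \<Rightarrow> w' = VPair (encjs pd') (VPair (VNum (int k')) (encjs Q')) \<and>
          k'' \<le> (length (j # pd) + 1) * (50 * (length (j # pd) + length Q + 2) + 50)"
        using False 2(3) js(2) k 2(6) by (simp add: arrive_code_def encj_def[of j] add.commute)
    qed
  qed
qed

text \<open>A killed job passes from \<open>X\<close> to \<open>Z\<close>, so
  \<open>length X + length Z\<close> never grows and every insertion has the same bound.\<close>

lemma purge_runs:
  "purge B t k X Y fr Z out = (X', fr', Z', out') \<Longrightarrow> int_size t \<le> M \<Longrightarrow> int_size (int k) \<le> M \<Longrightarrow> int_size (int B) \<le> M \<Longrightarrow>
   (\<forall>x\<in>set X. oke M x) \<Longrightarrow> (\<forall>z\<in>set Z. okj M z) \<Longrightarrow> (\<forall>x\<in>set X. int_size (int (ek x + B)) \<le> M) \<Longrightarrow>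
   runs prog M [VPair (VPair (VNum (int B)) (VPair (VNum t) (VPair (VNum (int k)) (VNum D))))
       (VPair (ences X) (VPair (ences Y) (VPair (encns fr) (VPair (encjs Z) (encos D out)))))] purge_code
     (VPair (ences X') (VPair (encns fr') (VPair (encjs Z') (encos D out'))))
     ((length X + 1) * (50 * (length X + length Z + 1) + 250))"
proof (induction X arbitrary: Y fr Z out)
  case Nil
  then show ?case by (intro runsI[of "[]"]) (simp_all add: purge_code_def)
next
  case (Cons x X)
  note prems = Cons.prems
  let ?x = "VPair (VPair (VNum (int B)) (VPair (VNum t) (VPair (VNum (int k)) (VNum D))))"
  let ?arg = "\<lambda>X Y fr Z out. ?x (VPair (ences X) (VPair (ences Y) (VPair (encns fr) (VPair (encjs Z) (encos D out)))))"
  let ?res = "VPair (ences X') (VPair (encns fr') (VPair (encjs Z') (encos D out')))"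
  let ?o = "Or (jid (ejob x)) (emach x) (estart x) t"
  let ?T = "(length (x # X) + 1) * (50 * (length (x # X) + length Z + 1) + 250)"
  have xs: "oke M x" "okj M (ejob x)" "int_size (eend x) \<le> M" "int_size (int (ek x)) \<le> M" "int_size (int (ek x) + int B) \<le> M"
    using prems(5,7) by (auto simp: oke_def)
  consider "t < eend x" "k < ek x + B" | "t < eend x" "\<not> k < ek x + B" | "\<not> t < eend x" by blast
  then show ?case
  proof cases
    case 1
    let ?K = "(length X + 1) * (50 * (length X + length Z + 1) + 250)"
    let ?C = "[((5, ?arg X (x # Y) fr Z out), (?res, ?K))]"
    show ?thesis
    proof (rule runsI[of ?C])
      have "runs prog M [?arg X (x # Y) fr Z out] purge_code ?res ?K"
        using 1 prems by (intro Cons.IH) auto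
      then show "\<forall>((f, v), (w, k))\<in>set ?C. f < length prog \<and> runs prog M [v] (prog ! f) w k" by simp
      have "?K + 200 \<le> ?T" by (simp add: algebra_simps)
      moreover have "int k < int (ek x) + int B" using 1 by simp
      ultimately show "case ev ?C M [?arg (x # X) Y fr Z out] purge_code of None \<Rightarrow> False
        | Some (w', k') \<Rightarrow> w' = ?res \<and> k' \<le> ?T"
        using 1 prems(2-4) xs by (simp add: purge_code_def ence_def[of x])
    qed
  next
    case 2
    let ?K = "(length X + 1) * (50 * (length X + length (insZ (ejob x) Z) + 1) + 250)"
    let ?C = "[((2, VPair (encj (ejob x)) (encjs Z)), (encjs (insZ (ejob x) Z), 50 * (length Z + 1))),
      ((5, ?arg X Y (emach x # fr) (insZ (ejob x) Z) (?o # out)), (?res, ?K))]"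
    show ?thesis
    proof (rule runsI[of ?C])
      have "runs prog M [?arg X Y (emach x # fr) (insZ (ejob x) Z) (?o # out)] purge_code ?res ?K"
        using 2 prems xs by (intro Cons.IH) auto
      then show "\<forall>((f, v), (w, k))\<in>set ?C. f < length prog \<and> runs prog M [v] (prog ! f) w k"
        using insZ_runs[of M "ejob x" Z] xs prems(6) by simp
      have "?K + 50 * (length Z + 1) + 200 \<le> ?T" by (simp add: algebra_simps)
      moreover have "\<not> int k < int (ek x) + int B" using 2 by simp
      ultimately show "case ev ?C M [?arg (x # X) Y fr Z out] purge_code of None \<Rightarrow> False
        | Some (w', k') \<Rightarrow> w' = ?res \<and> k' \<le> ?T"
        using 2 prems(2-4) xs by (simp add: purge_code_def ence_def[of x] encj_def[of "ejob x"] enco_def[of D ?o])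
    qed
  next
    case 3
    let ?K = "(length X + 1) * (50 * (length X + length Z + 1) + 250)"
    let ?C = "[((5, ?arg X Y (emach x # fr) Z (?o # out)), (?res, ?K))]"
    show ?thesis
    proof (rule runsI[of ?C])
      have "runs prog M [?arg X Y (emach x # fr) Z (?o # out)] purge_code ?res ?K"
        using 3 prems xs by (intro Cons.IH) auto
      then show "\<forall>((f, v), (w, k))\<in>set ?C. f < length prog \<and> runs prog M [v] (prog ! f) w k" by simp
      have "?K + 200 \<le> ?T" by (simp add: algebra_simps)
      then show "case ev ?C M [?arg (x # X) Y fr Z out] purge_code of None \<Rightarrow> False
        | Some (w', k') \<Rightarrow> w' = ?res \<and> k' \<le> ?T"
        using 3 prems(2-4) xs by (simp add: purge_code_def ence_def[of x] encj_def[of "ejob x"] enco_def[of D ?o])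
    qed
  qed
qed

lemma rejs_runs:
  "int_size (int (length X)) \<le> M \<Longrightarrow> 3 \<le> M \<Longrightarrow>
   runs prog M [ences X] rejs_code (VNum (int (rejs X))) (50 * (length X + 1))"
proof (induction X)
  case Nil
  then show ?case by (intro runsI[of "[]"]) (simp_all add: rejs_code_def)
next
  case (Cons x X)
  let ?C = "[((6, ences X), (VNum (int (rejs X)), 50 * (length X + 1)))]"
  have l: "int_size (int (length X)) \<le> M" using int_size_mono[of "int (length X)" "int (length (x # X))"] Cons.prems by simp
  have "rejs X \<le> length X" by (simp add: rejs_conv)
  then have r: "int_size (int (rejs X)) \<le> M" using int_size_mono[of "int (rejs X)" "int (length X)"] l by simp
  show ?case
  proof (rule runsI[of ?C])
    show "\<forall>((f, v), (w, k))\<in>set ?C. f < length prog \<and> runs prog M [v] (prog ! f) w k"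
      using Cons.IH[OF l Cons.prems(2)] by simp
    show "case ev ?C M [ences (x # X)] rejs_code of None \<Rightarrow> False
      | Some (w', k') \<Rightarrow> w' = VNum (int (rejs (x # X))) \<and> k' \<le> 50 * (length (x # X) + 1)"
      using Cons.prems r by (cases "erej x") (simp_all add: rejs_code_def ence_def[of x])
  qed
qed

text \<open>Restarts in progress are counted afresh whenever another one is considered. This linear
  cost is paid at most once per call, hence the quadratic total.\<close>

lemma fill_runs:
  "fill h t k fr Q Z X = (Q', Z', X', fr') \<Longrightarrow> int_size t \<le> M \<Longrightarrow> int_size (int h) \<le> M \<Longrightarrow>
   (\<forall>j\<in>set Q \<union> set Z. okj M j) \<Longrightarrow> int_size (int (length Q + length Z + length X)) \<le> M \<Longrightarrow> 3 \<le> M \<Longrightarrow>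
   runs prog M [VPair (VPair (VNum (int h)) (VPair (VNum t) (VNum (int k))))
       (VPair (encns fr) (VPair (encjs Q) (VPair (encjs Z) (ences X))))] fill_code
     (VPair (encjs Q') (VPair (encjs Z') (VPair (ences X') (encns fr'))))
     ((length Q + length Z + 1) * (50 * (length Q + length Z + length X + 1) + 250))"
proof (induction fr arbitrary: Q Z X)
  case Nil
  then show ?case by (intro runsI[of "[]"]) (simp_all add: fill_code_def)
next
  case (Cons f fr)
  note prems = Cons.prems
  let ?x = "VPair (VNum (int h)) (VPair (VNum t) (VNum (int k)))"
  let ?arg = "\<lambda>fr Q Z X. VPair ?x (VPair (encns fr) (VPair (encjs Q) (VPair (encjs Z) (ences X))))"
  let ?res = "VPair (encjs Q') (VPair (encjs Z') (VPair (ences X') (encns fr')))"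
  let ?T = "(length Q + length Z + 1) * (50 * (length Q + length Z + length X + 1) + 250)"
  show ?case
  proof (cases Q)
    case Q: (Cons q Q0)
    let ?e = "En q f t k False"
    let ?K = "(length Q0 + length Z + 1) * (50 * (length Q0 + length Z + length (?e # X) + 1) + 250)"
    let ?C = "[((7, ?arg fr Q0 Z (?e # X)), (?res, ?K))]"
    have q: "int_size (jproc q) \<le> M" using prems(4) Q by (auto simp: okj_def)
    show ?thesis
    proof (rule runsI[of ?C])
      have "runs prog M [?arg fr Q0 Z (?e # X)] fill_code ?res ?K"
        using prems Q by (intro Cons.IH) auto
      then show "\<forall>((f, v), (w, k))\<in>set ?C. f < length prog \<and> runs prog M [v] (prog ! f) w k" by simp
      have "?K + 200 \<le> ?T" by (simp add: Q algebra_simps)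
      then show "case ev ?C M [?arg (f # fr) Q Z X] fill_code of None \<Rightarrow> False
        | Some (w', k') \<Rightarrow> w' = ?res \<and> k' \<le> ?T"
        using prems(2,6) q by (simp add: Q fill_code_def new_ent_code_def ence_def[of ?e] encj_def[of q] eend_def)
    qed
  next
    case Q: Nil
    show ?thesis
    proof (cases Z)
      case Z: (Cons z Z0)
      have rl: "runs prog M [ences X] rejs_code (VNum (int (rejs X))) (50 * (length X + 1))"
        using prems(5,6) int_size_mono[of "int (length X)" "int (length Q + length Z + length X)"] by (intro rejs_runs) auto
      have "rejs X \<le> length X" by (simp add: rejs_conv)
      then have r: "int_size (int (rejs X)) \<le> M"
        using int_size_mono[of "int (rejs X)" "int (length Q + length Z + length X)"] prems(5) by simp
      let ?e = "En z f t k True"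
      let ?K = "(length Z0 + 1) * (50 * (length Z0 + length (?e # X) + 1) + 250)"
      have q: "int_size (jproc z) \<le> M" using prems(4) Z by (auto simp: okj_def)
      show ?thesis
      proof (cases "rejs X < h")
        case True
        let ?C = "[((6, ences X), (VNum (int (rejs X)), 50 * (length X + 1))), ((7, ?arg fr [] Z0 (?e # X)), (?res, ?K))]"
        show ?thesis
        proof (rule runsI[of ?C])
          have "runs prog M [?arg fr [] Z0 (?e # X)] fill_code ?res ?K"
            using Cons.IH[of "[]" Z0 "?e # X"] prems Q Z True by auto
          then show "\<forall>((f, v), (w, k))\<in>set ?C. f < length prog \<and> runs prog M [v] (prog ! f) w k" using rl by simp
          have "?K + 50 * (length X + 1) + 200 \<le> ?T" by (simp add: Q Z algebra_simps)
          then show "case ev ?C M [?arg (f # fr) Q Z X] fill_code of None \<Rightarrow> False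
            | Some (w', k') \<Rightarrow> w' = ?res \<and> k' \<le> ?T"
            using prems(2,3,6) q r True
            by (simp add: Q Z fill_code_def new_ent_code_def ence_def[of ?e] encj_def[of z] eend_def)
        qed
      next
        case False
        let ?C = "[((6, ences X), (VNum (int (rejs X)), 50 * (length X + 1)))]"
        show ?thesis
        proof (rule runsI[of ?C])
          show "\<forall>((f, v), (w, k))\<in>set ?C. f < length prog \<and> runs prog M [v] (prog ! f) w k" using rl by simp
          have "50 * (length X + 1) + 200 \<le> ?T" by (simp add: Q Z algebra_simps)
          moreover have "Q' = []" "Z' = Z" "X' = X" "fr' = f # fr" using prems(1) Q Z False by auto
          ultimately show "case ev ?C M [?arg (f # fr) Q Z X] fill_code of None \<Rightarrow> False
            | Some (w', k') \<Rightarrow> w' = ?res \<and> k' \<le> ?T"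
            using prems(2,3,6) q r False
            by (simp add: Q Z fill_code_def)
        qed
      qed
    next
      case Z: Nil
      then show ?thesis using prems(1) Q by (intro runsI[of "[]"]) (auto simp: fill_code_def)
    qed
  qed
qed

section \<open>Growth of the numbers during the simulation\<close>

lemma arrive_set:
  "arrive t pd k Q = (pd', k', Q') \<Longrightarrow> set pd' \<union> set Q' = set pd \<union> set Q \<and>
     length pd' + length Q' = length pd + length Q \<and> k' + length pd' = k + length pd"
  by (induction t pd k Q rule: arrive.induct) (auto split: if_splits)

lemma purge_set:
  "purge B t k X Y fr Z out = (X', fr', Z', out') \<Longrightarrow> set X' \<subseteq> set X \<union> set Y \<and> set Z' \<subseteq> set Z \<union> ejob ` set X \<and>
     length X' + length Z' \<le> length X + length Y + length Z"
  by (induction B t k X Y fr Z out rule: purge.induct) (auto split: if_splits)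

lemma fill_set:
  "fill h t k fr Q Z X = (Q', Z', X', fr') \<Longrightarrow> set Q' \<subseteq> set Q \<and> set Z' \<subseteq> set Z \<and>
     (\<forall>x\<in>set X'. x \<in> set X \<or> (ejob x \<in> set Q \<union> set Z \<and> estart x = t \<and> ek x = k)) \<and>
     length Q' + length Z' + length X' = length Q + length Z + length X"
proof (induction h t k fr Q Z X rule: fill.induct)
  case (2 h t k f fr q Q Z X)
  then show ?case by (intro conjI) force+
next
  case (4 h t k f fr z Z X)
  then show ?case by (cases "rejs X < h") (simp_all, (intro conjI; force))
qed auto

text \<open>An event is a release, at most \<open>R\<close>, or the end of a run, at most
  \<open>R\<close> after its start. Hence the event times grow by at most \<open>R\<close> per step,
  and their bit length stays polynomial.\<close>

definition bounded_state :: "int \<Rightarrow> nat \<Rightarrow> nat \<Rightarrow> int state \<Rightarrow> bool" where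
  "bounded_state R n i \<sigma> \<longleftrightarrow>
    (\<forall>j\<in>set (pend \<sigma>) \<union> set (fq \<sigma>) \<union> set (rq \<sigma>) \<union> ejob ` set (running \<sigma>).
       0 \<le> jrel j \<and> jrel j \<le> R \<and> 0 \<le> jproc j \<and> jproc j \<le> R \<and> \<bar>jcls j\<bar> \<le> R) \<and>
    (\<forall>x\<in>set (running \<sigma>). 0 \<le> estart x \<and> estart x \<le> int i * R \<and> ek x \<le> n) \<and>
    relno \<sigma> + length (pend \<sigma>) \<le> n \<and>
    length (pend \<sigma>) + length (fq \<sigma>) + length (rq \<sigma>) + length (running \<sigma>) \<le> n"

definition encst :: "int \<Rightarrow> int state \<Rightarrow> val" where
  "encst D \<sigma> = VPair (encjs (pend \<sigma>)) (VPair (VNum (int (relno \<sigma>))) (VPair (encjs (fq \<sigma>)) (VPair (encjs (rq \<sigma>))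
     (VPair (ences (running \<sigma>)) (VPair (encns (free \<sigma>)) (encos D (outs \<sigma>)))))))"

lemma int_size_abs: "int_size a = int_size \<bar>a\<bar>"
  by (simp add: int_size_def)

lemma int_size_le: "\<bar>a\<bar> \<le> b \<Longrightarrow> int_size b \<le> M \<Longrightarrow> int_size a \<le> M"
  using int_size_mono[of "\<bar>a\<bar>" b] int_size_abs[of a] by simp

lemma step_runs:
  assumes bnd: "bounded_state R n i \<sigma>" and M: "int_size ((int i + 2) * R) \<le> M" "3 \<le> M"
    and R: "int n + int B + int h \<le> R" and i: "i \<le> N"
  shows "bounded_state R n (Suc i) (step B h \<sigma>) \<and>
    runs prog M [VPair (VPair (VNum (int B)) (VPair (VNum (int h)) (VNum D))) (encst D \<sigma>)] step_code
      (encst D (step B h \<sigma>)) (2000 * (n + 1) ^ 2)"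
proof -
  obtain pd k Q Z X fr out where \<sigma>: "\<sigma> = St pd k Q Z X fr out" by (cases \<sigma>)
  have R0: "0 \<le> R" using R by simp
  have bj: "0 \<le> jrel j" "jrel j \<le> R" "0 \<le> jproc j" "jproc j \<le> R" "\<bar>jcls j\<bar> \<le> R"
    if "j \<in> set pd \<union> set Q \<union> set Z \<union> ejob ` set X" for j using bnd that by (auto simp: bounded_state_def \<sigma>)
  have bx: "0 \<le> estart x" "estart x \<le> int i * R" "ek x \<le> n" if "x \<in> set X" for x
    using bnd that by (auto simp: bounded_state_def \<sigma>)
  have len: "k + length pd \<le> n" "length pd + length Q + length Z + length X \<le> n"
    using bnd by (auto simp: bounded_state_def \<sigma>)
  have RM: "R \<le> (int i + 2) * R" using R0 by (simp add: algebra_simps)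
  have small: "int_size a \<le> M" if "\<bar>a\<bar> \<le> (int i + 2) * R" for a by (rule int_size_le[OF that M(1)])
  have smallR: "int_size a \<le> M" if "\<bar>a\<bar> \<le> R" for a using that RM by (intro small) simp
  have ok: "okj M j" if "j \<in> set pd \<union> set Q \<union> set Z \<union> ejob ` set X" for j
    unfolding okj_def using bj[OF that] by (auto intro!: smallR)
  have ee: "0 \<le> eend x" "eend x \<le> (int i + 1) * R" if "x \<in> set X" for x
    using bx[OF that] bj[of "ejob x"] that by (auto simp: eend_def algebra_simps)
  have oke: "oke M x" if "x \<in> set X" for x
  proof -
    have "(int i + 1) * R \<le> (int i + 2) * R" "int i * R \<le> (int i + 2) * R" using R0 by (simp_all add: algebra_simps)
    moreover have "\<bar>int (ek x)\<bar> \<le> R" using bx(3)[OF that] R by simp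
    ultimately have "int_size (estart x) \<le> M" "int_size (eend x) \<le> M" "int_size (int (ek x)) \<le> M"
      using bx[OF that] ee[OF that] by (auto intro: small smallR)
    then show ?thesis unfolding oke_def using ok[of "ejob x"] that by simp
  qed
  show ?thesis
  proof (cases "pd = [] \<and> X = []")
    case True
    have "int i * R \<le> int (Suc i) * R" using R0 by (simp add: algebra_simps)
    then have "bounded_state R n (Suc i) \<sigma>" using bnd by (force simp: bounded_state_def)
    moreover have "step B h \<sigma> = \<sigma>" using True by (simp add: \<sigma>)
    moreover have "runs prog M [VPair (VPair (VNum (int B)) (VPair (VNum (int h)) (VNum D))) (encst D \<sigma>)] step_code
      (encst D \<sigma>) (2000 * (n + 1) ^ 2)"
      using True M(2) by (intro runsI[of "[]"]) (simp_all add: step_code_def encst_def \<sigma> power2_eq_square)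
    ultimately show ?thesis by simp
  next
    case ne: False
    define t where "t = next_time pd X"
    have t: "0 \<le> t" "t \<le> (int i + 1) * R"
    proof -
      have "(\<exists>x\<in>set X. t = eend x) \<or> (pd \<noteq> [] \<and> t = jrel (hd pd))"
        unfolding t_def using ne by (intro next_time_in) auto
      moreover have "R \<le> (int i + 1) * R" using R0 by (simp add: algebra_simps)
      ultimately show "0 \<le> t" "t \<le> (int i + 1) * R" using ee bj(1,2)[of "hd pd"] by fastforce+
    qed
    have tM: "int_size t \<le> M" using t R0 by (intro small) (simp add: algebra_simps)
    obtain pd' k' Q1 where ar: "arrive t pd k Q = (pd', k', Q1)" by (metis prod_cases3)
    obtain X1 fr1 Z1 out' where pu: "purge B t k' X [] fr Z out = (X1, fr1, Z1, out')" by (metis prod_cases4)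
    obtain Q' Z' X' fr' where fi: "fill h t k' fr1 Q1 Z1 X1 = (Q', Z', X', fr')" by (metis prod_cases4)
    have eq: "step B h \<sigma> = St pd' k' Q' Z' X' fr' out'"
      unfolding \<sigma> step.simps if_not_P[OF ne] by (simp add: t_def[symmetric] ar pu fi Let_def)
    note A = arrive_set[OF ar] and P = purge_set[OF pu] and F = fill_set[OF fi]
    have k'n: "k' \<le> n" using A len by linarith
    have sub: "set pd' \<union> set Q1 \<union> set Z1 \<union> ejob ` set X1 \<subseteq> set pd \<union> set Q \<union> set Z \<union> ejob ` set X"
      using A P by auto
    have sub': "set pd' \<union> set Q' \<union> set Z' \<union> ejob ` set X' \<subseteq> set pd' \<union> set Q1 \<union> set Z1 \<union> ejob ` set X1"
      using F by auto
    have "bounded_state R n (Suc i) (step B h \<sigma>)"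
      unfolding bounded_state_def eq state.sel
    proof (intro conjI ballI)
      fix j assume "j \<in> set pd' \<union> set Q' \<union> set Z' \<union> ejob ` set X'"
      then have "j \<in> set pd \<union> set Q \<union> set Z \<union> ejob ` set X" using sub sub' by blast
      then show "0 \<le> jrel j" "jrel j \<le> R" "0 \<le> jproc j" "jproc j \<le> R" "\<bar>jcls j\<bar> \<le> R" by (fact bj)+
    next
      fix x assume "x \<in> set X'"
      then have "x \<in> set X1 \<or> estart x = t \<and> ek x = k'" using F by blast
      then consider "x \<in> set X" | "estart x = t" "ek x = k'" using P by auto
      then have "0 \<le> estart x \<and> estart x \<le> int (Suc i) * R \<and> ek x \<le> n"
      proof cases
        case 1
        then show ?thesis using bx[OF 1] R0 by (auto simp: algebra_simps)
      next
        case 2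
        then show ?thesis using t k'n by (simp add: algebra_simps)
      qed
      then show "0 \<le> estart x" "estart x \<le> int (Suc i) * R" "ek x \<le> n" by auto
    next
      show "k' + length pd' \<le> n" using A len by linarith
      show "length pd' + length Q' + length Z' + length X' \<le> n" using A P F len by simp
    qed
    moreover have "runs prog M [VPair (VPair (VNum (int B)) (VPair (VNum (int h)) (VNum D))) (encst D \<sigma>)] step_code
      (encst D (step B h \<sigma>)) (2000 * (n + 1) ^ 2)"
    proof -
      let ?ar = "VPair (VNum t) (VPair (encjs pd) (VPair (VNum (int k)) (encjs Q)))"
      let ?pu = "VPair (VPair (VNum (int B)) (VPair (VNum t) (VPair (VNum (int k')) (VNum D))))
       (VPair (ences X) (VPair (ences []) (VPair (encns fr) (VPair (encjs Z) (encos D out)))))"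
      let ?fi = "VPair (VPair (VNum (int h)) (VPair (VNum t) (VNum (int k'))))
       (VPair (encns fr1) (VPair (encjs Q1) (VPair (encjs Z1) (ences X1))))"
      let ?t0 = "if pd = [] then eend (hd X) else jrel (hd pd)"
      have tt: "t = min_end ?t0 X" by (cases pd) (simp_all add: t_def)
      define L where "L = n + 1"
      have r3: "runs prog M [VPair (VNum ?t0) (ences X)] min_end_code (VNum t) (50 * L)"
      proof -
        have "int_size ?t0 \<le> M" using ne ok[of "hd pd"] oke[of "hd X"] by (auto simp: okj_def oke_def)
        then have "runs prog M [VPair (VNum ?t0) (ences X)] min_end_code (VNum t) (50 * (length X + 1))"
          unfolding tt using oke by (intro min_end_runs) auto
        moreover have "50 * (length X + 1) \<le> 50 * L" using len by (simp add: L_def)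
        ultimately show ?thesis by (rule runs_mono)
      qed
      have r4: "runs prog M [?ar] arrive_code (VPair (encjs pd') (VPair (VNum (int k')) (encjs Q1))) (L * (50 * (L + 1) + 50))"
      proof -
        have "runs prog M [?ar] arrive_code (VPair (encjs pd') (VPair (VNum (int k')) (encjs Q1)))
            ((length pd + 1) * (50 * (length pd + length Q + 2) + 50))"
          using ar tM ok len R M(2) by (intro arrive_runs) (auto intro!: smallR)
        moreover have "(length pd + 1) * (50 * (length pd + length Q + 2) + 50) \<le> L * (50 * (L + 1) + 50)"
          using len by (intro mult_mono) (auto simp: L_def)
        ultimately show ?thesis by (rule runs_mono)
      qed
      have r5: "runs prog M [?pu] purge_code (VPair (ences X1) (VPair (encns fr1) (VPair (encjs Z1) (encos D out'))))
          (L * (50 * L + 250))"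
      proof -
        have "int_size (int (ek x + B)) \<le> M" if "x \<in> set X" for x
          using bx(3)[OF that] R by (intro smallR) simp
        then have "runs prog M [?pu] purge_code (VPair (ences X1) (VPair (encns fr1) (VPair (encjs Z1) (encos D out'))))
            ((length X + 1) * (50 * (length X + length Z + 1) + 250))"
          using pu tM ok oke k'n R by (intro purge_runs) (auto intro!: smallR)
        moreover have "(length X + 1) * (50 * (length X + length Z + 1) + 250) \<le> L * (50 * L + 250)"
          using len by (intro mult_mono) (auto simp: L_def)
        ultimately show ?thesis by (rule runs_mono)
      qed
      have r7: "runs prog M [?fi] fill_code (VPair (encjs Q') (VPair (encjs Z') (VPair (ences X') (encns fr'))))
          (L * (50 * L + 250))"
      proof -
        have le: "length Q1 + length Z1 + length X1 \<le> n" using A P len by simp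
        have "okj M j" if "j \<in> set Q1 \<union> set Z1" for j using ok sub that by blast
        then have "runs prog M [?fi] fill_code (VPair (encjs Q') (VPair (encjs Z') (VPair (ences X') (encns fr'))))
            ((length Q1 + length Z1 + 1) * (50 * (length Q1 + length Z1 + length X1 + 1) + 250))"
          using fi tM le R M(2) by (intro fill_runs) (auto intro!: smallR)
        moreover have "(length Q1 + length Z1 + 1) * (50 * (length Q1 + length Z1 + length X1 + 1) + 250) \<le> L * (50 * L + 250)"
          using le by (intro mult_mono) (auto simp: L_def)
        ultimately show ?thesis by (rule runs_mono)
      qed
      let ?C = "[((3, VPair (VNum ?t0) (ences X)), (VNum t, 50 * L)),
        ((4, ?ar), (VPair (encjs pd') (VPair (VNum (int k')) (encjs Q1)), L * (50 * (L + 1) + 50))),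
        ((5, ?pu), (VPair (ences X1) (VPair (encns fr1) (VPair (encjs Z1) (encos D out'))), L * (50 * L + 250))),
        ((7, ?fi), (VPair (encjs Q') (VPair (encjs Z') (VPair (ences X') (encns fr'))), L * (50 * L + 250)))]"
      show ?thesis
      proof (rule runsI[of ?C])
        show "\<forall>((f, v), (w, k))\<in>set ?C. f < length prog \<and> runs prog M [v] (prog ! f) w k"
          using r3 r4 r5 r7 by simp
        have "L \<le> L * L" "1 \<le> L" unfolding L_def by simp_all
        moreover have "50 * L + L * (50 * (L + 1) + 50) + L * (50 * L + 250) + L * (50 * L + 250) = 150 * (L * L) + 650 * L"
          by (simp add: algebra_simps)
        ultimately have cost: "50 * L + L * (50 * (L + 1) + 50) + L * (50 * L + 250) + L * (50 * L + 250) + 200 \<le> 2000 * (n + 1) ^ 2"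
          unfolding L_def[symmetric] power2_eq_square by linarith
        show "case ev ?C M [VPair (VPair (VNum (int B)) (VPair (VNum (int h)) (VNum D))) (encst D \<sigma>)] step_code of None \<Rightarrow> False
          | Some (w', k'') \<Rightarrow> w' = encst D (step B h \<sigma>) \<and> k'' \<le> 2000 * (n + 1) ^ 2"
        proof (cases pd)
          case Nil
          then obtain x X0 where X: "X = x # X0" using ne by (cases X) auto
          show ?thesis unfolding eq using cost M(2)
            by (simp add: Nil X step_code_def encst_def \<sigma> encj_def[of "ejob x"] ence_def[of x])
        next
          case (Cons j pd0)
          show ?thesis unfolding eq using cost M(2)
            by (cases X) (simp_all add: Cons step_code_def encst_def \<sigma> encj_def[of j])
        qed
      qed
    qed
    ultimately show ?thesis by simp
  qed
qed

lemma loop_runs: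
  assumes R: "int n + int B + int h \<le> R" and "3 \<le> M"
  shows "bounded_state R n i \<sigma> \<Longrightarrow> int_size ((int i + int N + 2) * R) \<le> M \<Longrightarrow> int_size (int N) \<le> M \<Longrightarrow>
    runs prog M [VPair (VNum (int N)) (VPair (VPair (VNum (int B)) (VPair (VNum (int h)) (VNum D))) (encst D \<sigma>))] loop_code
      (encst D (loop B h N \<sigma>)) ((N + 1) * (2000 * (n + 1) ^ 2 + 50))"
proof (induction N arbitrary: i \<sigma>)
  case 0
  then show ?case using assms by (intro runsI[of "[]"]) (simp_all add: loop_code_def)
next
  case (Suc N)
  have R0: "0 \<le> R" using R by simp
  have M1: "int_size ((int i + 2) * R) \<le> M"
    using Suc.prems(2) R0 by (rule_tac int_size_le[rotated]) (auto simp: mult_right_mono)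
  have M2: "int_size (int N) \<le> M" using Suc.prems(3) by (rule_tac int_size_le[rotated]) auto
  note S = step_runs[OF Suc.prems(1) M1 assms(2) R order_refl, of D]
  let ?c = "VPair (VNum (int B)) (VPair (VNum (int h)) (VNum D))"
  let ?C = "[((8, VPair ?c (encst D \<sigma>)), (encst D (step B h \<sigma>), 2000 * (n + 1) ^ 2)),
    ((9, VPair (VNum (int N)) (VPair ?c (encst D (step B h \<sigma>)))), (encst D (loop B h N (step B h \<sigma>)), (N + 1) * (2000 * (n + 1) ^ 2 + 50)))]"
  show ?case
  proof (rule runsI[of ?C])
    have "runs prog M [VPair (VNum (int N)) (VPair ?c (encst D (step B h \<sigma>)))] loop_code
        (encst D (loop B h N (step B h \<sigma>))) ((N + 1) * (2000 * (n + 1) ^ 2 + 50))"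
      using S Suc.prems(2) M2 by (intro Suc.IH[of "Suc i"]) (auto simp: algebra_simps)
    then show "\<forall>((f, v), (w, k))\<in>set ?C. f < length prog \<and> runs prog M [v] (prog ! f) w k"
      using S by simp
    show "case ev ?C M [VPair (VNum (int (Suc N))) (VPair ?c (encst D \<sigma>))] loop_code of None \<Rightarrow> False
      | Some (w', k') \<Rightarrow> w' = encst D (loop B h (Suc N) \<sigma>) \<and> k' \<le> (Suc N + 1) * (2000 * (n + 1) ^ 2 + 50)"
      using assms(2) Suc.prems(3) by (simp add: loop_code_def algebra_simps)
  qed
qed

section \<open>Polynomial running time\<close>

text \<open>The simulation uses times only in sums and comparisons, so an additive order embedding
  commutes with every part of it. It is applied to division by the common denominator.\<close>

locale time_embedding =
  fixes f :: "int \<Rightarrow> real"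
  assumes add: "f (x + y) = f x + f y" and less: "f x < f y \<longleftrightarrow> x < y"
begin

lemma sel_map [simp]:
  "jid (map_jrec f j) = jid j" "jrel (map_jrec f j) = f (jrel j)" "jproc (map_jrec f j) = f (jproc j)"
  "jcls (map_jrec f j) = jcls j" "ejob (map_ent f x) = map_jrec f (ejob x)" "emach (map_ent f x) = emach x"
  "estart (map_ent f x) = f (estart x)" "ek (map_ent f x) = ek x" "erej (map_ent f x) = erej x"
  by (simp_all add: jrec.map_sel ent.map_sel)

lemma eend_map [simp]: "eend (map_ent f x) = f (eend x)"
  by (simp add: eend_def add)

lemma insQ_map: "insQ (map_jrec f j) (map (map_jrec f) Q) = map (map_jrec f) (insQ j Q)"
  by (induction Q) auto

lemma insZ_map: "insZ (map_jrec f j) (map (map_jrec f) Q) = map (map_jrec f) (insZ j Q)"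
  by (induction Q) (auto simp: less)

lemma min_end_map: "min_end (f t) (map (map_ent f) X) = f (min_end t X)"
  by (induction X arbitrary: t) (auto simp: less)

lemma next_time_map:
  "\<not> (pd = [] \<and> X = []) \<Longrightarrow> next_time (map (map_jrec f) pd) (map (map_ent f) X) = f (next_time pd X)"
proof (cases pd)
  case Nil
  assume "\<not> (pd = [] \<and> X = [])"
  with Nil have "hd (map (map_ent f) X) = map_ent f (hd X)" by (simp add: hd_map)
  then show ?thesis using Nil min_end_map[of "eend (hd X)" X] by simp
next
  case (Cons j pd')
  then show ?thesis using min_end_map[of "jrel j" X] by simp
qed

lemma arrive_map:
  "arrive (f t) (map (map_jrec f) pd) k (map (map_jrec f) Q) =
     (case arrive t pd k Q of (pd', k', Q') \<Rightarrow> (map (map_jrec f) pd', k', map (map_jrec f) Q'))"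
  by (induction t pd k Q rule: arrive.induct) (auto simp: less insQ_map)

lemma purge_map:
  "purge B (f t) k (map (map_ent f) X) (map (map_ent f) Y) fr (map (map_jrec f) Z) (map (map_orun f) out) =
     (case purge B t k X Y fr Z out of (X', fr', Z', out') \<Rightarrow>
        (map (map_ent f) X', fr', map (map_jrec f) Z', map (map_orun f) out'))"
proof (induction B t k X Y fr Z out rule: purge.induct)
  case (2 B t k x X Y fr Z out)
  consider "t < eend x" "k < ek x + B" | "t < eend x" "\<not> k < ek x + B" | "\<not> t < eend x" by blast
  then show ?case
  proof cases
    case 1
    then show ?thesis using 2(1) by (simp add: less)
  next
    case c: 2
    then show ?thesis using 2(2) by (simp add: less insZ_map)
  next
    case 3
    then show ?thesis using 2(3) by (simp add: less)
  qed
qed simp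

lemma rejs_map [simp]: "rejs (map (map_ent f) X) = rejs X"
  by (induction X) auto

lemma fill_map:
  "fill h (f t) k fr (map (map_jrec f) Q) (map (map_jrec f) Z) (map (map_ent f) X) =
     (case fill h t k fr Q Z X of (Q', Z', X', fr') \<Rightarrow>
        (map (map_jrec f) Q', map (map_jrec f) Z', map (map_ent f) X', fr'))"
  by (induction h t k fr Q Z X rule: fill.induct) auto

lemma step_map: "step B h (map_state f \<sigma>) = map_state f (step B h \<sigma>)"
proof (cases \<sigma>)
  case (St pd k Q Z X fr out)
  show ?thesis
  proof (cases "pd = [] \<and> X = []")
    case True
    then show ?thesis by (simp add: St)
  next
    case False
    then have F: "\<not> (map (map_jrec f) pd = [] \<and> map (map_ent f) X = [])" by simp
    show ?thesis
      unfolding St state.map step.simps if_not_P[OF False] if_not_P[OF F] next_time_map[OF False]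
      using purge_map[where Y = "[]"]
      by (simp add: Let_def arrive_map fill_map split: prod.split)
  qed
qed

lemma loop_map: "loop B h N (map_state f \<sigma>) = map_state f (loop B h N \<sigma>)"
  by (induction N arbitrary: \<sigma>) (simp_all add: step_map)

end

section \<open>Preparation of the input: base, classes, common denominator\<close>

lemma abs_less_int_size: "\<bar>a\<bar> < 2 ^ int_size a"
proof -
  have "nat \<bar>a\<bar> < 2 ^ floorlog 2 (nat \<bar>a\<bar>)" by (rule floorlog_leD) auto
  also have "\<dots> \<le> 2 ^ int_size a" by (simp add: int_size_def)
  finally have "int (nat \<bar>a\<bar>) < int (2 ^ int_size a)" by (simp only: of_nat_less_iff)
  then show ?thesis by simp
qed

lemma int_size_leI: "\<bar>a\<bar> < 2 ^ k \<Longrightarrow> int_size a \<le> Suc k"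
proof -
  assume "\<bar>a\<bar> < 2 ^ k"
  then have "nat \<bar>a\<bar> < 2 ^ k" by (simp add: nat_less_iff)
  then have "floorlog 2 (nat \<bar>a\<bar>) \<le> k" by (intro floorlog_leI) auto
  then show ?thesis by (simp add: int_size_def)
qed

lemma base_upper: "base n m \<le> n + 2"
  unfolding base_def by (rule Least_le) simp

text \<open>A linear search is good enough, because the base is at most \<open>n + 2\<close> and
  \<open>n\<close> itself enters the time bound.\<close>

lemma base_runs:
  assumes M: "int_size (int ((m + 1) * (n + 2)\<^sup>2)) \<le> M" and "3 \<le> M"
  shows "2 \<le> b \<Longrightarrow> b \<le> base n m \<Longrightarrow>
    runs prog M [VPair (VNum (int n)) (VPair (VNum (int m)) (VNum (int b)))] base_code (VNum (int (base n m)))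
      (100 * (base n m - b + 1))"
proof (induction "base n m - b" arbitrary: b rule: less_induct)
  case less
  have bn: "b \<le> n + 2" using less.prems base_upper[of n m] by simp
  have small: "int_size (int a) \<le> M" if "a \<le> (m + 1) * (n + 2)\<^sup>2" for a
    using that M int_size_mono[of "int a" "int ((m + 1) * (n + 2)\<^sup>2)"] by linarith
  have sq: "b * b \<le> (n + 2)\<^sup>2" "n + 2 \<le> (n + 2)\<^sup>2" using mult_mono[OF bn bn] by (simp_all add: power2_eq_square)
  have up: "x \<le> (m + 1) * (n + 2)\<^sup>2" if "x \<le> (n + 2)\<^sup>2" for x using that by simp
  have "m * (b * b) \<le> (m + 1) * (n + 2)\<^sup>2" using sq by (intro mult_mono) auto
  moreover have "m * 1 \<le> (m + 1) * (n + 2)\<^sup>2" by (intro mult_mono) auto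
  ultimately have ss: "int_size (int n) \<le> M" "int_size (int b) \<le> M" "int_size (int m) \<le> M" "int_size (int b * int b) \<le> M"
    "int_size (int m * (int b * int b)) \<le> M"
    using small[of n] small[of b] small[of m] small[of "b * b"] small[of "m * (b * b)"] up[of n] up[of b] up[of "b * b"] sq bn
    by auto
  let ?C = "[((10, VPair (VNum (int n)) (VPair (VNum (int m)) (VNum (int (b + 1))))), (VNum (int (base n m)), 100 * (base n m - (b + 1) + 1)))]"
  show ?case
  proof (cases "b = base n m")
    case True
    show ?thesis
    proof (cases "n < b")
      case nb: True
      then show ?thesis using ss True by (intro runsI[of "[]"]) (simp_all add: base_code_def)
    next
      case nb: False
      then have "n \<le> m * (b * b)" using base_spec(2)[of n m] True by (simp add: power2_eq_square)
      then have "int n \<le> int m * (int b * int b)" by (metis of_nat_le_iff of_nat_mult)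
      then show ?thesis using nb ss True by (intro runsI[of "[]"]) (simp_all add: base_code_def)
    qed
  next
    case False
    then have lt: "b < base n m" using less.prems by simp
    have "\<not> (2 \<le> b \<and> (n < b \<or> n \<le> m * b\<^sup>2))"
      using not_less_Least[of b "\<lambda>b. 2 \<le> b \<and> (n < b \<or> n \<le> m * b\<^sup>2)"] lt by (simp add: base_def)
    then have nb: "\<not> n < b" "m * (b * b) < n" using less.prems by (auto simp: power2_eq_square)
    then have nb': "int m * (int b * int b) < int n" by (metis of_nat_less_iff of_nat_mult)
    show ?thesis
    proof (rule runsI[of ?C])
      show "\<forall>((f, v), (w, k))\<in>set ?C. f < length prog \<and> runs prog M [v] (prog ! f) w k"
        using less.hyps[of "b + 1"] lt less.prems by simp
      show "case ev ?C M [VPair (VNum (int n)) (VPair (VNum (int m)) (VNum (int b)))] base_code of None \<Rightarrow> False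
        | Some (w', k') \<Rightarrow> w' = VNum (int (base n m)) \<and> k' \<le> 100 * (base n m - b + 1)"
        using nb nb' ss lt assms(2) by (simp add: base_code_def add.commute)
    qed
  qed
qed

lemma upto_runs:
  "int_size (int k) \<le> M \<Longrightarrow> 3 \<le> M \<Longrightarrow> runs prog M [VNum (int k)] upto_code (encns (rev [0..<k])) (50 * (k + 1))"
proof (induction k)
  case 0
  then show ?case by (intro runsI[of "[]"]) (simp_all add: upto_code_def)
next
  case (Suc k)
  have "int_size (int k) \<le> M" using int_size_mono[of "int k" "int (Suc k)"] Suc.prems by simp
  note IH = Suc.IH[OF this Suc.prems(2)]
  let ?C = "[((11, VNum (int k)), (encns (rev [0..<k]), 50 * (k + 1)))]"
  show ?case
  proof (rule runsI[of ?C])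
    show "\<forall>((f, v), (w, k))\<in>set ?C. f < length prog \<and> runs prog M [v] (prog ! f) w k" using IH by simp
    show "case ev ?C M [VNum (int (Suc k))] upto_code of None \<Rightarrow> False
      | Some (w', k') \<Rightarrow> w' = encns (rev [0..<Suc k]) \<and> k' \<le> 50 * (Suc k + 1)"
      using Suc.prems by (simp add: upto_code_def)
  qed
qed

lemma cls_mult:
  assumes "2 \<le> \<beta>" "0 < x"
  shows "cls \<beta> (x * real \<beta>) = cls \<beta> x + 1"
proof -
  have "log \<beta> (x * real \<beta>) = log \<beta> x + 1" using assms by (simp add: log_mult)
  then show ?thesis by (simp add: cls_def)
qed

text \<open>\<open>Y\<close> bounds all intermediate numbers. A numerator below the denominator
  grows to less than \<open>b * \<beta>\<close>; if instead the denominator has to grow, then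
  \<open>b * \<beta> \<le> a\<close>, so the disjunction yields \<open>a * \<beta> \<le> Y\<close>,
  which bounds the new products. Each call brings the class of the quotient closer to 0 by
  one.\<close>

lemma cls_runs:
  assumes \<beta>: "2 \<le> \<beta>" and Y: "int_size Y \<le> M" and K: "int_size K \<le> M" and M3: "3 \<le> M"
  shows "0 < a \<Longrightarrow> 0 < b \<Longrightarrow> a < b * int \<beta> \<or> a * int \<beta> \<le> Y \<Longrightarrow> a \<le> Y \<Longrightarrow> b * int \<beta> \<le> Y \<Longrightarrow>
    \<bar>c\<bar> + \<bar>cls \<beta> (real_of_int a / real_of_int b)\<bar> \<le> K \<Longrightarrow>
    runs prog M [VPair (VNum a) (VPair (VNum b) (VPair (VNum (int \<beta>)) (VNum c)))] cls_code
      (VNum (c + cls \<beta> (real_of_int a / real_of_int b))) (50 * (nat \<bar>cls \<beta> (real_of_int a / real_of_int b)\<bar> + 1))"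
proof (induction "nat \<bar>cls \<beta> (real_of_int a / real_of_int b)\<bar>" arbitrary: a b c rule: less_induct)
  case less
  note prems = less.prems
  define x where "x = real_of_int a / real_of_int b"
  have x0: "0 < x" using prems by (simp add: x_def)
  have b1: "1 * int \<beta> \<le> b * int \<beta>" "b * 1 \<le> b * int \<beta>" using prems(1,2) \<beta> by (intro mult_mono; simp)+
  have ss: "int_size a \<le> M" "int_size b \<le> M" "int_size (int \<beta>) \<le> M" "int_size (b * int \<beta>) \<le> M"
  proof -
    have "b \<le> Y" "int \<beta> \<le> Y" using b1 prems(5) by linarith+
    then show "int_size a \<le> M" "int_size b \<le> M" "int_size (int \<beta>) \<le> M" "int_size (b * int \<beta>) \<le> M"
      using prems(1,2,4,5) by (auto intro!: int_size_le[OF _ Y])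
  qed
  have cs: "int_size c \<le> M" using prems(6) by (intro int_size_le[OF _ K]) simp
  let ?arg = "\<lambda>a b c. VPair (VNum a) (VPair (VNum b) (VPair (VNum (int \<beta>)) (VNum c)))"
  consider "a < b" | "b \<le> a" "a < b * int \<beta>" | "b * int \<beta> \<le> a" by linarith
  then show ?case
  proof cases
    case 1
    have "x < 1" using 1 prems by (simp add: x_def)
    then have "log \<beta> x < 0" using x0 \<beta> by simp
    then have neg: "cls \<beta> x < 0" by (simp add: cls_def floor_less_iff)
    have eq: "cls \<beta> (real_of_int (a * int \<beta>) / real_of_int b) = cls \<beta> x + 1"
      using cls_mult[OF \<beta> x0] by (simp add: x_def)
    have 2: "a * int \<beta> < b * int \<beta>" using 1 \<beta> by (intro mult_strict_right_mono) auto
    let ?C = "[((12, ?arg (a * int \<beta>) b (c - 1)), (VNum (c + cls \<beta> x), 50 * (nat \<bar>cls \<beta> x + 1\<bar> + 1)))]"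
    have "runs prog M [?arg (a * int \<beta>) b (c - 1)] cls_code (VNum (c - 1 + cls \<beta> (real_of_int (a * int \<beta>) / real_of_int b)))
        (50 * (nat \<bar>cls \<beta> (real_of_int (a * int \<beta>) / real_of_int b)\<bar> + 1))"
    proof (rule less.hyps)
      show "nat \<bar>cls \<beta> (real_of_int (a * int \<beta>) / real_of_int b)\<bar> < nat \<bar>cls \<beta> (real_of_int a / real_of_int b)\<bar>"
        unfolding eq x_def[symmetric] using neg by simp
      show "\<bar>c - 1\<bar> + \<bar>cls \<beta> (real_of_int (a * int \<beta>) / real_of_int b)\<bar> \<le> K"
        unfolding eq using prems(6) neg by (simp add: x_def[symmetric])
    next
      show "a * int \<beta> \<le> Y" using 2 prems(5) by linarith
    qed (use prems 2 \<beta> in auto)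
    then have IH: "runs prog M [?arg (a * int \<beta>) b (c - 1)] cls_code (VNum (c + cls \<beta> x)) (50 * (nat \<bar>cls \<beta> x + 1\<bar> + 1))"
      unfolding eq by simp
    show ?thesis unfolding x_def[symmetric]
    proof (rule runsI[of ?C])
      show "\<forall>((f, v), (w, k))\<in>set ?C. f < length prog \<and> runs prog M [v] (prog ! f) w k" using IH by simp
      have "50 * (nat \<bar>cls \<beta> x + 1\<bar> + 1) + 50 \<le> 50 * (nat \<bar>cls \<beta> x\<bar> + 1)" using neg by simp
      then show "case ev ?C M [?arg a b c] cls_code of None \<Rightarrow> False
        | Some (w', k') \<Rightarrow> w' = VNum (c + cls \<beta> x) \<and> k' \<le> 50 * (nat \<bar>cls \<beta> x\<bar> + 1)"
        using 1 ss cs M3 by (simp add: cls_code_def)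
    qed
  next
    case 2
    have "1 \<le> x" "x < \<beta>"
    proof -
      show "1 \<le> x" using 2 prems by (simp add: x_def)
      have "real_of_int a < real_of_int (b * int \<beta>)" using 2 by (simp only: of_int_less_iff)
      then show "x < \<beta>" using prems by (simp add: x_def field_simps)
    qed
    then have "0 \<le> log \<beta> x" "log \<beta> x < 1" using \<beta> by (simp_all add: log_less_one_cancel_iff)
    then have "cls \<beta> x = 0" by (simp add: cls_def floor_eq_iff)
    then show ?thesis unfolding x_def[symmetric] using 2 ss by (intro runsI[of "[]"]) (simp_all add: cls_code_def)
  next
    case 3
    have ba: "\<not> a < b" using 3 b1 by linarith
    have "real_of_int (b * int \<beta>) \<le> real_of_int a" using 3 by (simp only: of_int_le_iff)
    then have "\<beta> \<le> x" using prems by (simp add: x_def field_simps)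
    then have "1 \<le> log \<beta> x" using \<beta> x0 by (simp add: le_log_iff)
    then have pos: "1 \<le> cls \<beta> x" by (simp add: cls_def le_floor_iff)
    have "cls \<beta> x = cls \<beta> (real_of_int a / real_of_int (b * int \<beta>)) + 1"
      using cls_mult[OF \<beta>, of "real_of_int a / real_of_int (b * int \<beta>)"] prems \<beta> by (simp add: x_def)
    then have eq: "cls \<beta> (real_of_int a / real_of_int (b * int \<beta>)) = cls \<beta> x - 1" by simp
    have aY: "a * int \<beta> \<le> Y" using prems(3) 3 by linarith
    have "b * int \<beta> * int \<beta> \<le> a * int \<beta>" using 3 by (intro mult_right_mono) auto
    then have bY: "b * int \<beta> * int \<beta> \<le> Y" using aY by simp
    let ?C = "[((12, ?arg a (b * int \<beta>) (c + 1)), (VNum (c + cls \<beta> x), 50 * (nat \<bar>cls \<beta> x - 1\<bar> + 1)))]"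
    have "runs prog M [?arg a (b * int \<beta>) (c + 1)] cls_code (VNum (c + 1 + cls \<beta> (real_of_int a / real_of_int (b * int \<beta>))))
        (50 * (nat \<bar>cls \<beta> (real_of_int a / real_of_int (b * int \<beta>))\<bar> + 1))"
    proof (rule less.hyps)
      show "nat \<bar>cls \<beta> (real_of_int a / real_of_int (b * int \<beta>))\<bar> < nat \<bar>cls \<beta> (real_of_int a / real_of_int b)\<bar>"
        unfolding eq x_def[symmetric] using pos by simp
      show "\<bar>c + 1\<bar> + \<bar>cls \<beta> (real_of_int a / real_of_int (b * int \<beta>))\<bar> \<le> K"
        unfolding eq using prems(6) pos by (simp add: x_def[symmetric])
    qed (use prems aY bY \<beta> in auto)
    then have IH: "runs prog M [?arg a (b * int \<beta>) (c + 1)] cls_code (VNum (c + cls \<beta> x)) (50 * (nat \<bar>cls \<beta> x - 1\<bar> + 1))"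
      unfolding eq by simp
    show ?thesis unfolding x_def[symmetric]
    proof (rule runsI[of ?C])
      show "\<forall>((f, v), (w, k))\<in>set ?C. f < length prog \<and> runs prog M [v] (prog ! f) w k" using IH by simp
      have "50 * (nat \<bar>cls \<beta> x - 1\<bar> + 1) + 50 \<le> 50 * (nat \<bar>cls \<beta> x\<bar> + 1)" using pos by simp
      then show "case ev ?C M [?arg a b c] cls_code of None \<Rightarrow> False
        | Some (w', k') \<Rightarrow> w' = VNum (c + cls \<beta> x) \<and> k' \<le> 50 * (nat \<bar>cls \<beta> x\<bar> + 1)"
        using 3 ba ss cs M3 by (simp add: cls_code_def)
    qed
  qed
qed

abbreviation "numer q \<equiv> fst (quotient_of q)"
abbreviation "denom q \<equiv> snd (quotient_of q)"

lemma denom_pos: "0 < denom q"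
  by (metis prod.collapse quotient_of_denom_pos)

lemma of_rat_quotient: "(of_rat q :: real) = real_of_int (numer q) / real_of_int (denom q)"
proof -
  have "q = of_int (numer q) / of_int (denom q)" by (rule quotient_of_div) simp
  then show ?thesis by (metis of_rat_divide of_rat_of_int_eq)
qed

lemma numer_nonneg: "0 \<le> q \<Longrightarrow> 0 \<le> numer q" and numer_pos: "0 < q \<Longrightarrow> 0 < numer q"
  using of_rat_quotient[of q] denom_pos[of q]
  by (metis less_eq_rat_def of_int_0_less_iff of_int_0_le_iff zero_le_of_rat_iff zero_less_of_rat_iff
      divide_le_0_iff linorder_not_le zero_le_divide_iff zero_less_divide_iff of_int_0_eq_iff less_imp_le)+

definition encin :: "rat job \<Rightarrow> val" where
  "encin x = VPair (rat_val (release x)) (rat_val (proc x))"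

fun common_denom :: "rat job list \<Rightarrow> int" where
  "common_denom [] = 1"
| "common_denom (x # L) = denom (release x) * (denom (proc x) * common_denom L)"

lemma common_denom_pos: "0 < common_denom L"
  by (induction L) (auto simp: denom_pos)

lemma common_denom_dvd: "x \<in> set L \<Longrightarrow> denom (release x) dvd common_denom L \<and> denom (proc x) dvd common_denom L"
  by (induction L) (auto intro: dvd_mult dvd_mult2)

lemma common_denom_runs:
  "int_size (common_denom L) \<le> M \<Longrightarrow> 3 \<le> M \<Longrightarrow>
    runs prog M [list_val (map encin L)] denom_code (VNum (common_denom L)) (50 * (length L + 1))"
proof (induction L)
  case Nil
  then show ?case by (intro runsI[of "[]"]) (simp_all add: denom_code_def)
next
  case (Cons x L)
  let ?d1 = "denom (release x)" and ?d2 = "denom (proc x)"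
  have pos: "1 \<le> ?d1" "1 \<le> ?d2" "1 \<le> common_denom L" using denom_pos common_denom_pos by (simp_all add: int_one_le_iff_zero_less)
  have le: "common_denom L \<le> ?d2 * common_denom L" "?d2 \<le> ?d2 * common_denom L"
    "?d2 * common_denom L \<le> common_denom (x # L)" "?d1 \<le> common_denom (x # L)"
    using pos mult_right_mono[of 1 ?d2 "common_denom L"] mult_left_mono[of 1 "common_denom L" ?d2]
      mult_right_mono[of 1 ?d1 "?d2 * common_denom L"] mult_left_mono[of 1 "?d2 * common_denom L" ?d1] mult_mono[of 1 ?d2 1 "common_denom L"]
    by auto
  have ss: "int_size (common_denom L) \<le> M" "int_size (?d2 * common_denom L) \<le> M" "int_size ?d1 \<le> M" "int_size ?d2 \<le> M"
  proof -
    have "common_denom L \<le> common_denom (x # L)" "?d2 \<le> common_denom (x # L)" "0 \<le> ?d2 * common_denom L"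
      using le pos by linarith+
    then show "int_size (common_denom L) \<le> M" "int_size (?d2 * common_denom L) \<le> M" "int_size ?d1 \<le> M" "int_size ?d2 \<le> M"
      using pos le(3,4) by (auto intro!: int_size_le[OF _ Cons.prems(1)] simp del: common_denom.simps)
  qed
  let ?C = "[((13, list_val (map encin L)), (VNum (common_denom L), 50 * (length L + 1)))]"
  show ?case
  proof (rule runsI[of ?C])
    show "\<forall>((f, v), (w, k))\<in>set ?C. f < length prog \<and> runs prog M [v] (prog ! f) w k" using Cons.IH ss Cons.prems by simp
    show "case ev ?C M [list_val (map encin (x # L))] denom_code of None \<Rightarrow> False
      | Some (w', k') \<Rightarrow> w' = VNum (common_denom (x # L)) \<and> k' \<le> 50 * (length (x # L) + 1)"
      using ss by (simp add: denom_code_def encin_def[of x] rat_val_def)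
  qed
qed

fun int_recs :: "nat \<Rightarrow> int \<Rightarrow> nat \<Rightarrow> rat job list \<Rightarrow> int jrec list" where
  "int_recs \<beta> D i [] = []"
| "int_recs \<beta> D i (x # L) = JR i (numer (release x) * D div denom (release x)) (numer (proc x) * D div denom (proc x))
     (cls \<beta> (of_rat (proc x))) # int_recs \<beta> D (Suc i) L"

lemma length_int_recs [simp]: "length (int_recs \<beta> D i L) = length L"
  by (induction L arbitrary: i) auto

lemma int_recs_runs:
  assumes \<beta>: "2 \<le> \<beta>" and M3: "3 \<le> M" and Y: "int_size Y \<le> M" and K: "int_size (int K) \<le> M" and D: "int_size D \<le> M"
  shows "(\<forall>x\<in>set L. 0 < proc x \<and> int_size (numer (release x)) \<le> M \<and> int_size (numer (release x) * D) \<le> M \<and>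
      int_size (denom (release x)) \<le> M \<and> int_size (numer (proc x) * D) \<le> M \<and> numer (proc x) * int \<beta> \<le> Y \<and>
      denom (proc x) * int \<beta> \<le> Y \<and> \<bar>cls \<beta> (of_rat (proc x))\<bar> \<le> int K) \<Longrightarrow> int_size (int (i + length L)) \<le> M \<Longrightarrow>
    runs prog M [VPair (VPair (VNum D) (VNum (int \<beta>))) (VPair (VNum (int i)) (list_val (map encin L)))] recs_code
      (encjs (int_recs \<beta> D i L)) ((length L + 1) * (50 * (K + 1) + 100))"
proof (induction L arbitrary: i)
  case Nil
  then show ?case using M3 by (intro runsI[of "[]"]) (simp_all add: recs_code_def)
next
  case (Cons x L)
  let ?a = "numer (proc x)" and ?b = "denom (proc x)" and ?c = "cls \<beta> (of_rat (proc x))"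
  have x: "0 < proc x" "int_size (numer (release x)) \<le> M" "int_size (numer (release x) * D) \<le> M"
      "int_size (denom (release x)) \<le> M" "int_size (?a * D) \<le> M" "?a * int \<beta> \<le> Y" "?b * int \<beta> \<le> Y" "\<bar>?c\<bar> \<le> int K"
    using Cons.prems(1) by auto
  have pos: "0 < ?a" "0 < ?b" using numer_pos[OF x(1)] denom_pos by auto
  have le: "?a * 1 \<le> ?a * int \<beta>" "?b * 1 \<le> ?b * int \<beta>" using pos \<beta> by (intro mult_left_mono; simp)+
  have aY: "?a \<le> Y" "?b \<le> Y" using le x(6,7) by linarith+
  have ss: "int_size ?a \<le> M" "int_size ?b \<le> M" using pos aY by (auto intro!: int_size_le[OF _ Y])
  have ii: "int_size (int i) \<le> M" using int_size_mono[of "int i" "int (i + length (x # L))"] Cons.prems(2) by simp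
  let ?cl = "VPair (VNum ?a) (VPair (VNum ?b) (VPair (VNum (int \<beta>)) (VNum 0)))"
  have rc: "runs prog M [?cl] cls_code (VNum ?c) (50 * (K + 1))"
  proof -
    have "runs prog M [?cl] cls_code (VNum (0 + cls \<beta> (real_of_int ?a / real_of_int ?b))) (50 * (nat \<bar>cls \<beta> (real_of_int ?a / real_of_int ?b)\<bar> + 1))"
      using x aY pos by (intro cls_runs[OF \<beta> Y K M3]) (auto simp: of_rat_quotient)
    moreover have "50 * (nat \<bar>?c\<bar> + 1) \<le> 50 * (K + 1)" using x(8) by simp
    ultimately show ?thesis unfolding of_rat_quotient[symmetric] add_0_left by (rule runs_mono)
  qed
  let ?h = "VPair (VNum D) (VNum (int \<beta>))"
  let ?C = "[((12, ?cl), (VNum ?c, 50 * (K + 1))),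
    ((14, VPair ?h (VPair (VNum (int (Suc i))) (list_val (map encin L)))), (encjs (int_recs \<beta> D (Suc i) L), (length L + 1) * (50 * (K + 1) + 100)))]"
  show ?case
  proof (rule runsI[of ?C])
    show "\<forall>((f, v), (w, k))\<in>set ?C. f < length prog \<and> runs prog M [v] (prog ! f) w k"
      using rc Cons.IH[of "Suc i"] Cons.prems by simp
    show "case ev ?C M [VPair ?h (VPair (VNum (int i)) (list_val (map encin (x # L))))] recs_code of None \<Rightarrow> False
      | Some (w', k') \<Rightarrow> w' = encjs (int_recs \<beta> D i (x # L)) \<and> k' \<le> (length (x # L) + 1) * (50 * (K + 1) + 100)"
      using ss ii x M3 D by (simp add: recs_code_def encin_def[of x] rat_val_def encj_def[of "JR _ _ _ _"] add.commute)
  qed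
qed

lemma nth_int_recs:
  "j < length L \<Longrightarrow> int_recs \<beta> D i L ! j = JR (i + j) (numer (release (L ! j)) * D div denom (release (L ! j)))
     (numer (proc (L ! j)) * D div denom (proc (L ! j))) (cls \<beta> (of_rat (proc (L ! j))))"
proof (induction L arbitrary: i j)
  case (Cons x L)
  then show ?case by (cases j) auto
qed simp

lemma scaled_numer:
  assumes "denom q dvd D" "0 < D"
  shows "real_of_int (numer q * D div denom q) / real_of_int D = of_rat q"
proof -
  obtain k where k: "D = denom q * k" using assms(1) by blast
  have "k \<noteq> 0" using assms(2) k by auto
  have "numer q * D div denom q = numer q * k" using denom_pos[of q] by (simp add: k mult.left_commute)
  then show ?thesis using \<open>k \<noteq> 0\<close> denom_pos[of q] k by (simp add: of_rat_quotient)
qed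

text \<open>Every denominator divides the common one, so the integer divisions are exact and the
  scaling is undone without loss. Classes are taken from the unscaled processing times and so need
  no correction.\<close>

lemma jrecs_int_recs:
  "jrecs \<beta> (map real_job L) =
     map (map_jrec (\<lambda>a. real_of_int a / real_of_int (common_denom L))) (int_recs \<beta> (common_denom L) 0 L)"
proof (rule nth_equalityI)
  fix j assume "j < length (jrecs \<beta> (map real_job L))"
  then have j: "j < length L" by simp
  have dv: "denom (release (L ! j)) dvd common_denom L" "denom (proc (L ! j)) dvd common_denom L"
    using common_denom_dvd[of "L ! j" L] j by auto
  show "jrecs \<beta> (map real_job L) ! j =
     map (map_jrec (\<lambda>a. real_of_int a / real_of_int (common_denom L))) (int_recs \<beta> (common_denom L) 0 L) ! j"
    using j scaled_numer[OF dv(1) common_denom_pos] scaled_numer[OF dv(2) common_denom_pos]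
    by (simp add: nth_int_recs real_job_def)
qed simp

lemma element_size: "x \<in> set L \<Longrightarrow> int_size (numer (release x)) \<le> val_size (list_val (map encin L)) \<and>
    int_size (denom (release x)) \<le> val_size (list_val (map encin L)) \<and> int_size (numer (proc x)) \<le> val_size (list_val (map encin L)) \<and>
    int_size (denom (proc x)) \<le> val_size (list_val (map encin L))"
  by (induction L) (auto simp: encin_def rat_val_def)

text \<open>Bit lengths of the factors add up, and the input contains every factor. This is why the
  product of the denominators is small enough.\<close>

lemma common_denom_less: "common_denom L < 2 ^ val_size (list_val (map encin L))"
proof (induction L)
  case (Cons x L)
  let ?d1 = "denom (release x)" and ?d2 = "denom (proc x)"
  have d: "?d1 < 2 ^ int_size ?d1" "?d2 < 2 ^ int_size ?d2"
    using abs_less_int_size[of ?d1] abs_less_int_size[of ?d2] denom_pos[of "release x"] denom_pos[of "proc x"] by auto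
  have "?d1 * (?d2 * common_denom L) \<le> 2 ^ int_size ?d1 * (2 ^ int_size ?d2 * 2 ^ val_size (list_val (map encin L)))"
    using d Cons denom_pos[of "release x"] denom_pos[of "proc x"] common_denom_pos[of L] by (intro mult_mono) auto
  also have "\<dots> = 2 ^ (int_size ?d1 + (int_size ?d2 + val_size (list_val (map encin L))))" by (simp add: power_add)
  also have "\<dots> < 2 ^ val_size (list_val (map encin (x # L)))"
    by (intro power_strict_increasing) (auto simp: encin_def rat_val_def)
  finally show ?case by simp
qed simp

text \<open>Classes are at most as large as the input size, which makes stepping through them one by
  one in \<open>cls_code\<close> polynomial.\<close>

lemma cls_bound:
  assumes \<beta>: "2 \<le> \<beta>" and x: "0 < x" "x < 2 ^ s" "1 < x * 2 ^ s"
  shows "\<bar>cls \<beta> x\<bar> \<le> int s"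
proof -
  have b: "(2::real) ^ s \<le> real \<beta> ^ s" using \<beta> by (intro power_mono) auto
  have "x < real \<beta> powr s" using x b \<beta> by (simp add: powr_realpow)
  then have "log \<beta> x < s" using \<beta> x by (simp add: log_less_iff)
  moreover have "real \<beta> powr (- real s) < x"
  proof -
    have "1 < x * real \<beta> ^ s" using x b by (meson less_le_trans mult_left_mono less_imp_le)
    then show ?thesis using \<beta> by (simp add: powr_minus powr_realpow field_simps)
  qed
  then have "- real s < log \<beta> x" using \<beta> x by (simp add: less_log_iff)
  ultimately show ?thesis unfolding cls_def by linarith
qed

lemma ratio_bounds:
  fixes a b c :: real
  assumes "1 \<le> a" "1 \<le> b" "a < c" "b < c"
  shows "a / b < c" "1 < a / b * c"
proof -
  have "c * 1 \<le> c * b" using assms by (intro mult_left_mono) auto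
  then have "a < c * b" using assms by linarith
  then show "a / b < c" using assms(2) pos_divide_less_eq[of b a c] by simp
  have "1 * c \<le> a * c" using assms by (intro mult_right_mono) auto
  then have "b < a * c" using assms by linarith
  then show "1 < a / b * c" using assms(2) pos_less_divide_eq[of b 1 "a * c"] by simp
qed

text \<open>The size bound \<open>3 * s + 6\<close> is dictated by the times in the loop: they are
  at most \<open>(2 * n + 2) * R\<close>, which is below \<open>2 ^ (3 * s + 5)\<close>.\<close>

lemma main_runs:
  fixes n m :: nat and L :: "rat job list"
  assumes pos: "\<And>x. x \<in> set L \<Longrightarrow> 0 \<le> release x \<and> 0 < proc x" and len: "length L \<le> n"
  defines "\<beta> \<equiv> base n m" and "D \<equiv> common_denom L" and "s \<equiv> n + val_size (input_val n m L)"
  shows "runs prog (3 * s + 6) [input_val n m L] main_code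
    (encos D (outs (loop (m * \<beta>) (m div 2) (2 * n) (St (int_recs \<beta> D 0 L) 0 [] [] [] (rev [0..<min n m]) []))))
    (5000 * (s + 1) ^ 3)"
proof -
  let ?M = "3 * s + 6"
  let ?\<sigma> = "St (int_recs \<beta> D 0 L) 0 [] [] [] (rev [0..<min n m]) []"
  let ?L = "list_val (map encin L)"
  have iv: "input_val n m L = VPair (VNum (int n)) (VPair (VNum (int m)) ?L)"
    by (simp add: input_val_def encin_def[abs_def])
  have s: "n < s" "int_size (int m) \<le> s" "val_size ?L \<le> s" by (simp_all add: s_def iv)
  have small: "int_size a \<le> ?M" if "\<bar>a\<bar> < 2 ^ (3 * s + 5)" for a using int_size_leI[OF that] by simp
  have pw: "(2::int) ^ a \<le> 2 ^ b" if "a \<le> b" for a b using that by (intro power_increasing) auto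
  have n2: "int n < 2 ^ s"
  proof -
    have "n < 2 ^ s" using s(1) less_exp[of s] by linarith
    then have "int n < int (2 ^ s)" by (simp only: of_nat_less_iff)
    then show ?thesis by simp
  qed
  have m2: "int m < 2 ^ s" using abs_less_int_size[of "int m"] pw[OF s(2)] by linarith
  have D2: "D < 2 ^ s" "0 < D" using common_denom_less[of L] pw[OF s(3)] common_denom_pos[of L] unfolding D_def by linarith+
  have s1: "2 \<le> (2::int) ^ s" using s(1) pw[of 1 s] by simp
  have \<beta>: "2 \<le> \<beta>" "\<beta> \<le> n + 2" unfolding \<beta>_def by (rule base_spec) (rule base_upper)
  have "int \<beta> \<le> int n + 2" using \<beta>(2) by simp
  then have \<beta>2: "int \<beta> \<le> 2 ^ (s + 1)" using n2 s1 unfolding power_add power_one_right by linarith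
  have el: "0 \<le> numer (release x)" "0 < numer (proc x)" "0 < denom (release x)" "0 < denom (proc x)"
    "numer (release x) < 2 ^ s" "numer (proc x) < 2 ^ s" "denom (release x) < 2 ^ s" "denom (proc x) < 2 ^ s" if "x \<in> set L" for x
  proof -
    show *: "0 \<le> numer (release x)" "0 < numer (proc x)" "0 < denom (release x)" "0 < denom (proc x)"
      using pos[OF that] numer_nonneg numer_pos denom_pos by auto
    have b: "a < 2 ^ s" if "0 \<le> a" "int_size a \<le> val_size ?L" for a
    proof -
      have "int_size a \<le> s" using that s(3) by linarith
      from pw[OF this] show ?thesis using abs_less_int_size[of a] by linarith
    qed
    show "numer (release x) < 2 ^ s" "numer (proc x) < 2 ^ s" "denom (release x) < 2 ^ s" "denom (proc x) < 2 ^ s"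
      using element_size[OF that] * by (auto intro!: b)
  qed
  have prodD: "a * D < 2 ^ (2 * s)" if "0 \<le> a" "a < 2 ^ s" for a
  proof -
    have "a * D < 2 ^ s * 2 ^ s" using that D2 by (intro mult_strict_mono) auto
    then show ?thesis by (simp only: mult_2 power_add)
  qed
  have clsb: "\<bar>cls \<beta> (of_rat (proc x))\<bar> \<le> int s" if x: "x \<in> set L" for x
  proof (rule cls_bound[OF \<beta>(1)])
    let ?a = "real_of_int (numer (proc x))" and ?b = "real_of_int (denom (proc x))"
    have c: "real_of_int a < 2 ^ s" if "a < 2 ^ s" for a
    proof -
      have "real_of_int a < real_of_int (2 ^ s)" using that by (simp only: of_int_less_iff)
      then show ?thesis by simp
    qed
    have r: "1 \<le> ?a" "1 \<le> ?b" "?a < 2 ^ s" "?b < 2 ^ s"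
      using el(2,4)[OF x] c[OF el(6)[OF x]] c[OF el(8)[OF x]] by simp_all
    then show "0 < (of_rat (proc x) :: real)" by (simp add: of_rat_quotient)
    show "of_rat (proc x) < (2::real) ^ s" "1 < of_rat (proc x) * (2::real) ^ s"
      using ratio_bounds[OF r] by (simp_all only: of_rat_quotient)
  qed
  \<comment> \<open>Numerators and \<open>D\<close> are below \<open>2 ^ s\<close>, so scaled times
    stay below \<open>2 ^ (2 * s)\<close>. The extra factor 4 makes room for
    \<open>n + m * \<beta> + m div 2\<close>.\<close>
  define R :: int where "R = 2 ^ (2 * s + 2)"
  have dbl: "(2::int) ^ (2 * s) = 2 ^ s * 2 ^ s" by (simp only: mult_2 power_add)
  have R: "R = 4 * (2 ^ s * 2 ^ s)" by (simp only: R_def power_add dbl) simp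
  have sq: "2 ^ s * 2 \<le> (2::int) ^ s * 2 ^ s" by (rule mult_left_mono[OF s1]) simp
  have B: "int (m * \<beta>) \<le> 2 * (2 ^ s * 2 ^ s)"
  proof -
    have "int m * int \<beta> \<le> 2 ^ s * 2 ^ (s + 1)" using m2 \<beta>2 by (intro mult_mono) auto
    then show ?thesis by simp
  qed
  have Rsum: "int n + int (m * \<beta>) + int (m div 2) \<le> R"
  proof -
    have "int (m div 2) \<le> int m" by simp
    then show ?thesis using B R sq n2 m2 by linarith
  qed
  have s_small: "int s < 2 ^ s"
  proof -
    have "int s < int (2 ^ s)" by (simp only: of_nat_less_iff less_exp)
    then show ?thesis by simp
  qed
  have r10: "runs prog ?M [VPair (VNum (int n)) (VPair (VNum (int m)) (VNum 2))] base_code (VNum (int \<beta>)) (300 * (s + 1))"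
  proof -
    have "int ((m + 1) * (n + 2)\<^sup>2) < 2 ^ (3 * s + 5)"
    proof -
      have "int (m + 1) * int ((n + 2)\<^sup>2) \<le> 2 ^ s * (2 ^ (s + 1) * 2 ^ (s + 1))"
      proof -
        have "int (m + 1) \<le> 2 ^ s" using m2 by linarith
        moreover have n2': "int (n + 2) \<le> 2 ^ (s + 1)" using n2 s1 unfolding power_add power_one_right by linarith
        moreover have "int (n + 2) * int (n + 2) \<le> 2 ^ (s + 1) * 2 ^ (s + 1)" by (intro mult_mono n2') auto
        ultimately show ?thesis unfolding power2_eq_square of_nat_mult by (intro mult_mono) auto
      qed
      also have "\<dots> = 2 ^ (s + (s + 1) + (s + 1))" by (simp only: power_add mult.assoc)
      also have "\<dots> < 2 ^ (3 * s + 5)" by (intro power_strict_increasing) auto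
      finally show ?thesis by (simp only: of_nat_mult)
    qed
    then have "int_size (int ((m + 1) * (n + 2)\<^sup>2)) \<le> ?M" by (intro small) linarith
    from base_runs[OF this, of 2] have "runs prog ?M [VPair (VNum (int n)) (VPair (VNum (int m)) (VNum (int 2)))] base_code
        (VNum (int \<beta>)) (100 * (\<beta> - 2 + 1))" using \<beta>(1) by (simp add: \<beta>_def)
    moreover have "100 * (\<beta> - 2 + 1) \<le> 300 * (s + 1)" using \<beta> s(1) by simp
    ultimately show ?thesis unfolding of_nat_numeral of_nat_0 by (rule runs_mono)
  qed
  have p5: "(2::int) ^ s \<le> 2 ^ (3 * s + 5)" by (rule pw) simp
  have DM: "int_size D \<le> ?M" using D2 p5 by (intro small) linarith
  have r13: "runs prog ?M [?L] denom_code (VNum D) (50 * (s + 1))"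
  proof -
    have "runs prog ?M [?L] denom_code (VNum D) (50 * (length L + 1))"
      using DM unfolding D_def by (intro common_denom_runs) auto
    moreover have "50 * (length L + 1) \<le> 50 * (s + 1)" using len s(1) by simp
    ultimately show ?thesis by (rule runs_mono)
  qed
  have nM: "int_size (int n) \<le> ?M" "int_size (int m) \<le> ?M" 
  proof -
    have "(2::int) ^ s \<le> 2 ^ (3 * s + 5)" by (rule pw) simp
    then show "int_size (int n) \<le> ?M" "int_size (int m) \<le> ?M" using n2 m2 by (intro small; linarith)+
  qed
  have r11: "runs prog ?M [VNum (int (min n m))] upto_code (encns (rev [0..<min n m])) (50 * (s + 1))"
  proof -
    have "int_size (int (min n m)) \<le> ?M" using nM by (simp add: min_def)
    then have "runs prog ?M [VNum (int (min n m))] upto_code (encns (rev [0..<min n m])) (50 * (min n m + 1))"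
      by (intro upto_runs) auto
    moreover have "50 * (min n m + 1) \<le> 50 * (s + 1)" using s(1) by simp
    ultimately show ?thesis by (rule runs_mono)
  qed
  let ?rec = "VPair (VPair (VNum D) (VNum (int \<beta>))) (VPair (VNum 0) ?L)"
  have r14: "runs prog ?M [?rec] recs_code (encjs (int_recs \<beta> D 0 L)) ((s + 1) * (50 * (s + 1) + 100))"
  proof -
    define Y :: int where "Y = 2 ^ (2 * s + 1)"
    have "Y < 2 ^ (3 * s + 5)" unfolding Y_def by (rule power_strict_increasing) auto
    moreover have "0 \<le> Y" by (simp add: Y_def)
    ultimately have YM: "int_size Y \<le> ?M" by (intro small) linarith
    have sM: "int_size (int s) \<le> ?M" using s_small p5 by (intro small) linarith
    have Yb: "a * int \<beta> \<le> Y" if "0 \<le> a" "a < 2 ^ s" for a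
    proof -
      have "a * int \<beta> \<le> 2 ^ s * 2 ^ (s + 1)" using that \<beta>2 by (intro mult_mono) auto
      then show ?thesis by (simp only: Y_def power_add dbl mult.assoc)
    qed
    have sm: "int_size a \<le> ?M" if "0 \<le> a" "a < 2 ^ s" for a using that p5 by (intro small) linarith
    have smD: "int_size (a * D) \<le> ?M" if "0 \<le> a" "a < 2 ^ s" for a
    proof -
      have "(2::int) ^ (2 * s) \<le> 2 ^ (3 * s + 5)" by (rule pw) simp
      moreover have "0 \<le> a * D" using that(1) D2(2) by simp
      ultimately show ?thesis using prodD[OF that] by (intro small) linarith
    qed
    have lM: "int_size (int (0 + length L)) \<le> ?M" using len n2 by (intro sm) auto
    have hyp: "\<forall>x\<in>set L. 0 < proc x \<and> int_size (numer (release x)) \<le> ?M \<and> int_size (numer (release x) * D) \<le> ?M \<and>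
      int_size (denom (release x)) \<le> ?M \<and> int_size (numer (proc x) * D) \<le> ?M \<and> numer (proc x) * int \<beta> \<le> Y \<and>
      denom (proc x) * int \<beta> \<le> Y \<and> \<bar>cls \<beta> (of_rat (proc x))\<bar> \<le> int s"
    proof
      fix x assume x: "x \<in> set L"
      note e = el[OF x]
      show "0 < proc x \<and> int_size (numer (release x)) \<le> ?M \<and> int_size (numer (release x) * D) \<le> ?M \<and>
      int_size (denom (release x)) \<le> ?M \<and> int_size (numer (proc x) * D) \<le> ?M \<and> numer (proc x) * int \<beta> \<le> Y \<and>
      denom (proc x) * int \<beta> \<le> Y \<and> \<bar>cls \<beta> (of_rat (proc x))\<bar> \<le> int s"
        using pos[OF x] clsb[OF x] sm[OF e(1,5)] smD[OF e(1,5)] sm[OF less_imp_le[OF e(3)] e(7)]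
          smD[OF less_imp_le[OF e(2)] e(6)] Yb[OF less_imp_le[OF e(2)] e(6)] Yb[OF less_imp_le[OF e(4)] e(8)] by blast
    qed
    have "runs prog ?M [VPair (VPair (VNum D) (VNum (int \<beta>))) (VPair (VNum (int 0)) ?L)] recs_code (encjs (int_recs \<beta> D 0 L))
        ((length L + 1) * (50 * (s + 1) + 100))"
      by (rule int_recs_runs[OF \<beta>(1) _ YM sM DM hyp lM]) simp
    moreover have "(length L + 1) * (50 * (s + 1) + 100) \<le> (s + 1) * (50 * (s + 1) + 100)"
      using len s(1) by (intro mult_right_mono) auto
    ultimately show ?thesis unfolding of_nat_numeral of_nat_0 by (rule runs_mono)
  qed
  let ?ctx = "VPair (VNum (int (m * \<beta>))) (VPair (VNum (int (m div 2))) (VNum D))"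
  let ?fin = "loop (m * \<beta>) (m div 2) (2 * n) ?\<sigma>"
  have r9: "runs prog ?M [VPair (VNum (int (2 * n))) (VPair ?ctx (encst D ?\<sigma>))] loop_code (encst D ?fin)
      ((2 * s + 1) * (2000 * (s + 1) ^ 2 + 50))"
  proof -
    have "bounded_state R n 0 ?\<sigma>"
      unfolding bounded_state_def state.sel
    proof (intro conjI ballI)
      fix j assume "j \<in> set (int_recs \<beta> D 0 L) \<union> set [] \<union> set [] \<union> ejob ` set []"
      then obtain i where i: "i < length L" "j = int_recs \<beta> D 0 L ! i" by (auto simp: in_set_conv_nth)
      define x where "x = L ! i"
      have x: "x \<in> set L" using i by (simp add: x_def)
      have j: "jrel j = numer (release x) * D div denom (release x)" "jproc j = numer (proc x) * D div denom (proc x)"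
        "jcls j = cls \<beta> (of_rat (proc x))" using i by (simp_all add: nth_int_recs x_def)
      have q: "0 \<le> a * D div b \<and> a * D div b \<le> R" if "0 \<le> a" "a < 2 ^ s" "0 < b" for a b
      proof -
        have "a * D div b \<le> a * D div 1" using that D2 by (intro zdiv_mono2) auto
        then have "a * D div b \<le> a * D" by simp
        moreover have "a * D \<le> R" using prodD[OF that(1,2)] pw[of "2 * s" "2 * s + 2"] unfolding R_def by linarith
        ultimately show ?thesis using that D2 by (simp add: pos_imp_zdiv_nonneg_iff)
      qed
      show "0 \<le> jrel j" "jrel j \<le> R" "0 \<le> jproc j" "jproc j \<le> R"
        unfolding j using q el[OF x] by (auto simp: less_imp_le)
      show "\<bar>jcls j\<bar> \<le> R" unfolding j using clsb[OF x] s_small sq R s1 by linarith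
    qed (use len in auto)
    moreover have "int_size ((int 0 + int (2 * n) + 2) * R) \<le> ?M"
    proof (rule small)
      have "(2::int) ^ (s + 2) = 4 * 2 ^ s" by (simp add: power_add)
      then have "int 0 + int (2 * n) + 2 \<le> 2 ^ (s + 2)" using n2 s1 by linarith
      then have "(int 0 + int (2 * n) + 2) * R \<le> 2 ^ (s + 2) * R"
        by (rule mult_right_mono) (simp add: R_def)
      also have "\<dots> = 2 ^ (s + 2 + (2 * s + 2))" by (simp only: R_def power_add)
      also have "\<dots> < 2 ^ (3 * s + 5)" by (intro power_strict_increasing) auto
      finally show "\<bar>(int 0 + int (2 * n) + 2) * R\<bar> < 2 ^ (3 * s + 5)" by (simp add: R_def)
    qed
    moreover have "int_size (int (2 * n)) \<le> ?M"
    proof -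
      have "(2::int) ^ (s + 1) \<le> 2 ^ (3 * s + 5)" by (rule pw) simp
      moreover have "(2::int) ^ (s + 1) = 2 * 2 ^ s" by simp
      ultimately show ?thesis using n2 by (intro small) linarith
    qed
    ultimately have "runs prog ?M [VPair (VNum (int (2 * n))) (VPair ?ctx (encst D ?\<sigma>))] loop_code (encst D ?fin)
        ((2 * n + 1) * (2000 * (n + 1) ^ 2 + 50))"
      by (intro loop_runs[OF Rsum]) auto
    moreover have "(2 * n + 1) * (2000 * (n + 1) ^ 2 + 50) \<le> (2 * s + 1) * (2000 * (s + 1) ^ 2 + 50)"
      using s(1) by (intro mult_mono add_mono power_mono) auto
    ultimately show ?thesis by (rule runs_mono)
  qed
  let ?C = "[((10, VPair (VNum (int n)) (VPair (VNum (int m)) (VNum 2))), (VNum (int \<beta>), 300 * (s + 1))),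
    ((13, ?L), (VNum D, 50 * (s + 1))),
    ((11, VNum (int (min n m))), (encns (rev [0..<min n m]), 50 * (s + 1))),
    ((14, ?rec), (encjs (int_recs \<beta> D 0 L), (s + 1) * (50 * (s + 1) + 100))),
    ((9, VPair (VNum (int (2 * n))) (VPair ?ctx (encst D ?\<sigma>))), (encst D ?fin, (2 * s + 1) * (2000 * (s + 1) ^ 2 + 50)))]"
  have bM: "int_size (int \<beta>) \<le> ?M" 
  proof -
    have "(2::int) ^ (s + 1) < 2 ^ (3 * s + 5)" by (intro power_strict_increasing) auto
    then show ?thesis using \<beta>2 by (intro small) linarith
  qed
  show ?thesis
  proof (rule runsI[of ?C])
    show "\<forall>((f, v), (w, k))\<in>set ?C. f < length prog \<and> runs prog ?M [v] (prog ! f) w k"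
      using r9 r10 r11 r13 r14 by simp
    define u where "u = s + 1"
    have u: "1 \<le> u" "u \<le> u * u" "u * u \<le> u * (u * u)" by (simp_all add: u_def)
    have "(2 * s + 1) * (2000 * (s + 1) ^ 2 + 50) \<le> (2 * u) * (2000 * (u * u) + 50)"
      by (intro mult_mono) (auto simp: u_def power2_eq_square)
    also have "\<dots> = 4000 * (u * (u * u)) + 100 * u" by (simp add: algebra_simps)
    finally have X: "(2 * s + 1) * (2000 * u ^ 2 + 50) \<le> 4000 * (u * (u * u)) + 100 * u" by (simp only: u_def)
    have "u * (50 * u + 100) = 50 * (u * u) + 100 * u" "u ^ 3 = u * (u * u)"
      by (simp_all add: algebra_simps power3_eq_cube)
    then have cost: "300 * (s + 1) + 50 * (s + 1) + 50 * (s + 1) + (s + 1) * (50 * (s + 1) + 100) +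
        (2 * s + 1) * (2000 * (s + 1) ^ 2 + 50) + 200 \<le> 5000 * (s + 1) ^ 3"
      unfolding u_def[symmetric] using X u by linarith
    show "case ev ?C ?M [input_val n m L] main_code of None \<Rightarrow> False
      | Some (w', k') \<Rightarrow> w' = encos D (outs ?fin) \<and> k' \<le> 5000 * (s + 1) ^ 3"
      using cost nM bM by (cases "n < m") (simp_all add: main_code_def iv encst_def min_def zdiv_int)
  qed
qed

lemma alg_polynomial_time: "polynomial_time alg"
  unfolding polynomial_time_def
proof (rule exI[of _ prog], rule exI[of _ 760002], rule exI[of _ 4], intro allI impI, elim conjE)
  fix n m :: nat and L :: "rat job list"
  assume inst: "is_instance (map real_job L)" and len: "length L \<le> n"
  define D where "D = common_denom L"
  define s where "s = n + val_size (input_val n m L)"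
  let ?f = "\<lambda>a. real_of_int a / real_of_int D"
  have D0: "0 < D" by (simp add: D_def common_denom_pos)
  interpret time_embedding ?f
    by unfold_locales (use D0 in \<open>auto simp: add_divide_distrib divide_less_cancel\<close>)
  let ?fin = "loop (m * base n m) (m div 2) (2 * n) (St (int_recs (base n m) D 0 L) 0 [] [] [] (rev [0..<min n m]) [])"
  have pos: "0 \<le> release x \<and> 0 < proc x" if "x \<in> set L" for x
  proof -
    have "real_job x \<in> set (map real_job L)" using that by simp
    then have "0 \<le> release (real_job x) \<and> 0 < proc (real_job x)" using inst unfolding is_instance_def by blast
    then show ?thesis by (simp add: real_job_def)
  qed
  have "runs prog (3 * s + 6) [input_val n m L] main_code (encos D (outs ?fin)) (5000 * (s + 1) ^ 3)"
    unfolding D_def s_def by (rule main_runs[OF pos len])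
  then obtain t where t: "big_step prog [input_val n m L] main_code (encos D (outs ?fin)) t"
    "t \<le> 5000 * (s + 1) ^ 3 * (2 * (3 * s + 6) + 1)" unfolding runs_def by blast
  have "big_step prog [input_val n m L] (EVar 0) ([input_val n m L] ! 0) 1" by (rule big_step.Var) simp
  then have run: "runs_in prog (input_val n m L) (encos D (outs ?fin)) (1 + t + 1)"
    unfolding runs_in_def using t(1) by (intro big_step.Call) simp_all
  have "alg n m (map real_job L) = orun_run ` set (outs (map_state ?f ?fin))"
  proof -
    have "St (jrecs (base n m) (map real_job L)) 0 [] [] [] (rev [0..<min n m]) [] =
      map_state ?f (St (int_recs (base n m) D 0 L) 0 [] [] [] (rev [0..<min n m]) [])"
      by (simp add: jrecs_int_recs D_def)
    then show ?thesis unfolding alg_def by (simp only: loop_map)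
  qed
  also have "\<dots> = set (map (\<lambda>a. orun_run (map_orun ?f a)) (outs ?fin))"
    by (simp add: state.map_sel image_image)
  finally have eq: "alg n m (map real_job L) = set (map (\<lambda>a. orun_run (map_orun ?f a)) (outs ?fin))" .
  have "represents_run (enco D a) (orun_run (map_orun ?f a))" for a
    using D0 by (force simp: represents_run_def represents_real_def enco_def orun.map_sel)
  then have rep: "represents_schedule (encos D (outs ?fin)) (alg n m (map real_job L))"
    unfolding represents_schedule_def eq
    by (intro exI[of _ "map (enco D) (outs ?fin)"] exI[of _ "map (\<lambda>a. orun_run (map_orun ?f a)) (outs ?fin)"])
      (simp add: list_all2_conv_all_nth)
  have s1: "1 \<le> s" by (simp add: s_def input_val_def)
  have "1 + t + 1 \<le> 2 + 5000 * (s + 1) ^ 3 * (2 * (3 * s + 6) + 1)" using t(2) by simp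
  \<comment> \<open>From \<open>1 \<le> s\<close> follow \<open>s + 1 \<le> 2 * s\<close> and
    \<open>6 * s + 13 \<le> 19 * s\<close>; the constant is
    \<open>2 + 5000 * 8 * 19\<close>.\<close>
  also have "\<dots> \<le> 2 * s ^ 4 + 5000 * (2 * s) ^ 3 * (19 * s)"
    using s1 by (intro add_mono mult_mono power_mono) (auto simp: one_le_power)
  also have "\<dots> = 760002 * s ^ 4" by (simp add: power_mult_distrib power4_eq_xxxx power3_eq_cube)
  finally show "\<exists>v t. runs_in prog (input_val n m L) v t \<and> represents_schedule v (alg n m (map real_job L)) \<and>
      t \<le> 760002 * (n + val_size (input_val n m L)) ^ 4"
    using run rep unfolding s_def by blast
qed

text \<open>For \<open>n < m\<close> the quotient is below 1, while no schedule beats the preemptive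
  optimum; hence the maximum with 1. The constant obtained is 66, the 33 of \<open>flow_le\<close>
  times the 2 of \<open>base_le\<close>.\<close>

theorem mainTheorem7:
  shows "\<exists>A :: nat \<Rightarrow> nat \<Rightarrow> real job list \<Rightarrow> schedule.
     polynomial_time A \<and>
     (\<forall>n m. 2 \<le> m \<longrightarrow> kill_restart_online n m (A n m)) \<and>
     (\<exists>c::real. \<forall>n m. 2 \<le> m \<longrightarrow> competitive n m (c * max 1 (sqrt (real n / real m))) (A n m))"
  using alg_polynomial_time alg_kill_restart_online alg_competitive by blast

end
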